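(* Let $M$ and $N$ be finitely presented persistence modules. Then $$|M|\cdot|N| = |M\otimes N|-|\mathrm{Tor}_1(M,N)|,$$ where $|\cdot|$ denotes persistent magnitude.
   Context: Fix a field $\Bbbk$. A persistence module is a functor $(\mathbb{R},\le)\to\mathbf{Vect}_\Bbbk$. The interval module $\Bbbk[a,b)$ ($-\infty<a<b\le\infty$) is $\Bbbk$ at points of $[a,b)$ and $0$ elsewhere, with identity structure maps between points of $[a,b)$. A persistence module is finitely presented if and only if it is isomorphic to a finite direct sum of interval modules $\Bbbk[a,b)$. The persistent magnitude of a finitely presented $M\cong\bigoplus_{i=1}^n\Bbbk[a_i,b_i)$ is $|M|=\sum_{i=1}^n(e^{-a_i}-e^{-b_i})$, with the convention $e^{-\infty}=0$. The tensor product of persistence modules is $(M\otimes N)(s)=\operatorname{colim}_{s_1+s_2\le s}M(s_1)\otimes_\Bbbk N(s_2)$. Tensoring with a fixed persistence module is right exact, and $\mathrm{Tor}_i(M,N)$ denotes the resulting left derived functors, with $\mathrm{Tor}_0(M,N)=M\otimes N$. *)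

theory Defs
  imports
    Complex_Main
    "HOL-Library.Extended_Real"
    "HOL-Algebra.Module"
    "HOL-Algebra.AbelCoset"
begin

text \<open>
  Vector spaces over a field \<open>K\<close> are modules over \<open>K\<close> in the sense of the locale
  \<^locale>\<open>module\<close> of HOL-Algebra. Every linear structure below only uses the additive part and the
  scalar multiplication of the record \<^type>\<open>module\<close>, so its fields \<^const>\<open>mult\<close> and
  \<^const>\<open>one\<close> are irrelevant.
\<close>

section \<open>Constructions with vector spaces\<close>

definition lin_maps ::
  "('k, 'm) ring_scheme \<Rightarrow> ('k, 'a) module \<Rightarrow> ('k, 'b) module \<Rightarrow> ('a \<Rightarrow> 'b) set" where
  "lin_maps K V W = {f \<in> carrier V \<rightarrow> carrier W.
     (\<forall>x\<in>carrier V. \<forall>y\<in>carrier V. f (x \<oplus>\<^bsub>V\<^esub> y) = f x \<oplus>\<^bsub>W\<^esub> f y) \<and>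
     (\<forall>c\<in>carrier K. \<forall>x\<in>carrier V. f (c \<odot>\<^bsub>V\<^esub> x) = c \<odot>\<^bsub>W\<^esub> f x)}"

definition lin_span :: "('k, 'm) ring_scheme \<Rightarrow> ('k, 'a) module \<Rightarrow> 'a set \<Rightarrow> 'a set" where
  "lin_span K V S = \<Inter> {H. submodule H K V \<and> S \<subseteq> H}"

definition quot_space :: "('k, 'a) module \<Rightarrow> 'a set \<Rightarrow> ('k, 'a set) module" where
  "quot_space V W =
    \<lparr> carrier = a_rcosets\<^bsub>V\<^esub> W, mult = undefined, one = undefined, zero = W,
      add = (\<lambda>X Y. X <+>\<^bsub>V\<^esub> Y),
      smult = (\<lambda>c X. W <+>\<^bsub>V\<^esub> ((\<lambda>x. c \<odot>\<^bsub>V\<^esub> x) ` X)) \<rparr>"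

text \<open>
  For a linear map \<open>f\<close> from \<open>V\<close> to \<open>V'\<close> with \<open>f ` W \<subseteq> W'\<close>, the map induced by \<open>f\<close> from
  \<open>V / W\<close> to \<open>V' / W'\<close>: it sends the coset \<open>W + x\<close> to \<open>W' + f ` (W + x) = W' + f x\<close>.
\<close>

definition quot_map :: "('k, 'b) module \<Rightarrow> 'b set \<Rightarrow> ('a \<Rightarrow> 'b) \<Rightarrow> 'a set \<Rightarrow> 'b set" where
  "quot_map V' W' f X = W' <+>\<^bsub>V'\<^esub> (f ` X)"

definition free_space :: "('k, 'm) ring_scheme \<Rightarrow> 'a set \<Rightarrow> ('k, 'a \<Rightarrow> 'k) module" where
  "free_space K S =
    \<lparr> carrier = {h. (\<forall>x\<in>S. h x \<in> carrier K) \<and> (\<forall>x. x \<notin> S \<longrightarrow> h x = \<zero>\<^bsub>K\<^esub>) \<and>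
                    finite {x. h x \<noteq> \<zero>\<^bsub>K\<^esub>}},
      mult = undefined, one = undefined, zero = (\<lambda>_. \<zero>\<^bsub>K\<^esub>),
      add = (\<lambda>h h' x. h x \<oplus>\<^bsub>K\<^esub> h' x),
      smult = (\<lambda>c h x. c \<otimes>\<^bsub>K\<^esub> h x) \<rparr>"

definition free_gen :: "('k, 'm) ring_scheme \<Rightarrow> 'a \<Rightarrow> 'a \<Rightarrow> 'k" where
  "free_gen K x = (\<lambda>y. if y = x then \<one>\<^bsub>K\<^esub> else \<zero>\<^bsub>K\<^esub>)"

text \<open>The linear extension of a map \<open>\<phi>\<close> between bases.\<close>

definition free_map :: "('k, 'm) ring_scheme \<Rightarrow> ('a \<Rightarrow> 'b) \<Rightarrow> ('a \<Rightarrow> 'k) \<Rightarrow> 'b \<Rightarrow> 'k" where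
  "free_map K \<phi> h = (\<lambda>y. \<Oplus>\<^bsub>K\<^esub>x\<in>{x. h x \<noteq> \<zero>\<^bsub>K\<^esub> \<and> \<phi> x = y}. h x)"

text \<open>
  The tensor product of two vector spaces: the free vector space on the pairs \<open>(v, w)\<close>
  modulo the bilinearity relations.
\<close>

definition tensor_rels ::
  "('k, 'm) ring_scheme \<Rightarrow> ('k, 'a) module \<Rightarrow> ('k, 'b) module \<Rightarrow> ('a \<times> 'b \<Rightarrow> 'k) set" where
  "tensor_rels K V W =
    (let F = free_space K (carrier V \<times> carrier W) in
      {free_gen K (v \<oplus>\<^bsub>V\<^esub> v', w) \<ominus>\<^bsub>F\<^esub> (free_gen K (v, w) \<oplus>\<^bsub>F\<^esub> free_gen K (v', w)) | v v' w.
         v \<in> carrier V \<and> v' \<in> carrier V \<and> w \<in> carrier W} \<union>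
      {free_gen K (v, w \<oplus>\<^bsub>W\<^esub> w') \<ominus>\<^bsub>F\<^esub> (free_gen K (v, w) \<oplus>\<^bsub>F\<^esub> free_gen K (v, w')) | v w w'.
         v \<in> carrier V \<and> w \<in> carrier W \<and> w' \<in> carrier W} \<union>
      {free_gen K (c \<odot>\<^bsub>V\<^esub> v, w) \<ominus>\<^bsub>F\<^esub> (c \<odot>\<^bsub>F\<^esub> free_gen K (v, w)) | c v w.
         c \<in> carrier K \<and> v \<in> carrier V \<and> w \<in> carrier W} \<union>
      {free_gen K (v, c \<odot>\<^bsub>W\<^esub> w) \<ominus>\<^bsub>F\<^esub> (c \<odot>\<^bsub>F\<^esub> free_gen K (v, w)) | c v w.
         c \<in> carrier K \<and> v \<in> carrier V \<and> w \<in> carrier W})"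

definition tensor_null ::
  "('k, 'm) ring_scheme \<Rightarrow> ('k, 'a) module \<Rightarrow> ('k, 'b) module \<Rightarrow> ('a \<times> 'b \<Rightarrow> 'k) set" where
  "tensor_null K V W = lin_span K (free_space K (carrier V \<times> carrier W)) (tensor_rels K V W)"

definition tensor_space ::
  "('k, 'm) ring_scheme \<Rightarrow> ('k, 'a) module \<Rightarrow> ('k, 'b) module
     \<Rightarrow> ('k, ('a \<times> 'b \<Rightarrow> 'k) set) module" where
  "tensor_space K V W = quot_space (free_space K (carrier V \<times> carrier W)) (tensor_null K V W)"

text \<open>The map \<open>f \<otimes> g\<close>; the arguments \<open>V'\<close> and \<open>W'\<close> are the codomains of \<open>f\<close> and \<open>g\<close>.\<close>

definition tensor_map ::
  "('k, 'm) ring_scheme \<Rightarrow> ('k, 'c) module \<Rightarrow> ('k, 'd) module \<Rightarrow> ('a \<Rightarrow> 'c) \<Rightarrow> ('b \<Rightarrow> 'd)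
     \<Rightarrow> ('a \<times> 'b \<Rightarrow> 'k) set \<Rightarrow> ('c \<times> 'd \<Rightarrow> 'k) set" where
  "tensor_map K V' W' f g =
     quot_map (free_space K (carrier V' \<times> carrier W')) (tensor_null K V' W')
       (free_map K (map_prod f g))"

text \<open>
  The direct sum of the spaces \<open>V i\<close> with \<open>i \<in> I\<close>. Its elements vanish outside \<open>I\<close>, so for
  \<open>I \<subseteq> J\<close> the canonical inclusion of the sum over \<open>I\<close> into the sum over \<open>J\<close> is the identity.
\<close>

definition dsum_space :: "'i set \<Rightarrow> ('i \<Rightarrow> ('k, 'a) module) \<Rightarrow> ('k, 'i \<Rightarrow> 'a) module" where
  "dsum_space I V =
    \<lparr> carrier = {h. (\<forall>i\<in>I. h i \<in> carrier (V i)) \<and> (\<forall>i. i \<notin> I \<longrightarrow> h i = \<zero>\<^bsub>V i\<^esub>) \<and>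
                    finite {i. h i \<noteq> \<zero>\<^bsub>V i\<^esub>}},
      mult = undefined, one = undefined, zero = (\<lambda>i. \<zero>\<^bsub>V i\<^esub>),
      add = (\<lambda>h h' i. if i \<in> I then h i \<oplus>\<^bsub>V i\<^esub> h' i else \<zero>\<^bsub>V i\<^esub>),
      smult = (\<lambda>c h i. if i \<in> I then c \<odot>\<^bsub>V i\<^esub> h i else \<zero>\<^bsub>V i\<^esub>) \<rparr>"

definition dsum_inj :: "('i \<Rightarrow> ('k, 'a) module) \<Rightarrow> 'i \<Rightarrow> 'a \<Rightarrow> 'i \<Rightarrow> 'a" where
  "dsum_inj V i x = (\<lambda>j. if j = i then x else \<zero>\<^bsub>V j\<^esub>)"

definition dsum_map ::
  "'i set \<Rightarrow> ('i \<Rightarrow> ('k, 'b) module) \<Rightarrow> ('i \<Rightarrow> 'a \<Rightarrow> 'b) \<Rightarrow> ('i \<Rightarrow> 'a) \<Rightarrow> 'i \<Rightarrow> 'b" where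
  "dsum_map I V' \<phi> h = (\<lambda>i. if i \<in> I then \<phi> i (h i) else \<zero>\<^bsub>V' i\<^esub>)"

text \<open>
  The colimit of a diagram \<open>V\<close> indexed by a set \<open>I\<close> preordered by \<open>r\<close>, with transition maps
  \<open>u i j\<close> from \<open>V i\<close> to \<open>V j\<close>, is the quotient of \<open>dsum_space I V\<close> by the following subspace.
\<close>

definition colim_null ::
  "('k, 'm) ring_scheme \<Rightarrow> 'i set \<Rightarrow> ('i \<Rightarrow> 'i \<Rightarrow> bool) \<Rightarrow> ('i \<Rightarrow> ('k, 'a) module)
     \<Rightarrow> ('i \<Rightarrow> 'i \<Rightarrow> 'a \<Rightarrow> 'a) \<Rightarrow> ('i \<Rightarrow> 'a) set" where
  "colim_null K I r V u = lin_span K (dsum_space I V)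
     {dsum_inj V j (u i j x) \<ominus>\<^bsub>dsum_space I V\<^esub> dsum_inj V i x | i j x.
        i \<in> I \<and> j \<in> I \<and> r i j \<and> x \<in> carrier (V i)}"

definition colim_space ::
  "('k, 'm) ring_scheme \<Rightarrow> 'i set \<Rightarrow> ('i \<Rightarrow> 'i \<Rightarrow> bool) \<Rightarrow> ('i \<Rightarrow> ('k, 'a) module)
     \<Rightarrow> ('i \<Rightarrow> 'i \<Rightarrow> 'a \<Rightarrow> 'a) \<Rightarrow> ('k, ('i \<Rightarrow> 'a) set) module" where
  "colim_space K I r V u = quot_space (dsum_space I V) (colim_null K I r V u)"


section \<open>Persistence modules\<close>

record ('k, 'a) persmod =
  pm_ob :: "real \<Rightarrow> ('k, 'a) module"
  pm_tr :: "real \<Rightarrow> real \<Rightarrow> 'a \<Rightarrow> 'a"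

text \<open>The value of \<open>pm_tr M s t\<close> is only meaningful for \<open>s \<le> t\<close>.\<close>

locale persistence_module = field K for K :: "('k, 'm) ring_scheme" (structure) +
  fixes M :: "('k, 'a) persmod"
  assumes ob_module: "\<And>t. module K (pm_ob M t)"
    and tr_linear: "\<And>s t. s \<le> t \<Longrightarrow> pm_tr M s t \<in> lin_maps K (pm_ob M s) (pm_ob M t)"
    and tr_refl: "\<And>t x. x \<in> carrier (pm_ob M t) \<Longrightarrow> pm_tr M t t x = x"
    and tr_trans: "\<And>r s t x. r \<le> s \<Longrightarrow> s \<le> t \<Longrightarrow> x \<in> carrier (pm_ob M r)
      \<Longrightarrow> pm_tr M s t (pm_tr M r s x) = pm_tr M r t x"

definition pm_homs ::
  "('k, 'm) ring_scheme \<Rightarrow> ('k, 'a) persmod \<Rightarrow> ('k, 'b) persmod \<Rightarrow> (real \<Rightarrow> 'a \<Rightarrow> 'b) set" where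
  "pm_homs K M N = {\<phi>.
     (\<forall>t. \<phi> t \<in> lin_maps K (pm_ob M t) (pm_ob N t)) \<and>
     (\<forall>s t. s \<le> t \<longrightarrow>
        (\<forall>x\<in>carrier (pm_ob M s). \<phi> t (pm_tr M s t x) = pm_tr N s t (\<phi> s x)))}"

definition pm_epi ::
  "('k, 'a) persmod \<Rightarrow> ('k, 'b) persmod \<Rightarrow> (real \<Rightarrow> 'a \<Rightarrow> 'b) \<Rightarrow> bool" where
  "pm_epi M N \<phi> \<longleftrightarrow> (\<forall>t. \<phi> t ` carrier (pm_ob M t) = carrier (pm_ob N t))"

definition pm_isomorphic ::
  "('k, 'm) ring_scheme \<Rightarrow> ('k, 'a) persmod \<Rightarrow> ('k, 'b) persmod \<Rightarrow> bool" where
  "pm_isomorphic K M N \<longleftrightarrow>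
     (\<exists>\<phi>\<in>pm_homs K M N. \<forall>t. bij_betw (\<phi> t) (carrier (pm_ob M t)) (carrier (pm_ob N t)))"

text \<open>Exactness of \<open>L \<rightarrow> M \<rightarrow> N\<close> at \<open>M\<close>, for maps \<open>\<phi>\<close> and \<open>\<psi>\<close>.\<close>

definition pm_exact ::
  "('k, 'a) persmod \<Rightarrow> ('k, 'b) persmod \<Rightarrow> ('k, 'c) persmod
     \<Rightarrow> (real \<Rightarrow> 'a \<Rightarrow> 'b) \<Rightarrow> (real \<Rightarrow> 'b \<Rightarrow> 'c) \<Rightarrow> bool" where
  "pm_exact L M N \<phi> \<psi> \<longleftrightarrow>
     (\<forall>t. \<phi> t ` carrier (pm_ob L t) = a_kernel (pm_ob M t) (pm_ob N t) (\<psi> t))"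

definition pm_dsum :: "'i set \<Rightarrow> ('i \<Rightarrow> ('k, 'a) persmod) \<Rightarrow> ('k, 'i \<Rightarrow> 'a) persmod" where
  "pm_dsum I M =
    \<lparr> pm_ob = (\<lambda>t. dsum_space I (\<lambda>i. pm_ob (M i) t)),
      pm_tr = (\<lambda>s t. dsum_map I (\<lambda>i. pm_ob (M i) t) (\<lambda>i. pm_tr (M i) s t)) \<rparr>"

definition interval_module :: "('k, 'm) ring_scheme \<Rightarrow> real \<Rightarrow> ereal \<Rightarrow> ('k, 'k) persmod" where
  "interval_module K a b =
    (let J = {t. a \<le> t \<and> ereal t < b} in
      \<lparr> pm_ob = (\<lambda>t. \<lparr> carrier = (if t \<in> J then carrier K else {\<zero>\<^bsub>K\<^esub>}),
                       mult = mult K, one = one K, zero = zero K, add = add K,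
                       smult = mult K \<rparr>),
        pm_tr = (\<lambda>s t x. if s \<in> J \<and> t \<in> J then x else \<zero>\<^bsub>K\<^esub>) \<rparr>)"

definition interval_sum ::
  "('k, 'm) ring_scheme \<Rightarrow> nat \<Rightarrow> (nat \<Rightarrow> real) \<Rightarrow> (nat \<Rightarrow> ereal) \<Rightarrow> ('k, nat \<Rightarrow> 'k) persmod" where
  "interval_sum K n a b = pm_dsum {..<n} (\<lambda>i. interval_module K (a i) (b i))"

text \<open>
  Finitely generated free persistence modules are the finite direct sums of modules
  \<open>K[a, \<infinity>)\<close>; finite presentability is the existence of an exact sequence
  \<open>F1 \<rightarrow> F0 \<rightarrow> M \<rightarrow> 0\<close> with \<open>F0\<close> and \<open>F1\<close> finitely generated free.
\<close>

definition fg_free :: "('k, 'm) ring_scheme \<Rightarrow> nat \<Rightarrow> (nat \<Rightarrow> real) \<Rightarrow> ('k, nat \<Rightarrow> 'k) persmod" where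
  "fg_free K n a = interval_sum K n a (\<lambda>_. \<infinity>)"

definition finitely_presented :: "('k, 'm) ring_scheme \<Rightarrow> ('k, 'a) persmod \<Rightarrow> bool" where
  "finitely_presented K M \<longleftrightarrow> persistence_module K M \<and>
     (\<exists>m n a b \<phi> \<pi>.
        \<phi> \<in> pm_homs K (fg_free K m b) (fg_free K n a) \<and>
        \<pi> \<in> pm_homs K (fg_free K n a) M \<and>
        pm_exact (fg_free K m b) (fg_free K n a) M \<phi> \<pi> \<and>
        pm_epi (fg_free K n a) M \<pi>)"

definition exp_neg :: "ereal \<Rightarrow> real" where
  "exp_neg b = (if b = \<infinity> then 0 else exp (- real_of_ereal b))"

definition persistent_magnitude :: "('k, 'm) ring_scheme \<Rightarrow> ('k, 'a) persmod \<Rightarrow> real" where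
  "persistent_magnitude K M =
     (THE r. \<exists>n a b. (\<forall>i<n. ereal (a i) < b i) \<and> pm_isomorphic K M (interval_sum K n a b) \<and>
        r = (\<Sum>i<n. exp (- a i) - exp_neg (b i)))"


section \<open>Tensor products of persistence modules\<close>

text \<open>
  \<open>(M \<otimes> N)(s)\<close> is the colimit of the spaces \<open>M(s1) \<otimes> N(s2)\<close> over the set of pairs with
  \<open>s1 + s2 \<le> s\<close>, ordered componentwise.
\<close>

definition tensor_index :: "real \<Rightarrow> (real \<times> real) set" where
  "tensor_index s = {(s1, s2). s1 + s2 \<le> s}"

definition tensor_diag ::
  "('k, 'm) ring_scheme \<Rightarrow> ('k, 'a) persmod \<Rightarrow> ('k, 'b) persmod
     \<Rightarrow> real \<times> real \<Rightarrow> ('k, ('a \<times> 'b \<Rightarrow> 'k) set) module" where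
  "tensor_diag K M N = (\<lambda>(s1, s2). tensor_space K (pm_ob M s1) (pm_ob N s2))"

definition tensor_trans ::
  "('k, 'm) ring_scheme \<Rightarrow> ('k, 'a) persmod \<Rightarrow> ('k, 'b) persmod
     \<Rightarrow> real \<times> real \<Rightarrow> real \<times> real \<Rightarrow> ('a \<times> 'b \<Rightarrow> 'k) set \<Rightarrow> ('a \<times> 'b \<Rightarrow> 'k) set" where
  "tensor_trans K M N = (\<lambda>(s1, s2) (t1, t2).
     tensor_map K (pm_ob M t1) (pm_ob N t2) (pm_tr M s1 t1) (pm_tr N s2 t2))"

definition tensor_le :: "real \<times> real \<Rightarrow> real \<times> real \<Rightarrow> bool" where
  "tensor_le = (\<lambda>(s1, s2) (t1, t2). s1 \<le> t1 \<and> s2 \<le> t2)"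

definition pm_tensor_sum ::
  "('k, 'm) ring_scheme \<Rightarrow> ('k, 'a) persmod \<Rightarrow> ('k, 'b) persmod \<Rightarrow> real
     \<Rightarrow> ('k, real \<times> real \<Rightarrow> ('a \<times> 'b \<Rightarrow> 'k) set) module" where
  "pm_tensor_sum K M N s = dsum_space (tensor_index s) (tensor_diag K M N)"

definition pm_tensor_null ::
  "('k, 'm) ring_scheme \<Rightarrow> ('k, 'a) persmod \<Rightarrow> ('k, 'b) persmod \<Rightarrow> real
     \<Rightarrow> (real \<times> real \<Rightarrow> ('a \<times> 'b \<Rightarrow> 'k) set) set" where
  "pm_tensor_null K M N s =
     colim_null K (tensor_index s) tensor_le (tensor_diag K M N) (tensor_trans K M N)"

text \<open>
  The transition map from \<open>s\<close> to \<open>t\<close> is induced by the inclusion of the index set at \<open>s\<close> into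
  the one at \<open>t\<close>, which is the identity on elements of the direct sums.
\<close>

definition pm_tensor ::
  "('k, 'm) ring_scheme \<Rightarrow> ('k, 'a) persmod \<Rightarrow> ('k, 'b) persmod
     \<Rightarrow> ('k, (real \<times> real \<Rightarrow> ('a \<times> 'b \<Rightarrow> 'k) set) set) persmod" where
  "pm_tensor K M N =
    \<lparr> pm_ob = (\<lambda>s. colim_space K (tensor_index s) tensor_le
                     (tensor_diag K M N) (tensor_trans K M N)),
      pm_tr = (\<lambda>s t. quot_map (pm_tensor_sum K M N t) (pm_tensor_null K M N t) (\<lambda>h. h)) \<rparr>"

text \<open>The map \<open>\<phi> \<otimes> N\<close> into \<open>M' \<otimes> N\<close>, for a map \<open>\<phi>\<close> of persistence modules into \<open>M'\<close>.\<close>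

definition pm_tensor_map ::
  "('k, 'm) ring_scheme \<Rightarrow> ('k, 'c) persmod \<Rightarrow> ('k, 'b) persmod \<Rightarrow> (real \<Rightarrow> 'a \<Rightarrow> 'c) \<Rightarrow> real
     \<Rightarrow> (real \<times> real \<Rightarrow> ('a \<times> 'b \<Rightarrow> 'k) set) set
     \<Rightarrow> (real \<times> real \<Rightarrow> ('c \<times> 'b \<Rightarrow> 'k) set) set" where
  "pm_tensor_map K M' N \<phi> s =
     quot_map (pm_tensor_sum K M' N s) (pm_tensor_null K M' N s)
       (dsum_map (tensor_index s) (tensor_diag K M' N)
          (\<lambda>(s1, s2). tensor_map K (pm_ob M' s1) (pm_ob N s2) (\<phi> s1) (\<lambda>y. y)))"


section \<open>Tor\<close>

text \<open>
  Projectivity is the lifting property against epimorphisms. HOL cannot quantify over the types of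
  the test modules \<open>E\<close> and \<open>F\<close>, so they are fixed. This is no restriction: the type of \<open>E\<close>
  accommodates the free persistence module on all elements of \<open>P\<close> (finitely supported functions
  on pairs \<open>(t, x)\<close> with \<open>x\<close> in \<open>P(t)\<close>), and lifting the identity of \<open>P\<close> along the canonical
  epimorphism from it already makes \<open>P\<close> a direct summand of a free persistence module, which
  has the lifting property against all epimorphisms.
\<close>

definition pm_projective :: "('k, 'm) ring_scheme \<Rightarrow> ('k, 'p) persmod \<Rightarrow> bool" where
  "pm_projective K P \<longleftrightarrow> persistence_module K P \<and>
     (\<forall>(E :: ('k, real \<times> 'p \<Rightarrow> 'k) persmod) (F :: ('k, 'p) persmod) e g.
        persistence_module K E \<and> persistence_module K F \<and>
        e \<in> pm_homs K E F \<and> pm_epi E F e \<and> g \<in> pm_homs K P F \<longrightarrow>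
        (\<exists>h\<in>pm_homs K P E. \<forall>t. \<forall>x\<in>carrier (pm_ob P t). e t (h t x) = g t x))"

text \<open>
  A projective resolution of \<open>M\<close>: the sequence given by \<open>d n\<close> from \<open>P (n + 1)\<close> to \<open>P n\<close> and by
  \<open>\<epsilon>\<close> from \<open>P 0\<close> to \<open>M\<close> is exact.
\<close>

definition projective_resolution ::
  "('k, 'm) ring_scheme \<Rightarrow> ('k, 'a) persmod \<Rightarrow> (nat \<Rightarrow> ('k, 'p) persmod)
     \<Rightarrow> (nat \<Rightarrow> real \<Rightarrow> 'p \<Rightarrow> 'p) \<Rightarrow> (real \<Rightarrow> 'p \<Rightarrow> 'a) \<Rightarrow> bool" where
  "projective_resolution K M P d \<epsilon> \<longleftrightarrow>
     persistence_module K M \<and>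
     (\<forall>n. pm_projective K (P n)) \<and>
     (\<forall>n. d n \<in> pm_homs K (P (Suc n)) (P n)) \<and>
     \<epsilon> \<in> pm_homs K (P 0) M \<and>
     pm_epi (P 0) M \<epsilon> \<and>
     pm_exact (P (Suc 0)) (P 0) M (d 0) \<epsilon> \<and>
     (\<forall>n. pm_exact (P (Suc (Suc n))) (P (Suc n)) (P n) (d (Suc n)) (d n))"

text \<open>The persistence module \<open>Z / B\<close>, for families \<open>B t \<subseteq> Z t\<close> of subspaces of the \<open>M(t)\<close>.\<close>

definition pm_subquot ::
  "('k, 'a) persmod \<Rightarrow> (real \<Rightarrow> 'a set) \<Rightarrow> (real \<Rightarrow> 'a set) \<Rightarrow> ('k, 'a set) persmod" where
  "pm_subquot M Z B =
    \<lparr> pm_ob = (\<lambda>t. quot_space (pm_ob M t \<lparr> carrier := Z t \<rparr>) (B t)),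
      pm_tr = (\<lambda>s t. quot_map (pm_ob M t \<lparr> carrier := Z t \<rparr>) (B t) (pm_tr M s t)) \<rparr>"

text \<open>
  \<open>pm_Tor K P d N i\<close> is the homology in degree \<open>i\<close> of the complex with terms \<open>P n \<otimes> N\<close> and
  differentials \<open>d n \<otimes> N\<close>. For a projective resolution of \<open>M\<close> given by \<open>P\<close> and \<open>d\<close> this is the
  \<open>i\<close>-th left derived functor of \<open>- \<otimes> N\<close> at \<open>M\<close>, that is, \<open>Tor_i(M, N)\<close>.
\<close>

definition pm_Tor ::
  "('k, 'm) ring_scheme \<Rightarrow> (nat \<Rightarrow> ('k, 'p) persmod) \<Rightarrow> (nat \<Rightarrow> real \<Rightarrow> 'p \<Rightarrow> 'p)
     \<Rightarrow> ('k, 'b) persmod \<Rightarrow> nat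
     \<Rightarrow> ('k, (real \<times> real \<Rightarrow> ('p \<times> 'b \<Rightarrow> 'k) set) set set) persmod" where
  "pm_Tor K P d N i =
     pm_subquot (pm_tensor K (P i) N)
       (case i of
          0 \<Rightarrow> (\<lambda>t. carrier (pm_ob (pm_tensor K (P 0) N) t))
        | Suc j \<Rightarrow> (\<lambda>t. a_kernel (pm_ob (pm_tensor K (P (Suc j)) N) t) (pm_ob (pm_tensor K (P j) N) t)
                        (pm_tensor_map K (P j) N (d j) t)))
       (\<lambda>t. pm_tensor_map K (P i) N (d i) t ` carrier (pm_ob (pm_tensor K (P (Suc i)) N) t))"

end

theory Submission
  imports "HOL-Analysis.Henstock_Kurzweil_Integration" Defs
begin

text \<open>
  By the structure theorem, \<open>M\<close> and \<open>N\<close> are finite sums of bars \<open>[a, b)\<close> and \<open>[c, d)\<close>. Tensoring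
  any persistence module \<open>P\<close> with the bar \<open>[c, d)\<close> gives the cokernel of \<open>P (s - d) \<rightarrow> P (s - c)\<close>.
  Applied to \<open>M\<close>, this shows that \<open>M \<otimes> N\<close> is the sum of the bars \<open>[a + c, min (a + d) (b + c))\<close>;
  applied to a projective resolution of \<open>M\<close>, whose transition maps in degree 0 are injective, it shows
  that \<open>Tor_1(M, N)\<close> consists of the kernels of \<open>M (s - d) \<rightarrow> M (s - c)\<close>, that is, of the bars
  \<open>[max (a + d) (b + c), b + d)\<close> with \<open>b\<close> and \<open>d\<close> finite. The formula then follows bar by bar
  from \<open>exp (- min x y) + exp (- max x y) = exp (- x) + exp (- y)\<close>.
\<close>

section \<open>Linear maps and subspaces\<close>

text \<open>The resolution in the theorem is arbitrary, so \<open>Tor_1\<close> cannot be read off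
  from a short resolution of \<open>M\<close> chosen for the purpose. The way out is to resolve the
  other factor: the bar \<open>[c, d)\<close> of \<open>N\<close> is the cokernel of the inclusion
  of \<open>[d, \<infinity>)\<close> into \<open>[c, \<infinity>)\<close>, and tensoring with
  \<open>[c, \<infinity>)\<close> shifts by \<open>c\<close>. The cokernel description of
  \<open>P \<otimes> N\<close> therefore holds for every \<open>P\<close> and is natural in
  \<open>P\<close>, so it can be applied to each term of the given resolution; passing to kernels in
  \<open>M\<close> is the balancing of Tor, done by hand as a diagram chase. For a bar
  \<open>[a, b)\<close> of \<open>M\<close>, the generator is killed between \<open>s - d\<close>
  and \<open>s - c\<close> exactly when \<open>a + d \<le> s < b + d\<close> and
  \<open>b + c \<le> s\<close>, which gives the stated Tor bar. The second obstacle is that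
  magnitude is a definite description, so its value requires the sum over bars to be independent of
  the decomposition. Full uniqueness of barcodes is avoided: the sum equals the integral of
  \<open>exp (- t)\<close> times the dimension at time \<open>t\<close>, and dimensions are
  isomorphism invariants.\<close>

lemma lin_maps_closed:
  "f \<in> lin_maps K V W \<Longrightarrow> x \<in> carrier V \<Longrightarrow> f x \<in> carrier W"
  by (auto simp: lin_maps_def)

lemma lin_maps_add:
  "f \<in> lin_maps K V W \<Longrightarrow> x \<in> carrier V \<Longrightarrow> y \<in> carrier V \<Longrightarrow> f (x \<oplus>\<^bsub>V\<^esub> y) = f x \<oplus>\<^bsub>W\<^esub> f y"
  by (auto simp: lin_maps_def)

lemma lin_maps_smult:
  "f \<in> lin_maps K V W \<Longrightarrow> c \<in> carrier K \<Longrightarrow> x \<in> carrier V \<Longrightarrow> f (c \<odot>\<^bsub>V\<^esub> x) = c \<odot>\<^bsub>W\<^esub> f x"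
  by (auto simp: lin_maps_def)

lemma lin_mapsI:
  assumes "\<And>x. x \<in> carrier V \<Longrightarrow> f x \<in> carrier W"
    and "\<And>x y. x \<in> carrier V \<Longrightarrow> y \<in> carrier V \<Longrightarrow> f (x \<oplus>\<^bsub>V\<^esub> y) = f x \<oplus>\<^bsub>W\<^esub> f y"
    and "\<And>c x. c \<in> carrier K \<Longrightarrow> x \<in> carrier V \<Longrightarrow> f (c \<odot>\<^bsub>V\<^esub> x) = c \<odot>\<^bsub>W\<^esub> f x"
  shows "f \<in> lin_maps K V W"
  using assms by (auto simp: lin_maps_def)

lemma lin_maps_id: "(\<lambda>x. x) \<in> lin_maps K V V"
  by (auto intro: lin_mapsI)

lemma lin_maps_comp:
  "f \<in> lin_maps K V W \<Longrightarrow> g \<in> lin_maps K W Z \<Longrightarrow> (\<lambda>x. g (f x)) \<in> lin_maps K V Z"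
  by (simp add: lin_maps_def Pi_iff)

lemma lin_maps_zero:
  assumes "module K V" "module K W" "f \<in> lin_maps K V W"
  shows "f \<zero>\<^bsub>V\<^esub> = \<zero>\<^bsub>W\<^esub>"
proof -
  interpret V: module K V by fact
  interpret W: module K W by fact
  have "f \<zero>\<^bsub>V\<^esub> = f (\<zero>\<^bsub>K\<^esub> \<odot>\<^bsub>V\<^esub> \<zero>\<^bsub>V\<^esub>)"
    by simp
  also have "\<dots> = \<zero>\<^bsub>K\<^esub> \<odot>\<^bsub>W\<^esub> f \<zero>\<^bsub>V\<^esub>"
    using assms(3) by (intro lin_maps_smult[OF assms(3)]) auto
  finally show ?thesis
    using lin_maps_closed[OF assms(3), of "\<zero>\<^bsub>V\<^esub>"] by simp
qed

lemma module_minus_eq: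
  assumes "module K V" "x \<in> carrier V" "y \<in> carrier V"
  shows "x \<ominus>\<^bsub>V\<^esub> y = x \<oplus>\<^bsub>V\<^esub> (\<ominus>\<^bsub>K\<^esub> \<one>\<^bsub>K\<^esub>) \<odot>\<^bsub>V\<^esub> y"
proof -
  interpret V: module K V by fact
  show ?thesis
    using assms by (simp add: a_minus_def V.smult_l_minus)
qed

lemma lin_maps_minus:
  assumes "module K V" "module K W" "f \<in> lin_maps K V W" "x \<in> carrier V" "y \<in> carrier V"
  shows "f (x \<ominus>\<^bsub>V\<^esub> y) = f x \<ominus>\<^bsub>W\<^esub> f y"
proof -
  interpret V: module K V by fact
  interpret W: module K W by fact
  show ?thesis
    using assms
    by (simp add: module_minus_eq lin_maps_add[OF assms(3)] lin_maps_smult[OF assms(3)]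
        lin_maps_closed[OF assms(3)])
qed

lemma lin_maps_finsum:
  assumes "module K V" "module K W" "f \<in> lin_maps K V W" "finite A" "g \<in> A \<rightarrow> carrier V"
  shows "f (\<Oplus>\<^bsub>V\<^esub>i\<in>A. g i) = (\<Oplus>\<^bsub>W\<^esub>i\<in>A. f (g i))"
proof -
  interpret V: module K V by fact
  interpret W: module K W by fact
  have "\<And>x. x \<in> carrier V \<Longrightarrow> f x \<in> carrier W"
    using assms(3) by (rule lin_maps_closed)
  with assms(4,5) show ?thesis
    by (induct) (simp_all add: lin_maps_zero[OF assms(1-3)] lin_maps_add[OF assms(3)] Pi_iff)
qed

text \<open>Closure under negatives comes from scaling by minus one, so it is no separate
  condition.\<close>

lemma subspaceI:
  assumes "module K V" "H \<subseteq> carrier V" "\<zero>\<^bsub>V\<^esub> \<in> H"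
    and "\<And>x y. x \<in> H \<Longrightarrow> y \<in> H \<Longrightarrow> x \<oplus>\<^bsub>V\<^esub> y \<in> H"
    and "\<And>c x. c \<in> carrier K \<Longrightarrow> x \<in> H \<Longrightarrow> c \<odot>\<^bsub>V\<^esub> x \<in> H"
  shows "submodule H K V"
proof -
  interpret V: module K V by fact
  have "\<ominus>\<^bsub>V\<^esub> x \<in> H" if "x \<in> H" for x
    using assms(5)[of "\<ominus>\<^bsub>K\<^esub> \<one>\<^bsub>K\<^esub>" x] that assms(2) V.smult_l_minus[of "\<one>\<^bsub>K\<^esub>" x] by auto
  then show ?thesis
    by (intro V.submoduleI assms)
qed

lemma subspace_zero: "submodule H K V \<Longrightarrow> \<zero>\<^bsub>V\<^esub> \<in> H"
  using subgroup.one_closed[OF submodule.axioms(1), of H K V] by simp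

lemma subspace_subset: "submodule H K V \<Longrightarrow> x \<in> H \<Longrightarrow> x \<in> carrier V"
  using subgroup.subset[OF submodule.axioms(1), of H K V] by auto

lemma subspace_add: "submodule H K V \<Longrightarrow> x \<in> H \<Longrightarrow> y \<in> H \<Longrightarrow> x \<oplus>\<^bsub>V\<^esub> y \<in> H"
  using subgroup.m_closed[OF submodule.axioms(1), of H K V x y] by simp

lemma subspace_smult: "submodule H K V \<Longrightarrow> c \<in> carrier K \<Longrightarrow> x \<in> H \<Longrightarrow> c \<odot>\<^bsub>V\<^esub> x \<in> H"
  by (rule submodule.smult_closed)

lemma subspace_minus:
  assumes "module K V" "submodule H K V" "x \<in> H" "y \<in> H"
  shows "x \<ominus>\<^bsub>V\<^esub> y \<in> H"
  using assms module.submoduleE(3,5)[OF assms(1,2)] by (simp add: a_minus_def)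

lemma subspace_vimage:
  assumes "module K V" "module K W" "f \<in> lin_maps K V W" "submodule H K W"
  shows "submodule {x \<in> carrier V. f x \<in> H} K V"
proof -
  interpret V: module K V by fact
  show ?thesis
    using assms
    by (intro subspaceI)
      (auto simp: lin_maps_zero lin_maps_add lin_maps_smult intro: subspace_zero subspace_add
        subspace_smult)
qed

lemma subspace_image:
  assumes "module K V" "module K W" "f \<in> lin_maps K V W" "submodule H K V"
  shows "submodule (f ` H) K W"
proof (rule subspaceI[OF assms(2)])
  note sub = subspace_subset[OF assms(4)]
  show "f ` H \<subseteq> carrier W"
    using sub lin_maps_closed[OF assms(3)] by auto
  show "\<zero>\<^bsub>W\<^esub> \<in> f ` H"
    using lin_maps_zero[OF assms(1-3)] subspace_zero[OF assms(4)] by (metis image_eqI)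
  show "x \<oplus>\<^bsub>W\<^esub> y \<in> f ` H" if "x \<in> f ` H" "y \<in> f ` H" for x y
    using that sub subspace_add[OF assms(4)] lin_maps_add[OF assms(3)]
    by (smt (verit) image_iff)
  show "c \<odot>\<^bsub>W\<^esub> x \<in> f ` H" if "c \<in> carrier K" "x \<in> f ` H" for c x
    using that sub subspace_smult[OF assms(4)] lin_maps_smult[OF assms(3)]
    by (smt (verit) image_iff)
qed

lemma subspace_equalizer:
  assumes "module K V" "module K W" "f \<in> lin_maps K V W" "g \<in> lin_maps K V W"
  shows "submodule {x \<in> carrier V. f x = g x} K V"
proof -
  interpret V: module K V by fact
  show ?thesis
    using assms
    by (intro subspaceI) (auto simp: lin_maps_zero lin_maps_add lin_maps_smult)
qed

lemma subspace_kernel: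
  assumes "module K V" "module K W" "f \<in> lin_maps K V W"
  shows "submodule (a_kernel V W f) K V"
proof -
  interpret V: module K V by fact
  interpret W: module K W by fact
  show ?thesis
    using assms unfolding a_kernel_def'
    by (intro subspaceI) (auto simp: lin_maps_zero lin_maps_add lin_maps_smult)
qed

lemma lin_span_subspace:
  assumes "module K V" "S \<subseteq> carrier V"
  shows "submodule (lin_span K V S) K V"
proof -
  \<comment> \<open>The intersection in \<open>lin_span\<close> must not be empty, since otherwise
    it would not lie in the carrier.\<close>
  have "carrier V \<in> {H. submodule H K V \<and> S \<subseteq> H}"
    using assms by (simp add: module.carrier_is_submodule)
  then show ?thesis
    unfolding lin_span_def
    by (intro subspaceI[OF assms(1)])
      (auto intro: subspace_zero subspace_add subspace_smult)
qed

lemma lin_span_least: "submodule H K V \<Longrightarrow> S \<subseteq> H \<Longrightarrow> lin_span K V S \<subseteq> H"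
  unfolding lin_span_def by auto

lemma lin_span_superset: "x \<in> S \<Longrightarrow> x \<in> lin_span K V S"
  unfolding lin_span_def by auto

text \<open>Agreement on the carrier is enough, which lets the module axioms pass between records
  whose operations differ on functions outside it.\<close>

lemma module_transfer:
  assumes V: "module K V" and "carrier W = carrier V" "\<zero>\<^bsub>W\<^esub> = \<zero>\<^bsub>V\<^esub>"
    and "\<And>x y. x \<in> carrier V \<Longrightarrow> y \<in> carrier V \<Longrightarrow> x \<oplus>\<^bsub>W\<^esub> y = x \<oplus>\<^bsub>V\<^esub> y"
    and "\<And>c x. c \<in> carrier K \<Longrightarrow> x \<in> carrier V \<Longrightarrow> c \<odot>\<^bsub>W\<^esub> x = c \<odot>\<^bsub>V\<^esub> x"
  shows "module K W"
proof -
  interpret V: module K V by fact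
  show ?thesis
    by (intro moduleI abelian_groupI V.R.is_cring)
      (auto simp: assms V.M.a_ac V.smult_l_distr V.smult_r_distr V.smult_assoc1
        intro!: bexI[of _ "\<ominus>\<^bsub>V\<^esub> x" for x] V.M.l_neg)
qed

lemma module_minus_self:
  assumes "module K V" "x \<in> carrier V"
  shows "x \<ominus>\<^bsub>V\<^esub> x = \<zero>\<^bsub>V\<^esub>"
proof -
  interpret V: module K V by fact
  show ?thesis using assms(2) by (simp add: a_minus_def V.M.r_neg)
qed

lemma module_minus_eq_zeroD:
  assumes "module K V" "x \<in> carrier V" "y \<in> carrier V" "x \<ominus>\<^bsub>V\<^esub> y = \<zero>\<^bsub>V\<^esub>"
  shows "x = y"
proof -
  interpret V: module K V by fact
  have "x = (x \<ominus>\<^bsub>V\<^esub> y) \<oplus>\<^bsub>V\<^esub> y"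
    using assms(2,3) by (simp add: a_minus_def V.M.a_assoc V.M.l_neg)
  then show ?thesis using assms by simp
qed

lemma lin_maps_injI:
  assumes V: "module K V" and W: "module K W" and f: "f \<in> lin_maps K V W"
    and ker: "\<And>x. x \<in> carrier V \<Longrightarrow> f x = \<zero>\<^bsub>W\<^esub> \<Longrightarrow> x = \<zero>\<^bsub>V\<^esub>"
  shows "inj_on f (carrier V)"
proof (rule inj_onI)
  fix x y assume xy: "x \<in> carrier V" "y \<in> carrier V" "f x = f y"
  have "f (x \<ominus>\<^bsub>V\<^esub> y) = \<zero>\<^bsub>W\<^esub>"
    using lin_maps_minus[OF V W f xy(1,2)] xy(3) module_minus_self[OF W lin_maps_closed[OF f xy(2)]]
    by simp
  then show "x = y"
    using ker[OF abelian_group.minus_closed[OF module.axioms(2)[OF V] xy(1,2)]]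
      module_minus_eq_zeroD[OF V xy(1,2)] by blast
qed


section \<open>Quotients\<close>

lemma coset_mem: "y \<in> W +>\<^bsub>V\<^esub> x \<longleftrightarrow> (\<exists>w\<in>W. y = w \<oplus>\<^bsub>V\<^esub> x)"
  by (auto simp: a_r_coset_def')

lemma coset_eq_iff:
  assumes "module K V" "submodule W K V" "x \<in> carrier V" "y \<in> carrier V"
  shows "W +>\<^bsub>V\<^esub> x = W +>\<^bsub>V\<^esub> y \<longleftrightarrow> x \<ominus>\<^bsub>V\<^esub> y \<in> W"
proof -
  interpret V: module K V by fact
  have sub: "w \<in> carrier V" if "w \<in> W" for w
    using that subspace_subset[OF assms(2)] by blast
  have aux: "W +>\<^bsub>V\<^esub> x \<subseteq> W +>\<^bsub>V\<^esub> y" if "x \<ominus>\<^bsub>V\<^esub> y \<in> W" "x \<in> carrier V" "y \<in> carrier V" for x y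
  proof
    fix z assume "z \<in> W +>\<^bsub>V\<^esub> x"
    then obtain w where w: "w \<in> W" "z = w \<oplus>\<^bsub>V\<^esub> x" by (auto simp: coset_mem)
    have "z = (w \<oplus>\<^bsub>V\<^esub> (x \<ominus>\<^bsub>V\<^esub> y)) \<oplus>\<^bsub>V\<^esub> y"
      using w sub that by (simp add: a_minus_def V.M.a_assoc V.M.l_neg)
    then show "z \<in> W +>\<^bsub>V\<^esub> y"
      using w that subspace_add[OF assms(2)] by (auto simp: coset_mem)
  qed
  show ?thesis
  proof
    assume eq: "W +>\<^bsub>V\<^esub> x = W +>\<^bsub>V\<^esub> y"
    have "x \<in> W +>\<^bsub>V\<^esub> x"
      using assms subspace_zero[OF assms(2)] by (auto simp: coset_mem intro!: bexI[of _ "\<zero>\<^bsub>V\<^esub>"])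
    then obtain w where w: "w \<in> W" "x = w \<oplus>\<^bsub>V\<^esub> y" unfolding eq by (auto simp: coset_mem)
    then have "x \<ominus>\<^bsub>V\<^esub> y = w"
      using sub assms by (simp add: a_minus_def V.M.a_assoc V.M.r_neg)
    then show "x \<ominus>\<^bsub>V\<^esub> y \<in> W" using w by simp
  next
    assume d: "x \<ominus>\<^bsub>V\<^esub> y \<in> W"
    have "y \<ominus>\<^bsub>V\<^esub> x = \<ominus>\<^bsub>V\<^esub> (x \<ominus>\<^bsub>V\<^esub> y)"
      using assms by (simp add: a_minus_def V.M.minus_add V.M.a_comm)
    then have "y \<ominus>\<^bsub>V\<^esub> x \<in> W"
      using d module.submoduleE(3)[OF assms(1,2)] by simp
    then show "W +>\<^bsub>V\<^esub> x = W +>\<^bsub>V\<^esub> y"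
      using aux d assms by blast
  qed
qed

text \<open>Additivity of \<open>f\<close> carries the computation, so it serves for induced maps
  and, with \<open>f\<close> a scaling of \<open>V\<close> and \<open>W' = W\<close>, for scalar
  multiplication on the quotient.\<close>

lemma set_add_image_coset:
  assumes V: "module K V" and V': "module K V'" and W: "submodule W K V"
    and W': "submodule W' K V'" and x: "x \<in> carrier V"
    and cl: "\<And>y. y \<in> carrier V \<Longrightarrow> f y \<in> carrier V'"
    and add: "\<And>y z. y \<in> carrier V \<Longrightarrow> z \<in> carrier V \<Longrightarrow> f (y \<oplus>\<^bsub>V\<^esub> z) = f y \<oplus>\<^bsub>V'\<^esub> f z"
    and sub: "f ` W \<subseteq> W'"
  shows "W' <+>\<^bsub>V'\<^esub> (f ` (W +>\<^bsub>V\<^esub> x)) = W' +>\<^bsub>V'\<^esub> f x"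
proof -
  interpret V: module K V by fact
  interpret V': module K V' by fact
  note c = subspace_subset[OF W] subspace_subset[OF W']
  show ?thesis
  proof (intro equalityI subsetI)
    fix z assume "z \<in> W' <+>\<^bsub>V'\<^esub> (f ` (W +>\<^bsub>V\<^esub> x))"
    then obtain w w' where w: "w \<in> W" "w' \<in> W'" "z = w' \<oplus>\<^bsub>V'\<^esub> f (w \<oplus>\<^bsub>V\<^esub> x)"
      by (auto simp: set_add_def' coset_mem)
    then have "z = (w' \<oplus>\<^bsub>V'\<^esub> f w) \<oplus>\<^bsub>V'\<^esub> f x"
      using c x cl add by (simp add: V'.M.a_assoc)
    moreover have "w' \<oplus>\<^bsub>V'\<^esub> f w \<in> W'"
      using w sub subspace_add[OF W'] by auto
    ultimately show "z \<in> W' +>\<^bsub>V'\<^esub> f x" by (auto simp: coset_mem)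
  next
    fix z assume "z \<in> W' +>\<^bsub>V'\<^esub> f x"
    then obtain w' where "w' \<in> W'" "z = w' \<oplus>\<^bsub>V'\<^esub> f x" by (auto simp: coset_mem)
    moreover have "f x \<in> f ` (W +>\<^bsub>V\<^esub> x)"
      using x subspace_zero[OF W] by (auto simp: coset_mem intro!: imageI bexI[of _ "\<zero>\<^bsub>V\<^esub>"])
    ultimately show "z \<in> W' <+>\<^bsub>V'\<^esub> (f ` (W +>\<^bsub>V\<^esub> x))"
      unfolding set_add_def' by blast
  qed
qed

lemma quot_map_coset:
  assumes "module K V" "module K V'" "submodule W K V" "submodule W' K V'"
    and "f \<in> lin_maps K V V'" "f ` W \<subseteq> W'" "x \<in> carrier V"
  shows "quot_map V' W' f (W +>\<^bsub>V\<^esub> x) = W' +>\<^bsub>V'\<^esub> f x"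
  unfolding quot_map_def
  using assms by (intro set_add_image_coset) (auto simp: lin_maps_closed lin_maps_add)

lemma quot_carrier: "carrier (quot_space V W) = (\<lambda>x. W +>\<^bsub>V\<^esub> x) ` carrier V"
  by (auto simp: quot_space_def A_RCOSETS_def')

lemma quot_zero:
  assumes "module K V" "submodule W K V"
  shows "\<zero>\<^bsub>quot_space V W\<^esub> = W +>\<^bsub>V\<^esub> \<zero>\<^bsub>V\<^esub>"
proof -
  interpret V: module K V by fact
  have "W +>\<^bsub>V\<^esub> \<zero>\<^bsub>V\<^esub> = W"
    using subspace_subset[OF assms(2)] by (auto simp: coset_mem)
  then show ?thesis by (simp add: quot_space_def)
qed

lemma quot_add:
  assumes "module K V" "submodule W K V" "x \<in> carrier V" "y \<in> carrier V"
  shows "(W +>\<^bsub>V\<^esub> x) \<oplus>\<^bsub>quot_space V W\<^esub> (W +>\<^bsub>V\<^esub> y) = W +>\<^bsub>V\<^esub> (x \<oplus>\<^bsub>V\<^esub> y)"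
proof -
  interpret V: module K V by fact
  note c = subspace_subset[OF assms(2)]
  have "(W +>\<^bsub>V\<^esub> x) <+>\<^bsub>V\<^esub> (W +>\<^bsub>V\<^esub> y) = W +>\<^bsub>V\<^esub> (x \<oplus>\<^bsub>V\<^esub> y)"
  proof (intro equalityI subsetI)
    fix z assume "z \<in> (W +>\<^bsub>V\<^esub> x) <+>\<^bsub>V\<^esub> (W +>\<^bsub>V\<^esub> y)"
    then obtain w w' where w: "w \<in> W" "w' \<in> W" "z = (w \<oplus>\<^bsub>V\<^esub> x) \<oplus>\<^bsub>V\<^esub> (w' \<oplus>\<^bsub>V\<^esub> y)"
      by (auto simp: set_add_def' coset_mem)
    then have "z = (w \<oplus>\<^bsub>V\<^esub> w') \<oplus>\<^bsub>V\<^esub> (x \<oplus>\<^bsub>V\<^esub> y)"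
      using c assms by (simp add: V.M.a_ac)
    then show "z \<in> W +>\<^bsub>V\<^esub> (x \<oplus>\<^bsub>V\<^esub> y)"
      using w subspace_add[OF assms(2)] by (auto simp: coset_mem)
  next
    fix z assume "z \<in> W +>\<^bsub>V\<^esub> (x \<oplus>\<^bsub>V\<^esub> y)"
    then obtain w where w: "w \<in> W" "z = w \<oplus>\<^bsub>V\<^esub> (x \<oplus>\<^bsub>V\<^esub> y)"
      by (auto simp: coset_mem)
    then have "z = (w \<oplus>\<^bsub>V\<^esub> x) \<oplus>\<^bsub>V\<^esub> (\<zero>\<^bsub>V\<^esub> \<oplus>\<^bsub>V\<^esub> y)"
      using c assms by (simp add: V.M.a_ac)
    then show "z \<in> (W +>\<^bsub>V\<^esub> x) <+>\<^bsub>V\<^esub> (W +>\<^bsub>V\<^esub> y)"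
      using w subspace_zero[OF assms(2)] unfolding set_add_def' a_r_coset_def' by blast
  qed
  then show ?thesis by (simp add: quot_space_def)
qed

lemma quot_smult:
  assumes "module K V" "submodule W K V" "c \<in> carrier K" "x \<in> carrier V"
  shows "c \<odot>\<^bsub>quot_space V W\<^esub> (W +>\<^bsub>V\<^esub> x) = W +>\<^bsub>V\<^esub> (c \<odot>\<^bsub>V\<^esub> x)"
proof -
  interpret V: module K V by fact
  show ?thesis
    using assms by (simp add: quot_space_def)
      (intro set_add_image_coset[OF assms(1,1)],
        auto simp: V.smult_r_distr intro: subspace_smult[OF assms(2)])
qed

lemma quot_module:
  assumes "module K V" "submodule W K V"
  shows "module K (quot_space V W)"
proof -
  interpret V: module K V by fact
  note q = quot_add[OF assms] quot_smult[OF assms] quot_zero[OF assms]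
  show ?thesis
  proof (intro moduleI abelian_groupI V.R.is_cring; (unfold quot_carrier)?; (elim imageE)?; (simp only:)?)
    fix x assume "x \<in> carrier V"
    then show "\<exists>y\<in>(\<lambda>x. W +>\<^bsub>V\<^esub> x) ` carrier V. y \<oplus>\<^bsub>quot_space V W\<^esub> (W +>\<^bsub>V\<^esub> x) = \<zero>\<^bsub>quot_space V W\<^esub>"
      by (intro bexI[of _ "W +>\<^bsub>V\<^esub> (\<ominus>\<^bsub>V\<^esub> x)"]) (auto simp: q V.M.l_neg)
  qed (auto simp: q V.M.a_ac V.smult_l_distr V.smult_r_distr V.smult_assoc1)
qed

lemma quot_proj:
  assumes "module K V" "submodule W K V"
  shows "(\<lambda>x. W +>\<^bsub>V\<^esub> x) \<in> lin_maps K V (quot_space V W)"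
  by (rule lin_mapsI) (auto simp: quot_carrier quot_add[OF assms] quot_smult[OF assms])

lemma quot_map_lin:
  assumes "module K V" "module K V'" "submodule W K V" "submodule W' K V'"
    and "f \<in> lin_maps K V V'" "f ` W \<subseteq> W'"
  shows "quot_map V' W' f \<in> lin_maps K (quot_space V W) (quot_space V' W')"
proof -
  interpret V: module K V by fact
  interpret V': module K V' by fact
  note q = quot_add[OF assms(1,3)] quot_smult[OF assms(1,3)] quot_add[OF assms(2,4)]
    quot_smult[OF assms(2,4)] quot_map_coset[OF assms] lin_maps_closed[OF assms(5)]
    lin_maps_add[OF assms(5)] lin_maps_smult[OF assms(5)]
  show ?thesis
    by (rule lin_mapsI) (auto simp: quot_carrier q)
qed

text \<open>The induced map evaluates \<open>f\<close> at a chosen representative; the choice does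
  not matter because \<open>f\<close> vanishes on \<open>W\<close>.\<close>

lemma quot_lift:
  assumes "module K V" "module K Z" "submodule W K V"
    and "f \<in> lin_maps K V Z" "\<And>x. x \<in> W \<Longrightarrow> f x = \<zero>\<^bsub>Z\<^esub>"
  obtains g where "g \<in> lin_maps K (quot_space V W) Z"
    and "\<And>x. x \<in> carrier V \<Longrightarrow> g (W +>\<^bsub>V\<^esub> x) = f x"
proof -
  interpret V: module K V by fact
  interpret Z: module K Z by fact
  define g where "g X = f (SOME x. x \<in> X)" for X
  have g: "g (W +>\<^bsub>V\<^esub> x) = f x" if x: "x \<in> carrier V" for x
  proof -
    have "x \<in> W +>\<^bsub>V\<^esub> x"
      using x subspace_zero[OF assms(3)] by (auto simp: coset_mem intro!: bexI[of _ "\<zero>\<^bsub>V\<^esub>"])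
    then have "(SOME y. y \<in> W +>\<^bsub>V\<^esub> x) \<in> W +>\<^bsub>V\<^esub> x" by (rule someI)
    then obtain w where "w \<in> W" "(SOME y. y \<in> W +>\<^bsub>V\<^esub> x) = w \<oplus>\<^bsub>V\<^esub> x"
      by (auto simp: coset_mem)
    then show ?thesis
      using x assms(5) subspace_subset[OF assms(3)] lin_maps_closed[OF assms(4)]
      by (simp add: g_def lin_maps_add[OF assms(4)])
  qed
  have "g \<in> lin_maps K (quot_space V W) Z"
    by (rule lin_mapsI)
      (auto simp: quot_carrier g quot_add[OF assms(1,3)] quot_smult[OF assms(1,3)]
        lin_maps_closed[OF assms(4)] lin_maps_add[OF assms(4)] lin_maps_smult[OF assms(4)])
  then show ?thesis using g that by blast
qed


section \<open>Direct sums\<close>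

text \<open>Lets sums over different supports be compared over a common index set.\<close>

lemma finsum_superset:
  assumes "module K Z" "finite B" "A \<subseteq> B" "\<And>i. i \<in> B - A \<Longrightarrow> f i = \<zero>\<^bsub>Z\<^esub>" "f \<in> B \<rightarrow> carrier Z"
  shows "(\<Oplus>\<^bsub>Z\<^esub>i\<in>A. f i) = (\<Oplus>\<^bsub>Z\<^esub>i\<in>B. f i)"
proof -
  interpret Z: module K Z by fact
  show ?thesis
    using assms by (intro Z.M.add.finprod_mono_neutral_cong_left) auto
qed

lemma dsum_carrier:
  "h \<in> carrier (dsum_space I V) \<longleftrightarrow>
     (\<forall>i\<in>I. h i \<in> carrier (V i)) \<and> (\<forall>i. i \<notin> I \<longrightarrow> h i = \<zero>\<^bsub>V i\<^esub>) \<and> finite {i. h i \<noteq> \<zero>\<^bsub>V i\<^esub>}"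
  by (simp add: dsum_space_def)

lemma dsum_zero: "\<zero>\<^bsub>dsum_space I V\<^esub> = (\<lambda>i. \<zero>\<^bsub>V i\<^esub>)"
  by (simp add: dsum_space_def)

lemma dsum_add:
  "h \<oplus>\<^bsub>dsum_space I V\<^esub> h' = (\<lambda>i. if i \<in> I then h i \<oplus>\<^bsub>V i\<^esub> h' i else \<zero>\<^bsub>V i\<^esub>)"
  by (simp add: dsum_space_def)

lemma dsum_smult:
  "c \<odot>\<^bsub>dsum_space I V\<^esub> h = (\<lambda>i. if i \<in> I then c \<odot>\<^bsub>V i\<^esub> h i else \<zero>\<^bsub>V i\<^esub>)"
  by (simp add: dsum_space_def)

lemma dsum_add_closed:
  assumes "\<And>i. i \<in> I \<Longrightarrow> module K (V i)"
    and "h \<in> carrier (dsum_space I V)" "h' \<in> carrier (dsum_space I V)"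
  shows "h \<oplus>\<^bsub>dsum_space I V\<^esub> h' \<in> carrier (dsum_space I V)"
proof -
  have 1: "x \<oplus>\<^bsub>V i\<^esub> y \<in> carrier (V i)" "\<zero>\<^bsub>V i\<^esub> \<oplus>\<^bsub>V i\<^esub> \<zero>\<^bsub>V i\<^esub> = \<zero>\<^bsub>V i\<^esub>"
    if "i \<in> I" "x \<in> carrier (V i)" "y \<in> carrier (V i)" for i x y
  proof -
    interpret V: module K "V i" using assms(1)[OF that(1)] .
    show "x \<oplus>\<^bsub>V i\<^esub> y \<in> carrier (V i)" "\<zero>\<^bsub>V i\<^esub> \<oplus>\<^bsub>V i\<^esub> \<zero>\<^bsub>V i\<^esub> = \<zero>\<^bsub>V i\<^esub>"
      using that by auto
  qed
  have "{i. (h \<oplus>\<^bsub>dsum_space I V\<^esub> h') i \<noteq> \<zero>\<^bsub>V i\<^esub>} \<subseteq> {i. h i \<noteq> \<zero>\<^bsub>V i\<^esub>} \<union> {i. h' i \<noteq> \<zero>\<^bsub>V i\<^esub>}"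
    using assms 1 by (fastforce simp: dsum_add dsum_carrier split: if_splits)
  moreover have "finite ({i. h i \<noteq> \<zero>\<^bsub>V i\<^esub>} \<union> {i. h' i \<noteq> \<zero>\<^bsub>V i\<^esub>})"
    using assms by (simp add: dsum_carrier)
  ultimately have "finite {i. (h \<oplus>\<^bsub>dsum_space I V\<^esub> h') i \<noteq> \<zero>\<^bsub>V i\<^esub>}"
    by (rule finite_subset)
  then show ?thesis
    using assms 1 by (simp add: dsum_carrier dsum_add)
qed

lemma dsum_smult_closed:
  assumes "\<And>i. i \<in> I \<Longrightarrow> module K (V i)"
    and "h \<in> carrier (dsum_space I V)" "c \<in> carrier K"
  shows "c \<odot>\<^bsub>dsum_space I V\<^esub> h \<in> carrier (dsum_space I V)"
proof -
  have 1: "c \<odot>\<^bsub>V i\<^esub> x \<in> carrier (V i)" "c \<odot>\<^bsub>V i\<^esub> \<zero>\<^bsub>V i\<^esub> = \<zero>\<^bsub>V i\<^esub>"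
    if "i \<in> I" "x \<in> carrier (V i)" for i x
  proof -
    interpret V: module K "V i" using assms(1)[OF that(1)] .
    show "c \<odot>\<^bsub>V i\<^esub> x \<in> carrier (V i)" "c \<odot>\<^bsub>V i\<^esub> \<zero>\<^bsub>V i\<^esub> = \<zero>\<^bsub>V i\<^esub>"
      using that assms by auto
  qed
  have "{i. (c \<odot>\<^bsub>dsum_space I V\<^esub> h) i \<noteq> \<zero>\<^bsub>V i\<^esub>} \<subseteq> {i. h i \<noteq> \<zero>\<^bsub>V i\<^esub>}"
    using assms 1 by (fastforce simp: dsum_smult dsum_carrier split: if_splits)
  moreover have "finite {i. h i \<noteq> \<zero>\<^bsub>V i\<^esub>}"
    using assms by (simp add: dsum_carrier)
  ultimately have "finite {i. (c \<odot>\<^bsub>dsum_space I V\<^esub> h) i \<noteq> \<zero>\<^bsub>V i\<^esub>}"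
    by (rule finite_subset)
  then show ?thesis
    using assms 1 by (simp add: dsum_carrier dsum_smult)
qed

lemma dsum_module:
  assumes "cring K" and V: "\<And>i. i \<in> I \<Longrightarrow> module K (V i)"
  shows "module K (dsum_space I V)"
proof (intro moduleI abelian_groupI assms(1))
  note mod = abelian_groupE[OF module.axioms(2)[OF V]] module.smult_closed[OF V]
    module.smult_l_distr[OF V] module.smult_r_distr[OF V] module.smult_assoc1[OF V]
    module.smult_one[OF V]
  note z = abelian_groupE(2)[OF module.axioms(2)[OF V]]
  show zero: "\<zero>\<^bsub>dsum_space I V\<^esub> \<in> carrier (dsum_space I V)"
    by (auto simp: dsum_carrier dsum_zero mod)
  fix x y z c b
  assume x: "x \<in> carrier (dsum_space I V)"
  show "\<exists>y\<in>carrier (dsum_space I V). y \<oplus>\<^bsub>dsum_space I V\<^esub> x = \<zero>\<^bsub>dsum_space I V\<^esub>"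
  \<comment> \<open>Minus one times \<open>x\<close> serves as the negative: it is zero outside
    \<open>I\<close> by definition, where the \<open>V i\<close> need not be modules.\<close>
  proof (intro bexI)
    interpret K: cring K by fact
    have *: "(\<ominus>\<^bsub>K\<^esub> \<one>\<^bsub>K\<^esub>) \<odot>\<^bsub>V i\<^esub> x i \<oplus>\<^bsub>V i\<^esub> x i = \<zero>\<^bsub>V i\<^esub>" if i: "i \<in> I" for i
    proof -
      interpret Vi: module K "V i" using V[OF i] .
      have "x i \<in> carrier (V i)" using x i by (simp add: dsum_carrier)
      then show ?thesis by (simp add: Vi.smult_l_minus Vi.M.l_neg)
    qed
    show "((\<ominus>\<^bsub>K\<^esub> \<one>\<^bsub>K\<^esub>) \<odot>\<^bsub>dsum_space I V\<^esub> x) \<oplus>\<^bsub>dsum_space I V\<^esub> x = \<zero>\<^bsub>dsum_space I V\<^esub>"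
      using * by (auto simp: dsum_add dsum_smult dsum_zero)
    show "(\<ominus>\<^bsub>K\<^esub> \<one>\<^bsub>K\<^esub>) \<odot>\<^bsub>dsum_space I V\<^esub> x \<in> carrier (dsum_space I V)"
      using x V by (intro dsum_smult_closed) auto
  qed
  show "\<zero>\<^bsub>dsum_space I V\<^esub> \<oplus>\<^bsub>dsum_space I V\<^esub> x = x"
    using x abelian_monoid.l_zero[OF abelian_group.axioms(1)[OF module.axioms(2)[OF V]]]
    by (auto simp: dsum_add dsum_zero dsum_carrier fun_eq_iff)
  show "\<one>\<^bsub>K\<^esub> \<odot>\<^bsub>dsum_space I V\<^esub> x = x"
    using x by (auto simp: dsum_smult dsum_carrier mod fun_eq_iff)
  show "c \<odot>\<^bsub>dsum_space I V\<^esub> x \<in> carrier (dsum_space I V)" if "c \<in> carrier K"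
    using that x V by (rule_tac dsum_smult_closed)
  show "(c \<oplus>\<^bsub>K\<^esub> b) \<odot>\<^bsub>dsum_space I V\<^esub> x = c \<odot>\<^bsub>dsum_space I V\<^esub> x \<oplus>\<^bsub>dsum_space I V\<^esub> b \<odot>\<^bsub>dsum_space I V\<^esub> x"
    if "c \<in> carrier K" "b \<in> carrier K"
    using that x by (auto simp: dsum_smult dsum_add dsum_carrier mod)
  show "(c \<otimes>\<^bsub>K\<^esub> b) \<odot>\<^bsub>dsum_space I V\<^esub> x = c \<odot>\<^bsub>dsum_space I V\<^esub> (b \<odot>\<^bsub>dsum_space I V\<^esub> x)"
    if "c \<in> carrier K" "b \<in> carrier K"
    using that x by (auto simp: dsum_smult dsum_add dsum_carrier mod)
  assume y: "y \<in> carrier (dsum_space I V)"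
  show "x \<oplus>\<^bsub>dsum_space I V\<^esub> y \<in> carrier (dsum_space I V)"
    using x y V by (rule_tac dsum_add_closed)
  show "x \<oplus>\<^bsub>dsum_space I V\<^esub> y = y \<oplus>\<^bsub>dsum_space I V\<^esub> x"
    using x y by (auto simp: dsum_add dsum_carrier mod)
  show "c \<odot>\<^bsub>dsum_space I V\<^esub> (x \<oplus>\<^bsub>dsum_space I V\<^esub> y) = c \<odot>\<^bsub>dsum_space I V\<^esub> x \<oplus>\<^bsub>dsum_space I V\<^esub> c \<odot>\<^bsub>dsum_space I V\<^esub> y"
    if "c \<in> carrier K"
    using that x y by (auto simp: dsum_smult dsum_add dsum_carrier mod)
  assume z: "z \<in> carrier (dsum_space I V)"
  show "x \<oplus>\<^bsub>dsum_space I V\<^esub> y \<oplus>\<^bsub>dsum_space I V\<^esub> z = x \<oplus>\<^bsub>dsum_space I V\<^esub> (y \<oplus>\<^bsub>dsum_space I V\<^esub> z)"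
    using x y z by (auto simp: dsum_add dsum_carrier mod(1,3) fun_eq_iff)
qed

lemma dsum_inj_lin:
  assumes V: "\<And>i. i \<in> I \<Longrightarrow> module K (V i)" and i: "i \<in> I"
  shows "dsum_inj V i \<in> lin_maps K (V i) (dsum_space I V)"
proof (rule lin_mapsI)
  note mod = abelian_groupE[OF module.axioms(2)[OF V]] module.smult_r_null[OF V]
  show "dsum_inj V i x \<in> carrier (dsum_space I V)" if "x \<in> carrier (V i)" for x
  proof -
    have "finite {j. dsum_inj V i x j \<noteq> \<zero>\<^bsub>V j\<^esub>}"
      by (rule finite_subset[of _ "{i}"]) (auto simp: dsum_inj_def)
    then show ?thesis
      using that i by (auto simp: dsum_carrier dsum_inj_def mod)
  qed
qed (use i abelian_groupE[OF module.axioms(2)[OF V]] module.smult_r_null[OF V] in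
    \<open>auto simp: dsum_inj_def dsum_add dsum_smult\<close>)

text \<open>Induction on the finite support, splitting off one coordinate at a time: every element
  is a finite sum of injected ones.\<close>

lemma dsum_induct:
  assumes V: "\<And>i. i \<in> I \<Longrightarrow> module K (V i)" and "cring K"
    and H: "submodule H K (dsum_space I V)"
    and inj: "\<And>i x. i \<in> I \<Longrightarrow> x \<in> carrier (V i) \<Longrightarrow> dsum_inj V i x \<in> H"
    and h: "h \<in> carrier (dsum_space I V)"
  shows "h \<in> H"
proof -
  note mod = abelian_groupE[OF module.axioms(2)[OF V]]
  have "finite {i. h i \<noteq> \<zero>\<^bsub>V i\<^esub>}" using h by (simp add: dsum_carrier)
  then show ?thesis using h
  proof (induction "{i. h i \<noteq> \<zero>\<^bsub>V i\<^esub>}" arbitrary: h rule: finite_induct)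
    case empty
    then have "h = \<zero>\<^bsub>dsum_space I V\<^esub>" by (auto simp: dsum_zero)
    then show ?case using subspace_zero[OF H] by simp
  next
    case (insert i A)
    define h' where "h' = h(i := \<zero>\<^bsub>V i\<^esub>)"
    have i: "i \<in> I" using insert by (auto simp: dsum_carrier)
    have A: "A = {i. h' i \<noteq> \<zero>\<^bsub>V i\<^esub>}"
      using insert(2,4) by (auto simp: h'_def)
    have h': "h' \<in> carrier (dsum_space I V)"
      unfolding dsum_carrier A[symmetric] using insert(1,5) i mod by (auto simp: h'_def dsum_carrier)
    have hi: "h i \<in> carrier (V i)" using insert(5) i by (simp add: dsum_carrier)
    have "h = h' \<oplus>\<^bsub>dsum_space I V\<^esub> dsum_inj V i (h i)"
    proof
      fix j
      show "h j = (h' \<oplus>\<^bsub>dsum_space I V\<^esub> dsum_inj V i (h i)) j"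
      proof (cases "j \<in> I")
        case True
        interpret Vj: module K "V j" using V[OF True] .
        have "h j \<in> carrier (V j)" using insert(5) True by (simp add: dsum_carrier)
        then show ?thesis
          using True by (cases "i = j") (simp_all add: dsum_add h'_def dsum_inj_def)
      next
        case False
        then show ?thesis using insert(5) by (auto simp: dsum_add dsum_carrier)
      qed
    qed
    moreover have "h' \<in> H" using insert(3)[OF A h'] .
    ultimately show ?case
      using subspace_add[OF H, of h' "dsum_inj V i (h i)"] inj[OF i hi] by simp
  qed
qed

text \<open>The universal property of the direct sum; the extension adds up \<open>g i (h i)\<close>
  over the support of \<open>h\<close>.\<close>

lemma dsum_ext:
  assumes V: "\<And>i. i \<in> I \<Longrightarrow> module K (V i)" and Z: "module K Z"
    and g: "\<And>i. i \<in> I \<Longrightarrow> g i \<in> lin_maps K (V i) Z"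
  obtains f where "f \<in> lin_maps K (dsum_space I V) Z"
    and "\<And>i x. i \<in> I \<Longrightarrow> x \<in> carrier (V i) \<Longrightarrow> f (dsum_inj V i x) = g i x"
proof -
  interpret Z: module K Z by fact
  define f where "f h = (\<Oplus>\<^bsub>Z\<^esub>i\<in>{i. h i \<noteq> \<zero>\<^bsub>V i\<^esub>}. g i (h i))" for h
  note g0 = lin_maps_zero[OF V Z g]
  \<comment> \<open>The supports of \<open>h\<close>, of a multiple and of a sum differ, so
    linearity is checked after enlarging them to a common finite set \<open>A\<close>.\<close>
  have f: "f h = (\<Oplus>\<^bsub>Z\<^esub>i\<in>A. g i (h i))"
    if "h \<in> carrier (dsum_space I V)" "finite A" "{i. h i \<noteq> \<zero>\<^bsub>V i\<^esub>} \<subseteq> A" "A \<subseteq> I" for h A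
    unfolding f_def
  proof (rule finsum_superset[OF Z that(2,3)])
    show "(\<lambda>i. g i (h i)) \<in> A \<rightarrow> carrier Z"
      using that lin_maps_closed[OF g] by (auto simp: dsum_carrier)
  qed (use that g0 in auto)
  have supp: "finite {i. h i \<noteq> \<zero>\<^bsub>V i\<^esub>}" "{i. h i \<noteq> \<zero>\<^bsub>V i\<^esub>} \<subseteq> I"
    if "h \<in> carrier (dsum_space I V)" for h
    using that by (auto simp: dsum_carrier)
  have "f \<in> lin_maps K (dsum_space I V) Z"
  proof (rule lin_mapsI)
    fix h assume h: "h \<in> carrier (dsum_space I V)"
    let ?A = "{i. h i \<noteq> \<zero>\<^bsub>V i\<^esub>}"
    have gh: "g i (h i) \<in> carrier Z" if "i \<in> I" for i
      using that h lin_maps_closed[OF g] by (auto simp: dsum_carrier)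
    show "f h \<in> carrier Z"
      unfolding f_def using gh supp[OF h] by (intro Z.M.finsum_closed) auto
    show "f (c \<odot>\<^bsub>dsum_space I V\<^esub> h) = c \<odot>\<^bsub>Z\<^esub> f h" if c: "c \<in> carrier K" for c
    proof -
      have "f (c \<odot>\<^bsub>dsum_space I V\<^esub> h) = (\<Oplus>\<^bsub>Z\<^esub>i\<in>?A. g i ((c \<odot>\<^bsub>dsum_space I V\<^esub> h) i))"
        using supp[OF h] h c module.smult_r_null[OF V c]
        by (intro f dsum_smult_closed) (auto simp: dsum_smult V)
      also have "\<dots> = (\<Oplus>\<^bsub>Z\<^esub>i\<in>?A. c \<odot>\<^bsub>Z\<^esub> g i (h i))"
        using supp[OF h] gh h c
        by (intro Z.M.finsum_cong') (auto simp: dsum_smult dsum_carrier lin_maps_smult[OF g])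
      also have "\<dots> = c \<odot>\<^bsub>Z\<^esub> (\<Oplus>\<^bsub>Z\<^esub>i\<in>?A. g i (h i))"
        using supp[OF h] gh c by (intro Z.finsum_smult_ldistr[symmetric]) auto
      finally show ?thesis by (simp add: f_def)
    qed
    fix h' assume h': "h' \<in> carrier (dsum_space I V)"
    let ?B = "?A \<union> {i. h' i \<noteq> \<zero>\<^bsub>V i\<^esub>}"
    have gh': "g i (h' i) \<in> carrier Z" if "i \<in> I" for i
      using that h' lin_maps_closed[OF g] by (auto simp: dsum_carrier)
    have B: "finite ?B" "?B \<subseteq> I" using supp[OF h] supp[OF h'] by auto
    have z: "\<zero>\<^bsub>V i\<^esub> \<oplus>\<^bsub>V i\<^esub> \<zero>\<^bsub>V i\<^esub> = \<zero>\<^bsub>V i\<^esub>" if "i \<in> I" for i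
      using abelian_groupE(2,5)[OF module.axioms(2)[OF V[OF that]]] by simp
    have "f (h \<oplus>\<^bsub>dsum_space I V\<^esub> h') = (\<Oplus>\<^bsub>Z\<^esub>i\<in>?B. g i ((h \<oplus>\<^bsub>dsum_space I V\<^esub> h') i))"
      using B h h' z by (intro f dsum_add_closed[OF V]) (auto simp: dsum_add)
    also have "\<dots> = (\<Oplus>\<^bsub>Z\<^esub>i\<in>?B. g i (h i) \<oplus>\<^bsub>Z\<^esub> g i (h' i))"
      using B gh gh' h h'
      by (intro Z.M.finsum_cong') (auto simp: dsum_add dsum_carrier lin_maps_add[OF g])
    also have "\<dots> = (\<Oplus>\<^bsub>Z\<^esub>i\<in>?B. g i (h i)) \<oplus>\<^bsub>Z\<^esub> (\<Oplus>\<^bsub>Z\<^esub>i\<in>?B. g i (h' i))"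
      using B gh gh' by (intro Z.M.finsum_addf) auto
    also have "(\<Oplus>\<^bsub>Z\<^esub>i\<in>?B. g i (h i)) = f h" using B h by (intro f[symmetric]) auto
    also have "(\<Oplus>\<^bsub>Z\<^esub>i\<in>?B. g i (h' i)) = f h'" using B h' by (intro f[symmetric]) auto
    finally show "f (h \<oplus>\<^bsub>dsum_space I V\<^esub> h') = f h \<oplus>\<^bsub>Z\<^esub> f h'" .
  qed
  moreover have "f (dsum_inj V i x) = g i x" if "i \<in> I" "x \<in> carrier (V i)" for i x
  proof -
    have "f (dsum_inj V i x) = (\<Oplus>\<^bsub>Z\<^esub>j\<in>{i}. g j (dsum_inj V i x j))"
      using that lin_maps_closed[OF dsum_inj_lin[OF V]]
      by (intro f) (auto simp: dsum_inj_def)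
    then show ?thesis
      using that lin_maps_closed[OF g] by (simp add: dsum_inj_def)
  qed
  ultimately show ?thesis using that by blast
qed

lemma dsum_map_inj:
  assumes "i \<in> I" "\<And>j. j \<in> I \<Longrightarrow> \<phi> j \<zero>\<^bsub>V j\<^esub> = \<zero>\<^bsub>V' j\<^esub>"
  shows "dsum_map I V' \<phi> (dsum_inj V i x) = dsum_inj V' i (\<phi> i x)"
  using assms by (auto simp: dsum_map_def dsum_inj_def)

lemma dsum_map_lin:
  assumes V: "\<And>i. i \<in> I \<Longrightarrow> module K (V i)" and V': "\<And>i. i \<in> I \<Longrightarrow> module K (V' i)"
    and \<phi>: "\<And>i. i \<in> I \<Longrightarrow> \<phi> i \<in> lin_maps K (V i) (V' i)"
  shows "dsum_map I V' \<phi> \<in> lin_maps K (dsum_space I V) (dsum_space I V')"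
proof (rule lin_mapsI)
  note z = lin_maps_zero[OF V V' \<phi>]
  fix h assume h: "h \<in> carrier (dsum_space I V)"
  have "{i. dsum_map I V' \<phi> h i \<noteq> \<zero>\<^bsub>V' i\<^esub>} \<subseteq> {i. h i \<noteq> \<zero>\<^bsub>V i\<^esub>}"
    using z by (auto simp: dsum_map_def)
  then have "finite {i. dsum_map I V' \<phi> h i \<noteq> \<zero>\<^bsub>V' i\<^esub>}"
    using h by (auto simp: dsum_carrier intro: finite_subset)
  then show "dsum_map I V' \<phi> h \<in> carrier (dsum_space I V')"
    using h lin_maps_closed[OF \<phi>] by (auto simp: dsum_carrier dsum_map_def)
qed (use lin_maps_add[OF \<phi>] lin_maps_smult[OF \<phi>] in
    \<open>auto simp: dsum_map_def dsum_add dsum_smult dsum_carrier\<close>)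


section \<open>Free vector spaces\<close>

text \<open>\<open>K\<close> as a vector space over itself. It turns free spaces into direct sums,
  from which they inherit their induction and extension properties.\<close>

definition ground_space :: "('k, 'm) ring_scheme \<Rightarrow> ('k, 'k) module" where
  "ground_space K = \<lparr> carrier = carrier K, mult = mult K, one = one K, zero = zero K, add = add K,
     smult = mult K \<rparr>"

lemma ground_space_module: "cring K \<Longrightarrow> module K (ground_space K)"
proof -
  assume "cring K"
  then interpret K: cring K .
  show ?thesis
    by (intro moduleI abelian_groupI K.is_cring)
      (auto simp: ground_space_def K.a_ac K.l_distr K.r_distr K.m_assoc
        intro!: bexI[of _ "\<ominus>\<^bsub>K\<^esub> x" for x] K.l_neg)
qed

text \<open>The two records are not equal: off the carrier, addition in \<open>dsum_space\<close> is
  cut off outside \<open>S\<close>, while in \<open>free_space\<close> it is not.\<close>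

lemma free_space_dsum:
  fixes K :: "('k, 'm) ring_scheme"
  assumes "cring K"
  defines "D S \<equiv> dsum_space S (\<lambda>_. ground_space K)"
  shows "carrier (free_space K S) = carrier (D S)" "\<zero>\<^bsub>free_space K S\<^esub> = \<zero>\<^bsub>D S\<^esub>"
    "\<And>x y. x \<in> carrier (D S) \<Longrightarrow> y \<in> carrier (D S) \<Longrightarrow> x \<oplus>\<^bsub>free_space K S\<^esub> y = x \<oplus>\<^bsub>D S\<^esub> y"
    "\<And>c x. c \<in> carrier K \<Longrightarrow> x \<in> carrier (D S) \<Longrightarrow> c \<odot>\<^bsub>free_space K S\<^esub> x = c \<odot>\<^bsub>D S\<^esub> x"
proof -
  interpret K: cring K by fact
  show "carrier (free_space K S) = carrier (D S)" "\<zero>\<^bsub>free_space K S\<^esub> = \<zero>\<^bsub>D S\<^esub>"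
    by (simp_all add: D_def free_space_def dsum_space_def ground_space_def)
  show "\<And>x y. x \<in> carrier (D S) \<Longrightarrow> y \<in> carrier (D S) \<Longrightarrow> x \<oplus>\<^bsub>free_space K S\<^esub> y = x \<oplus>\<^bsub>D S\<^esub> y"
    "\<And>c x. c \<in> carrier K \<Longrightarrow> x \<in> carrier (D S) \<Longrightarrow> c \<odot>\<^bsub>free_space K S\<^esub> x = c \<odot>\<^bsub>D S\<^esub> x"
    by (auto simp: D_def free_space_def dsum_space_def ground_space_def fun_eq_iff)
qed

lemma free_module: "cring K \<Longrightarrow> module K (free_space K S)"
  by (rule module_transfer[OF dsum_module[of K S "\<lambda>_. ground_space K"]])
    (simp_all add: ground_space_module free_space_dsum)

lemma free_gen_inj: "free_gen K x = dsum_inj (\<lambda>_. ground_space K) x \<one>\<^bsub>K\<^esub>"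
  by (auto simp: free_gen_def dsum_inj_def ground_space_def fun_eq_iff)

lemma free_gen_closed:
  assumes "cring K" "x \<in> S"
  shows "free_gen K x \<in> carrier (free_space K S)"
proof -
  interpret K: cring K by fact
  have "finite {y. y = x \<and> \<one>\<^bsub>K\<^esub> \<noteq> \<zero>\<^bsub>K\<^esub>}" by simp
  then show ?thesis using assms by (auto simp: free_space_def free_gen_def)
qed

lemma free_smult_gen:
  assumes "cring K" "c \<in> carrier K"
  shows "c \<odot>\<^bsub>free_space K S\<^esub> free_gen K x = dsum_inj (\<lambda>_. ground_space K) x c"
proof -
  interpret K: cring K by fact
  show ?thesis using assms
    by (auto simp: free_gen_def dsum_inj_def ground_space_def free_space_def fun_eq_iff)
qed

lemma free_induct:
  assumes K: "cring K" and H: "submodule H K (free_space K S)"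
    and gen: "\<And>x. x \<in> S \<Longrightarrow> free_gen K x \<in> H" and h: "h \<in> carrier (free_space K S)"
  shows "h \<in> H"
proof (rule dsum_induct[of S K "\<lambda>_. ground_space K"])
  have sub: "H \<subseteq> carrier (free_space K S)" using subspace_subset[OF H] by auto
  show "submodule H K (dsum_space S (\<lambda>_. ground_space K))"
    using sub subspace_add[OF H] subspace_smult[OF H] subspace_zero[OF H] K
    by (intro subspaceI dsum_module ground_space_module) (auto simp: free_space_dsum subset_iff)
  show "dsum_inj (\<lambda>_. ground_space K) x c \<in> H" if "x \<in> S" "c \<in> carrier (ground_space K)" for x c
    using that subspace_smult[OF H _ gen[of x], of c] free_smult_gen[OF K, of c S x]
    by (simp add: ground_space_def)
qed (use K h in \<open>simp_all add: ground_space_module free_space_dsum\<close>)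

lemma free_ext:
  assumes K: "cring K" and Z: "module K Z" and \<beta>: "\<And>x. x \<in> S \<Longrightarrow> \<beta> x \<in> carrier Z"
  obtains f where "f \<in> lin_maps K (free_space K S) Z"
    and "\<And>x. x \<in> S \<Longrightarrow> f (free_gen K x) = \<beta> x"
proof -
  interpret Z: module K Z by fact
  have "(\<lambda>c. c \<odot>\<^bsub>Z\<^esub> \<beta> x) \<in> lin_maps K (ground_space K) Z" if "x \<in> S" for x
    using \<beta>[OF that] by (intro lin_mapsI) (auto simp: ground_space_def Z.smult_l_distr Z.smult_assoc1)
  then obtain f where f: "f \<in> lin_maps K (dsum_space S (\<lambda>_. ground_space K)) Z"
    "\<And>x c. x \<in> S \<Longrightarrow> c \<in> carrier (ground_space K) \<Longrightarrow>
      f (dsum_inj (\<lambda>_. ground_space K) x c) = c \<odot>\<^bsub>Z\<^esub> \<beta> x"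
    using dsum_ext[OF ground_space_module[OF K] Z, of S "\<lambda>x c. c \<odot>\<^bsub>Z\<^esub> \<beta> x"] by blast
  have "f \<in> lin_maps K (free_space K S) Z"
    using f(1) by (auto simp: lin_maps_def free_space_dsum[OF K])
  moreover have "f (free_gen K x) = \<beta> x" if "x \<in> S" for x
    using that f(2)[of x "\<one>\<^bsub>K\<^esub>"] \<beta> by (simp add: free_gen_inj ground_space_def)
  ultimately show ?thesis using that by blast
qed

lemma free_map_lin:
  assumes K: "cring K" and \<phi>: "\<And>x. x \<in> S \<Longrightarrow> \<phi> x \<in> S'"
  shows "free_map K \<phi> \<in> lin_maps K (free_space K S) (free_space K S')"
proof (rule lin_mapsI)
  interpret K: cring K by fact
  have G: "module K (ground_space K)" using K by (rule ground_space_module)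
  \<comment> \<open>\<open>finsum\<close> reads only the carrier, zero and addition of a record, so
    sums in \<open>K\<close> may use the lemmas for vector spaces.\<close>
  have fs: "finsum (ground_space K) = finsum K"
    by (simp add: finsum_def finprod_def ground_space_def fun_eq_iff)
  \<comment> \<open>As for direct sums, the sum over a fibre of \<open>\<phi>\<close> may run over
    any finite part of \<open>S\<close> that contains the support.\<close>
  have sup: "free_map K \<phi> h y = (\<Oplus>\<^bsub>K\<^esub>x\<in>{x \<in> A. \<phi> x = y}. h x)"
    if "h \<in> carrier (free_space K S)" "finite A" "{x. h x \<noteq> \<zero>\<^bsub>K\<^esub>} \<subseteq> A" "A \<subseteq> S" for h A y
    unfolding free_map_def fs[symmetric]
    by (rule finsum_superset[OF G]) (use that in \<open>auto simp: free_space_def ground_space_def\<close>)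
  have supp: "finite {x. h x \<noteq> \<zero>\<^bsub>K\<^esub>}" "{x. h x \<noteq> \<zero>\<^bsub>K\<^esub>} \<subseteq> S" "\<And>x. x \<in> S \<Longrightarrow> h x \<in> carrier K"
    if "h \<in> carrier (free_space K S)" for h
    using that by (auto simp: free_space_def)
  interpret F: module K "free_space K S" using K by (rule free_module)
  fix h assume h: "h \<in> carrier (free_space K S)"
  let ?A = "{x. h x \<noteq> \<zero>\<^bsub>K\<^esub>}"
  have z: "free_map K \<phi> h y = \<zero>\<^bsub>K\<^esub>" if "y \<notin> \<phi> ` ?A" for y
  proof -
    have *: "{x. h x \<noteq> \<zero>\<^bsub>K\<^esub> \<and> \<phi> x = y} = {}" using that by auto
    show ?thesis unfolding free_map_def * by simp
  qed
  have "{y. free_map K \<phi> h y \<noteq> \<zero>\<^bsub>K\<^esub>} \<subseteq> \<phi> ` ?A" using z by auto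
  then have "finite {y. free_map K \<phi> h y \<noteq> \<zero>\<^bsub>K\<^esub>}"
    using supp(1)[OF h] finite_subset by blast
  moreover have "free_map K \<phi> h y \<in> carrier K" for y
    unfolding free_map_def using supp[OF h] by (intro K.finsum_closed) auto
  moreover have "free_map K \<phi> h y = \<zero>\<^bsub>K\<^esub>" if "y \<notin> S'" for y
    using that supp[OF h] \<phi> by (intro z) auto
  ultimately show "free_map K \<phi> h \<in> carrier (free_space K S')"
    by (simp add: free_space_def)
  show "free_map K \<phi> (c \<odot>\<^bsub>free_space K S\<^esub> h) = c \<odot>\<^bsub>free_space K S'\<^esub> free_map K \<phi> h"
    if c: "c \<in> carrier K" for c
  proof
    fix y
    have c0: "c \<otimes>\<^bsub>K\<^esub> \<zero>\<^bsub>K\<^esub> = \<zero>\<^bsub>K\<^esub>" using c by simp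
    have "free_map K \<phi> (c \<odot>\<^bsub>free_space K S\<^esub> h) y = (\<Oplus>\<^bsub>K\<^esub>x\<in>{x \<in> ?A. \<phi> x = y}. c \<otimes>\<^bsub>K\<^esub> h x)"
      using supp[OF h] h c c0
      by (subst sup[OF F.smult_closed[OF c h] supp(1)[OF h]]) (auto simp: free_space_def)
    also have "\<dots> = c \<otimes>\<^bsub>K\<^esub> (\<Oplus>\<^bsub>K\<^esub>x\<in>{x \<in> ?A. \<phi> x = y}. h x)"
      using supp[OF h] c by (intro K.finsum_rdistr[symmetric]) auto
    finally show "free_map K \<phi> (c \<odot>\<^bsub>free_space K S\<^esub> h) y = (c \<odot>\<^bsub>free_space K S'\<^esub> free_map K \<phi> h) y"
      by (simp add: free_map_def free_space_def)
  qed
  fix h' assume h': "h' \<in> carrier (free_space K S)"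
  let ?B = "?A \<union> {x. h' x \<noteq> \<zero>\<^bsub>K\<^esub>}"
  have B: "finite ?B" "?B \<subseteq> S" using supp[OF h] supp[OF h'] by auto
  show "free_map K \<phi> (h \<oplus>\<^bsub>free_space K S\<^esub> h') =
      free_map K \<phi> h \<oplus>\<^bsub>free_space K S'\<^esub> free_map K \<phi> h'"
  proof
    fix y
    have "free_map K \<phi> (h \<oplus>\<^bsub>free_space K S\<^esub> h') y =
        (\<Oplus>\<^bsub>K\<^esub>x\<in>{x \<in> ?B. \<phi> x = y}. h x \<oplus>\<^bsub>K\<^esub> h' x)"
      by (subst sup[OF F.M.a_closed[OF h h'] B(1)]) (use B in \<open>auto simp: free_space_def\<close>)
    also have "\<dots> = (\<Oplus>\<^bsub>K\<^esub>x\<in>{x \<in> ?B. \<phi> x = y}. h x) \<oplus>\<^bsub>K\<^esub> (\<Oplus>\<^bsub>K\<^esub>x\<in>{x \<in> ?B. \<phi> x = y}. h' x)"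
      using B supp(3)[OF h] supp(3)[OF h'] by (intro K.finsum_addf) auto
    also have "\<dots> = free_map K \<phi> h y \<oplus>\<^bsub>K\<^esub> free_map K \<phi> h' y"
      using sup[OF h B(1) _ B(2)] sup[OF h' B(1) _ B(2)] by simp
    finally show "free_map K \<phi> (h \<oplus>\<^bsub>free_space K S\<^esub> h') y =
        (free_map K \<phi> h \<oplus>\<^bsub>free_space K S'\<^esub> free_map K \<phi> h') y"
      by (simp add: free_space_def)
  qed
qed

lemma free_map_gen:
  assumes "cring K"
  shows "free_map K \<phi> (free_gen K x) = free_gen K (\<phi> x)"
proof
  interpret K: cring K by fact
  fix y
  have "{x'. free_gen K x x' \<noteq> \<zero>\<^bsub>K\<^esub> \<and> \<phi> x' = y} = (if \<phi> x = y \<and> \<one>\<^bsub>K\<^esub> \<noteq> \<zero>\<^bsub>K\<^esub> then {x} else {})"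
    by (auto simp: free_gen_def)
  then show "free_map K \<phi> (free_gen K x) y = free_gen K (\<phi> x) y"
    by (auto simp: free_map_def free_gen_def)
qed


section \<open>Tensor products of vector spaces\<close>

text \<open>The pure tensor of \<open>v\<close> and \<open>w\<close>, through which elements of
  \<open>tensor_space\<close> are handled from here on.\<close>

definition tens ::
  "('k, 'm) ring_scheme \<Rightarrow> ('k, 'a) module \<Rightarrow> ('k, 'b) module \<Rightarrow> 'a \<Rightarrow> 'b \<Rightarrow> ('a \<times> 'b \<Rightarrow> 'k) set"
  where "tens K V W v w =
    tensor_null K V W +>\<^bsub>free_space K (carrier V \<times> carrier W)\<^esub> free_gen K (v, w)"

definition bilinear_map ::
  "('k, 'm) ring_scheme \<Rightarrow> ('k, 'a) module \<Rightarrow> ('k, 'b) module \<Rightarrow> ('k, 'c) module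
     \<Rightarrow> ('a \<Rightarrow> 'b \<Rightarrow> 'c) \<Rightarrow> bool"
  where "bilinear_map K V W Z \<beta> \<longleftrightarrow>
    (\<forall>w\<in>carrier W. (\<lambda>v. \<beta> v w) \<in> lin_maps K V Z) \<and> (\<forall>v\<in>carrier V. \<beta> v \<in> lin_maps K W Z)"

lemma module_cring: "module K V \<Longrightarrow> cring K"
  by (simp add: module_def)

lemma tensor_rels_subset:
  assumes V: "module K V" and W: "module K W"
  shows "tensor_rels K V W \<subseteq> carrier (free_space K (carrier V \<times> carrier W))"
proof -
  interpret V: module K V by fact
  interpret W: module K W by fact
  interpret F: module K "free_space K (carrier V \<times> carrier W)"
    by (rule free_module[OF V.R.is_cring])
  note [simp] = free_gen_closed[OF V.R.is_cring]
  show ?thesis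
    by (auto simp: tensor_rels_def Let_def)
qed

lemma tensor_rels_intros:
  fixes K :: "('k, 'm) ring_scheme" and V :: "('k, 'a) module" and W :: "('k, 'b) module"
  defines "F \<equiv> free_space K (carrier V \<times> carrier W)"
  shows "v \<in> carrier V \<Longrightarrow> v' \<in> carrier V \<Longrightarrow> w \<in> carrier W \<Longrightarrow>
      free_gen K (v \<oplus>\<^bsub>V\<^esub> v', w) \<ominus>\<^bsub>F\<^esub> (free_gen K (v, w) \<oplus>\<^bsub>F\<^esub> free_gen K (v', w)) \<in> tensor_rels K V W"
    and "v \<in> carrier V \<Longrightarrow> w \<in> carrier W \<Longrightarrow> w' \<in> carrier W \<Longrightarrow>
      free_gen K (v, w \<oplus>\<^bsub>W\<^esub> w') \<ominus>\<^bsub>F\<^esub> (free_gen K (v, w) \<oplus>\<^bsub>F\<^esub> free_gen K (v, w')) \<in> tensor_rels K V W"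
    and "c \<in> carrier K \<Longrightarrow> v \<in> carrier V \<Longrightarrow> w \<in> carrier W \<Longrightarrow>
      free_gen K (c \<odot>\<^bsub>V\<^esub> v, w) \<ominus>\<^bsub>F\<^esub> (c \<odot>\<^bsub>F\<^esub> free_gen K (v, w)) \<in> tensor_rels K V W"
    and "c \<in> carrier K \<Longrightarrow> v \<in> carrier V \<Longrightarrow> w \<in> carrier W \<Longrightarrow>
      free_gen K (v, c \<odot>\<^bsub>W\<^esub> w) \<ominus>\<^bsub>F\<^esub> (c \<odot>\<^bsub>F\<^esub> free_gen K (v, w)) \<in> tensor_rels K V W"
proof -
  note d = tensor_rels_def[of K V W] Let_def F_def
  show "v \<in> carrier V \<Longrightarrow> v' \<in> carrier V \<Longrightarrow> w \<in> carrier W \<Longrightarrow>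
      free_gen K (v \<oplus>\<^bsub>V\<^esub> v', w) \<ominus>\<^bsub>F\<^esub> (free_gen K (v, w) \<oplus>\<^bsub>F\<^esub> free_gen K (v', w)) \<in> tensor_rels K V W"
    unfolding d by (rule UnI1, rule UnI1, rule UnI1, rule CollectI, intro exI, rule conjI, rule refl) simp
  show "v \<in> carrier V \<Longrightarrow> w \<in> carrier W \<Longrightarrow> w' \<in> carrier W \<Longrightarrow>
      free_gen K (v, w \<oplus>\<^bsub>W\<^esub> w') \<ominus>\<^bsub>F\<^esub> (free_gen K (v, w) \<oplus>\<^bsub>F\<^esub> free_gen K (v, w')) \<in> tensor_rels K V W"
    unfolding d by (rule UnI1, rule UnI1, rule UnI2, rule CollectI, intro exI, rule conjI, rule refl) simp
  show "c \<in> carrier K \<Longrightarrow> v \<in> carrier V \<Longrightarrow> w \<in> carrier W \<Longrightarrow>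
      free_gen K (c \<odot>\<^bsub>V\<^esub> v, w) \<ominus>\<^bsub>F\<^esub> (c \<odot>\<^bsub>F\<^esub> free_gen K (v, w)) \<in> tensor_rels K V W"
    unfolding d by (rule UnI1, rule UnI2, rule CollectI, intro exI, rule conjI, rule refl) simp
  show "c \<in> carrier K \<Longrightarrow> v \<in> carrier V \<Longrightarrow> w \<in> carrier W \<Longrightarrow>
      free_gen K (v, c \<odot>\<^bsub>W\<^esub> w) \<ominus>\<^bsub>F\<^esub> (c \<odot>\<^bsub>F\<^esub> free_gen K (v, w)) \<in> tensor_rels K V W"
    unfolding d by (rule UnI2, rule CollectI, intro exI, rule conjI, rule refl) simp
qed

lemma tensor_null_least:
  fixes K :: "('k, 'm) ring_scheme" and V :: "('k, 'a) module" and W :: "('k, 'b) module"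
  defines "F \<equiv> free_space K (carrier V \<times> carrier W)"
  assumes "submodule H K F"
    and "\<And>v v' w. v \<in> carrier V \<Longrightarrow> v' \<in> carrier V \<Longrightarrow> w \<in> carrier W \<Longrightarrow>
      free_gen K (v \<oplus>\<^bsub>V\<^esub> v', w) \<ominus>\<^bsub>F\<^esub> (free_gen K (v, w) \<oplus>\<^bsub>F\<^esub> free_gen K (v', w)) \<in> H"
    and "\<And>v w w'. v \<in> carrier V \<Longrightarrow> w \<in> carrier W \<Longrightarrow> w' \<in> carrier W \<Longrightarrow>
      free_gen K (v, w \<oplus>\<^bsub>W\<^esub> w') \<ominus>\<^bsub>F\<^esub> (free_gen K (v, w) \<oplus>\<^bsub>F\<^esub> free_gen K (v, w')) \<in> H"
    and "\<And>c v w. c \<in> carrier K \<Longrightarrow> v \<in> carrier V \<Longrightarrow> w \<in> carrier W \<Longrightarrow>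
      free_gen K (c \<odot>\<^bsub>V\<^esub> v, w) \<ominus>\<^bsub>F\<^esub> (c \<odot>\<^bsub>F\<^esub> free_gen K (v, w)) \<in> H"
    and "\<And>c v w. c \<in> carrier K \<Longrightarrow> v \<in> carrier V \<Longrightarrow> w \<in> carrier W \<Longrightarrow>
      free_gen K (v, c \<odot>\<^bsub>W\<^esub> w) \<ominus>\<^bsub>F\<^esub> (c \<odot>\<^bsub>F\<^esub> free_gen K (v, w)) \<in> H"
  shows "tensor_null K V W \<subseteq> H"
  unfolding tensor_null_def
  using assms(2-) unfolding F_def
  by (intro lin_span_least) (auto simp only: tensor_rels_def Let_def)

lemma tensor_null_subspace:
  "module K V \<Longrightarrow> module K W \<Longrightarrow>
    submodule (tensor_null K V W) K (free_space K (carrier V \<times> carrier W))"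
  unfolding tensor_null_def
  by (intro lin_span_subspace free_module tensor_rels_subset) (auto dest: module_cring)

lemma tensor_module: "module K V \<Longrightarrow> module K W \<Longrightarrow> module K (tensor_space K V W)"
  unfolding tensor_space_def
  by (intro quot_module free_module tensor_null_subspace) (auto dest: module_cring)

lemma tens_proj:
  assumes "module K V" "module K W"
  shows "(\<lambda>h. tensor_null K V W +>\<^bsub>free_space K (carrier V \<times> carrier W)\<^esub> h)
    \<in> lin_maps K (free_space K (carrier V \<times> carrier W)) (tensor_space K V W)"
  unfolding tensor_space_def
  by (intro quot_proj free_module tensor_null_subspace assms module_cring[OF assms(1)])

lemma tens_bilinear:
  assumes V: "module K V" and W: "module K W"
  shows "bilinear_map K V W (tensor_space K V W) (tens K V W)"
proof -
  interpret V: module K V by fact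
  interpret W: module K W by fact
  define F where "F = free_space K (carrier V \<times> carrier W)"
  interpret F: module K F
    unfolding F_def by (rule free_module[OF V.R.is_cring])
  have pr: "(\<lambda>h. tensor_null K V W +>\<^bsub>F\<^esub> h) \<in> lin_maps K F (tensor_space K V W)"
    unfolding F_def by (rule tens_proj[OF V W])
  have gen: "free_gen K (v, w) \<in> carrier F" if "v \<in> carrier V" "w \<in> carrier W" for v w
    unfolding F_def using that by (simp add: free_gen_closed[OF V.R.is_cring])
  have eq: "tensor_null K V W +>\<^bsub>F\<^esub> x = tensor_null K V W +>\<^bsub>F\<^esub> y"
    if "x \<ominus>\<^bsub>F\<^esub> y \<in> tensor_rels K V W" "x \<in> carrier F" "y \<in> carrier F" for x y
    using that lin_span_superset[of "x \<ominus>\<^bsub>F\<^esub> y" "tensor_rels K V W" K F]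
      coset_eq_iff[OF free_module[OF V.R.is_cring] tensor_null_subspace[OF V W]]
    unfolding F_def tensor_null_def by blast
  note pr' = lin_maps_closed[OF pr gen] lin_maps_add[OF pr gen gen, symmetric]
    lin_maps_smult[OF pr _ gen, symmetric]
  note r = tensor_rels_intros[where K = K and V = V and W = W, folded F_def]
  show ?thesis
    unfolding bilinear_map_def tens_def F_def[symmetric]
    by (intro conjI ballI lin_mapsI)
      (simp_all add: pr', (intro eq r; simp add: gen)+)
qed

lemma tens_closed:
  "module K V \<Longrightarrow> module K W \<Longrightarrow> v \<in> carrier V \<Longrightarrow> w \<in> carrier W
    \<Longrightarrow> tens K V W v w \<in> carrier (tensor_space K V W)"
  using tens_bilinear[of K V W] lin_maps_closed[of "tens K V W v" K W "tensor_space K V W" w]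
  by (simp add: bilinear_map_def)

text \<open>The projection from the free space pulls \<open>H\<close> back to a subspace containing
  all generators, hence everything. Identities between linear maps on a tensor product therefore
  need checking on pure tensors only.\<close>

lemma tensor_induct:
  assumes V: "module K V" and W: "module K W" and H: "submodule H K (tensor_space K V W)"
    and tens: "\<And>v w. v \<in> carrier V \<Longrightarrow> w \<in> carrier W \<Longrightarrow> tens K V W v w \<in> H"
    and x: "x \<in> carrier (tensor_space K V W)"
  shows "x \<in> H"
proof -
  let ?F = "free_space K (carrier V \<times> carrier W)"
  let ?p = "\<lambda>h. tensor_null K V W +>\<^bsub>?F\<^esub> h"
  have K: "cring K" using V by (rule module_cring)
  have sub: "submodule {h \<in> carrier ?F. ?p h \<in> H} K ?F"
    by (intro subspace_vimage[OF _ _ tens_proj] free_module tensor_module V W H K)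
  obtain h where h: "h \<in> carrier ?F" "x = ?p h"
    using x unfolding tensor_space_def quot_carrier by auto
  have "h \<in> {h \<in> carrier ?F. ?p h \<in> H}"
    using tens h(1) by (rule_tac free_induct[OF K sub]) (auto simp: tens_def free_gen_closed[OF K])
  then show ?thesis using h by simp
qed

lemma tensor_lin_eq:
  assumes "module K V" "module K W" "module K Z"
    and "f \<in> lin_maps K (tensor_space K V W) Z" "g \<in> lin_maps K (tensor_space K V W) Z"
    and "\<And>v w. v \<in> carrier V \<Longrightarrow> w \<in> carrier W \<Longrightarrow> f (tens K V W v w) = g (tens K V W v w)"
    and "x \<in> carrier (tensor_space K V W)"
  shows "f x = g x"
  using tensor_induct[OF assms(1,2) subspace_equalizer[OF tensor_module assms(3-5)], of x] assms
  by (auto simp: tens_closed)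

text \<open>The universal property: \<open>\<beta>\<close> is extended linearly from pairs to the
  free space, and bilinearity says precisely that the four kinds of relations go to zero.\<close>

lemma tensor_ext:
  assumes V: "module K V" and W: "module K W" and Z: "module K Z" and \<beta>: "bilinear_map K V W Z \<beta>"
  obtains f where "f \<in> lin_maps K (tensor_space K V W) Z"
    and "\<And>v w. v \<in> carrier V \<Longrightarrow> w \<in> carrier W \<Longrightarrow> f (tens K V W v w) = \<beta> v w"
proof -
  interpret V: module K V by fact
  interpret W: module K W by fact
  interpret Z: module K Z by fact
  define F where "F = free_space K (carrier V \<times> carrier W)"
  have mF: "module K F" unfolding F_def by (rule free_module[OF V.R.is_cring])
  interpret F: module K F by fact
  have gen: "free_gen K (v, w) \<in> carrier F" if "v \<in> carrier V" "w \<in> carrier W" for v w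
    unfolding F_def using that by (simp add: free_gen_closed[OF V.R.is_cring])
  have bl: "\<And>w. w \<in> carrier W \<Longrightarrow> (\<lambda>v. \<beta> v w) \<in> lin_maps K V Z"
    and br: "\<And>v. v \<in> carrier V \<Longrightarrow> \<beta> v \<in> lin_maps K W Z"
    using \<beta> by (auto simp: bilinear_map_def)
  note b = lin_maps_closed[OF br] lin_maps_add[OF br] lin_maps_smult[OF br]
    lin_maps_add[OF bl] lin_maps_smult[OF bl]
  obtain f where f: "f \<in> lin_maps K F Z"
    "\<And>x. x \<in> carrier V \<times> carrier W \<Longrightarrow> f (free_gen K x) = case_prod \<beta> x"
    unfolding F_def
    by (rule free_ext[OF V.R.is_cring Z, of "carrier V \<times> carrier W" "case_prod \<beta>"]) (use b(1) in auto)
  have "tensor_null K V W \<subseteq> {x \<in> carrier F. f x \<in> {\<zero>\<^bsub>Z\<^esub>}}"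
  proof (rule tensor_null_least[where K = K and V = V and W = W, folded F_def])
    show "submodule {x \<in> carrier F. f x \<in> {\<zero>\<^bsub>Z\<^esub>}} K F"
      by (intro subspace_vimage[OF mF Z f(1)] subspaceI[OF Z]) auto
  qed (simp_all add: gen lin_maps_minus[OF mF Z f(1)] lin_maps_add[OF f(1)]
      lin_maps_smult[OF f(1)] f(2) b Z.M.r_neg a_minus_def[of Z])
  then obtain g where "g \<in> lin_maps K (tensor_space K V W) Z"
    "\<And>x. x \<in> carrier F \<Longrightarrow> g (tensor_null K V W +>\<^bsub>F\<^esub> x) = f x"
    using quot_lift[OF mF Z _ f(1), of "tensor_null K V W"] tensor_null_subspace[OF V W]
    unfolding tensor_space_def F_def[symmetric] by blast
  then show ?thesis
    using that f(2) gen unfolding tens_def F_def[symmetric] by fastforce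
qed

text \<open>As \<open>f\<close> and \<open>g\<close> are linear, the map on free spaces sends each
  bilinearity relation to a relation of the same kind, so it descends to the quotients.\<close>

lemma tensor_map_facts:
  assumes V: "module K V" and W: "module K W" and V': "module K V'" and W': "module K W'"
    and f: "f \<in> lin_maps K V V'" and g: "g \<in> lin_maps K W W'"
  shows tensor_map_lin:
      "tensor_map K V' W' f g \<in> lin_maps K (tensor_space K V W) (tensor_space K V' W')"
    and tensor_map_tens: "\<And>v w. v \<in> carrier V \<Longrightarrow> w \<in> carrier W \<Longrightarrow>
      tensor_map K V' W' f g (tens K V W v w) = tens K V' W' (f v) (g w)"
proof -
  interpret V: module K V by fact
  interpret W: module K W by fact
  interpret V': module K V' by fact
  interpret W': module K W' by fact
  have K: "cring K" using V by (rule module_cring)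
  define F where "F = free_space K (carrier V \<times> carrier W)"
  define F' where "F' = free_space K (carrier V' \<times> carrier W')"
  have mF: "module K F" "module K F'" unfolding F_def F'_def by (simp_all add: free_module K)
  have null: "submodule (tensor_null K V W) K F" "submodule (tensor_null K V' W') K F'"
    using tensor_null_subspace V W V' W' unfolding F_def F'_def by blast+
  note cl = lin_maps_closed[OF f] lin_maps_closed[OF g] lin_maps_add[OF f] lin_maps_add[OF g]
    lin_maps_smult[OF f] lin_maps_smult[OF g]
  have m: "free_map K (map_prod f g) \<in> lin_maps K F F'"
    unfolding F_def F'_def by (rule free_map_lin[OF K]) (auto simp: cl)
  have gen: "free_gen K (v, w) \<in> carrier F" if "v \<in> carrier V" "w \<in> carrier W" for v w
    unfolding F_def using that by (simp add: free_gen_closed[OF K])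
  interpret F: module K F by fact
  have R: "x \<in> tensor_null K V' W'" if "x \<in> tensor_rels K V' W'" for x
    using that unfolding tensor_null_def by (rule lin_span_superset)
  note r = tensor_rels_intros[where K = K and V = V' and W = W', folded F'_def]
  have "tensor_null K V W \<subseteq> {x \<in> carrier F. free_map K (map_prod f g) x \<in> tensor_null K V' W'}"
  proof (rule tensor_null_least[where K = K and V = V and W = W, folded F_def])
    show "submodule {x \<in> carrier F. free_map K (map_prod f g) x \<in> tensor_null K V' W'} K F"
      by (intro subspace_vimage[OF mF m] null)
  qed (simp_all add: gen cl lin_maps_minus[OF mF m] lin_maps_add[OF m]
        lin_maps_smult[OF m] free_map_gen[OF K] R r)
  then have sub: "free_map K (map_prod f g) ` tensor_null K V W \<subseteq> tensor_null K V' W'" by auto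
  show "tensor_map K V' W' f g \<in> lin_maps K (tensor_space K V W) (tensor_space K V' W')"
    unfolding tensor_map_def tensor_space_def F_def[symmetric] F'_def[symmetric]
    by (rule quot_map_lin[OF mF null m sub])
  show "tensor_map K V' W' f g (tens K V W v w) = tens K V' W' (f v) (g w)"
    if "v \<in> carrier V" "w \<in> carrier W" for v w
    unfolding tensor_map_def tens_def F_def[symmetric] F'_def[symmetric]
    using quot_map_coset[OF mF null m sub gen[OF that]] by (simp add: free_map_gen[OF K])
qed


section \<open>Tensor products of persistence modules\<close>

lemma colim_null_rel:
  "i \<in> I \<Longrightarrow> j \<in> I \<Longrightarrow> r i j \<Longrightarrow> x \<in> carrier (V i) \<Longrightarrow>
    dsum_inj V j (u i j x) \<ominus>\<^bsub>dsum_space I V\<^esub> dsum_inj V i x \<in> colim_null K I r V u"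
  unfolding colim_null_def
  by (rule lin_span_superset, rule CollectI, (rule exI)+, rule conjI, rule refl) simp

lemma colim_null_least:
  assumes "submodule H K (dsum_space I V)"
    and "\<And>i j x. i \<in> I \<Longrightarrow> j \<in> I \<Longrightarrow> r i j \<Longrightarrow> x \<in> carrier (V i) \<Longrightarrow>
      dsum_inj V j (u i j x) \<ominus>\<^bsub>dsum_space I V\<^esub> dsum_inj V i x \<in> H"
  shows "colim_null K I r V u \<subseteq> H"
  unfolding colim_null_def
  by (rule lin_span_least[OF assms(1)], rule subsetI, elim CollectE exE conjE, simp only:)
    (rule assms(2))

lemma colim_null_subspace:
  assumes "cring K" and V: "\<And>i. i \<in> I \<Longrightarrow> module K (V i)"
    and u: "\<And>i j x. i \<in> I \<Longrightarrow> j \<in> I \<Longrightarrow> r i j \<Longrightarrow> u i j \<in> lin_maps K (V i) (V j)"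
  shows "submodule (colim_null K I r V u) K (dsum_space I V)"
  unfolding colim_null_def
proof (rule lin_span_subspace)
  show m: "module K (dsum_space I V)" by (rule dsum_module[OF assms(1) V])
  interpret D: module K "dsum_space I V" by (rule m)
  show "{dsum_inj V j (u i j x) \<ominus>\<^bsub>dsum_space I V\<^esub> dsum_inj V i x | i j x.
        i \<in> I \<and> j \<in> I \<and> r i j \<and> x \<in> carrier (V i)} \<subseteq> carrier (dsum_space I V)"
  proof (rule subsetI, elim CollectE exE conjE, simp only:)
    fix i j x assume ij: "i \<in> I" "j \<in> I" "r i j" and x: "x \<in> carrier (V i)"
    show "dsum_inj V j (u i j x) \<ominus>\<^bsub>dsum_space I V\<^esub> dsum_inj V i x \<in> carrier (dsum_space I V)"
      by (intro D.M.minus_closed lin_maps_closed[OF dsum_inj_lin[OF V]] lin_maps_closed[OF u] ij x)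
  qed
qed

lemma dsum_incl_lin:
  assumes V: "\<And>i. i \<in> J \<Longrightarrow> module K (V i)" and "I \<subseteq> J"
  shows "(\<lambda>h. h) \<in> lin_maps K (dsum_space I V) (dsum_space J V)"
proof (rule lin_mapsI)
  have z: "\<zero>\<^bsub>V i\<^esub> \<in> carrier (V i)" "\<zero>\<^bsub>V i\<^esub> \<oplus>\<^bsub>V i\<^esub> \<zero>\<^bsub>V i\<^esub> = \<zero>\<^bsub>V i\<^esub>" if "i \<in> J" for i
    using abelian_groupE(2,5)[OF module.axioms(2)[OF V[OF that]]] by simp_all
  have z': "c \<odot>\<^bsub>V i\<^esub> \<zero>\<^bsub>V i\<^esub> = \<zero>\<^bsub>V i\<^esub>" if "i \<in> J" "c \<in> carrier K" for i c
    using module.smult_r_null[OF V[OF that(1)] that(2)] .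
  fix x assume x: "x \<in> carrier (dsum_space I V)"
  show "x \<in> carrier (dsum_space J V)"
    unfolding dsum_carrier
  proof (intro conjI ballI allI impI)
    show "x i \<in> carrier (V i)" if "i \<in> J" for i
      using x z(1)[OF that] by (cases "i \<in> I") (simp_all add: dsum_carrier)
    show "x i = \<zero>\<^bsub>V i\<^esub>" if "i \<notin> J" for i
      using x that assms(2) by (auto simp: dsum_carrier)
    show "finite {i. x i \<noteq> \<zero>\<^bsub>V i\<^esub>}"
      using x by (simp add: dsum_carrier)
  qed
  show "c \<odot>\<^bsub>dsum_space I V\<^esub> x = c \<odot>\<^bsub>dsum_space J V\<^esub> x" if "c \<in> carrier K" for c
    using x z' that assms(2) by (auto simp: dsum_carrier dsum_smult fun_eq_iff)
  show "x \<oplus>\<^bsub>dsum_space I V\<^esub> y = x \<oplus>\<^bsub>dsum_space J V\<^esub> y" if "y \<in> carrier (dsum_space I V)" for y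
    using x z that assms(2) by (auto simp: dsum_carrier dsum_add fun_eq_iff)
qed

text \<open>The class in \<open>(M \<otimes> N)(s)\<close> of the pure tensor of \<open>v\<close> in
  \<open>M(s1)\<close> and \<open>w\<close> in \<open>N(s2)\<close>, meaningful for
  \<open>s1 + s2 \<le> s\<close>. Its rules below take the place of the nested cosets of the
  definition in all later arguments.\<close>

definition ptens ::
  "('k, 'm) ring_scheme \<Rightarrow> ('k, 'a) persmod \<Rightarrow> ('k, 'b) persmod \<Rightarrow> real \<Rightarrow> real \<Rightarrow> real
     \<Rightarrow> 'a \<Rightarrow> 'b \<Rightarrow> (real \<times> real \<Rightarrow> ('a \<times> 'b \<Rightarrow> 'k) set) set"
  where "ptens K M N s s1 s2 v w =
    pm_tensor_null K M N s +>\<^bsub>pm_tensor_sum K M N s\<^esub>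
      dsum_inj (tensor_diag K M N) (s1, s2) (tens K (pm_ob M s1) (pm_ob N s2) v w)"

lemma pm_module: "persistence_module K M \<Longrightarrow> module K (pm_ob M t)"
  by (rule persistence_module.ob_module)

lemma pm_cring: "persistence_module K M \<Longrightarrow> cring K"
  by (simp add: persistence_module_def field_def domain_def)

lemma pm_tr_lin:
  "persistence_module K M \<Longrightarrow> s \<le> t \<Longrightarrow> pm_tr M s t \<in> lin_maps K (pm_ob M s) (pm_ob M t)"
  by (rule persistence_module.tr_linear)

lemma pm_homs_lin: "\<phi> \<in> pm_homs K M N \<Longrightarrow> \<phi> t \<in> lin_maps K (pm_ob M t) (pm_ob N t)"
  by (simp add: pm_homs_def)

lemma pm_homs_natural:
  "\<phi> \<in> pm_homs K M N \<Longrightarrow> s \<le> t \<Longrightarrow> x \<in> carrier (pm_ob M s) \<Longrightarrow>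
    \<phi> t (pm_tr M s t x) = pm_tr N s t (\<phi> s x)"
  by (simp add: pm_homs_def)

lemma bilinear_map_comp:
  assumes "bilinear_map K V W Z \<beta>" "f \<in> lin_maps K Z Z'"
  shows "bilinear_map K V W Z' (\<lambda>v w. f (\<beta> v w))"
  unfolding bilinear_map_def
proof (intro conjI ballI)
  show "(\<lambda>v. f (\<beta> v w)) \<in> lin_maps K V Z'" if "w \<in> carrier W" for w
    using assms(1) that by (intro lin_maps_comp[OF _ assms(2)]) (simp add: bilinear_map_def)
  show "(\<lambda>w. f (\<beta> v w)) \<in> lin_maps K W Z'" if "v \<in> carrier V" for v
    using assms(1) that by (intro lin_maps_comp[OF _ assms(2)]) (simp add: bilinear_map_def)
qed

lemma bilinear_mapD:
  assumes "bilinear_map K V W Z \<beta>"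
  shows "w \<in> carrier W \<Longrightarrow> (\<lambda>v. \<beta> v w) \<in> lin_maps K V Z" "v \<in> carrier V \<Longrightarrow> \<beta> v \<in> lin_maps K W Z"
  using assms by (auto simp: bilinear_map_def)

context
  fixes K :: "('k, 'm) ring_scheme" and M :: "('k, 'a) persmod" and N :: "('k, 'b) persmod"
  assumes M: "persistence_module K M" and N: "persistence_module K N"
begin

lemma tensor_diag_module: "module K (tensor_diag K M N i)"
  by (cases i) (simp add: tensor_diag_def tensor_module pm_module[OF M] pm_module[OF N])

lemma tensor_trans_lin:
  "tensor_le i j \<Longrightarrow> tensor_trans K M N i j \<in> lin_maps K (tensor_diag K M N i) (tensor_diag K M N j)"
  by (cases i; cases j)
    (auto simp: tensor_le_def tensor_trans_def tensor_diag_def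
      intro!: tensor_map_lin pm_module[OF M] pm_module[OF N] pm_tr_lin[OF M] pm_tr_lin[OF N])

lemma pm_tensor_sum_module: "module K (pm_tensor_sum K M N s)"
  unfolding pm_tensor_sum_def by (rule dsum_module[OF pm_cring[OF M] tensor_diag_module])

lemma pm_tensor_null_subspace: "submodule (pm_tensor_null K M N s) K (pm_tensor_sum K M N s)"
  unfolding pm_tensor_sum_def pm_tensor_null_def
  by (intro colim_null_subspace pm_cring[OF M] tensor_diag_module tensor_trans_lin)

lemma pm_tensor_ob:
  "pm_ob (pm_tensor K M N) s = quot_space (pm_tensor_sum K M N s) (pm_tensor_null K M N s)"
  by (simp add: pm_tensor_def colim_space_def pm_tensor_sum_def pm_tensor_null_def)

lemma pm_tensor_module: "module K (pm_ob (pm_tensor K M N) s)"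
  unfolding pm_tensor_ob by (rule quot_module[OF pm_tensor_sum_module pm_tensor_null_subspace])

lemma ptens_lin:
  assumes "s1 + s2 \<le> s"
  shows "(\<lambda>x. pm_tensor_null K M N s +>\<^bsub>pm_tensor_sum K M N s\<^esub>
      dsum_inj (tensor_diag K M N) (s1, s2) x)
    \<in> lin_maps K (tensor_space K (pm_ob M s1) (pm_ob N s2)) (pm_ob (pm_tensor K M N) s)"
proof -
  have "(s1, s2) \<in> tensor_index s" using assms by (simp add: tensor_index_def)
  from dsum_inj_lin[of "tensor_index s" K "tensor_diag K M N", OF tensor_diag_module this]
  have 1: "dsum_inj (tensor_diag K M N) (s1, s2)
    \<in> lin_maps K (tensor_space K (pm_ob M s1) (pm_ob N s2)) (pm_tensor_sum K M N s)"
    by (simp add: pm_tensor_sum_def tensor_diag_def)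
  have 2: "(\<lambda>x. pm_tensor_null K M N s +>\<^bsub>pm_tensor_sum K M N s\<^esub> x)
    \<in> lin_maps K (pm_tensor_sum K M N s) (pm_ob (pm_tensor K M N) s)"
    unfolding pm_tensor_ob by (rule quot_proj[OF pm_tensor_sum_module pm_tensor_null_subspace])
  show ?thesis by (rule lin_maps_comp[OF 1 2])
qed

lemma ptens_bilinear:
  assumes "s1 + s2 \<le> s"
  shows "bilinear_map K (pm_ob M s1) (pm_ob N s2) (pm_ob (pm_tensor K M N) s) (ptens K M N s s1 s2)"
  unfolding ptens_def
  by (intro bilinear_map_comp[OF tens_bilinear ptens_lin] pm_module[OF M] pm_module[OF N] assms)

lemma ptens_closed:
  "s1 + s2 \<le> s \<Longrightarrow> v \<in> carrier (pm_ob M s1) \<Longrightarrow> w \<in> carrier (pm_ob N s2) \<Longrightarrow>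
    ptens K M N s s1 s2 v w \<in> carrier (pm_ob (pm_tensor K M N) s)"
  using bilinear_mapD(2)[OF ptens_bilinear] by (rule lin_maps_closed)

text \<open>The two injected tensors differ by one of the relations that define the colimit. By this
  rule a shift in time is traded between the two factors.\<close>

lemma ptens_trans:
  assumes "s1 \<le> t1" "s2 \<le> t2" "t1 + t2 \<le> s" "v \<in> carrier (pm_ob M s1)" "w \<in> carrier (pm_ob N s2)"
  shows "ptens K M N s t1 t2 (pm_tr M s1 t1 v) (pm_tr N s2 t2 w) = ptens K M N s s1 s2 v w"
proof -
  note mods = pm_module[OF M] pm_module[OF N]
  let ?D = "tensor_diag K M N" and ?x = "tens K (pm_ob M s1) (pm_ob N s2) v w"
  have idx: "(s1, s2) \<in> tensor_index s" "(t1, t2) \<in> tensor_index s" "tensor_le (s1, s2) (t1, t2)"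
    using assms by (auto simp: tensor_index_def tensor_le_def)
  have x: "?x \<in> carrier (?D (s1, s2))"
    using assms tens_closed[OF mods] by (simp add: tensor_diag_def)
  note inj = lin_maps_closed[OF dsum_inj_lin[of "tensor_index s" K ?D, OF tensor_diag_module]]
  have "tens K (pm_ob M t1) (pm_ob N t2) (pm_tr M s1 t1 v) (pm_tr N s2 t2 w)
      = tensor_trans K M N (s1, s2) (t1, t2) ?x"
    using tensor_map_tens[OF mods mods pm_tr_lin[OF M assms(1)] pm_tr_lin[OF N assms(2)] assms(4,5)]
    by (simp add: tensor_trans_def)
  moreover have "dsum_inj ?D (t1, t2) (tensor_trans K M N (s1, s2) (t1, t2) ?x)
      \<ominus>\<^bsub>pm_tensor_sum K M N s\<^esub> dsum_inj ?D (s1, s2) ?x \<in> pm_tensor_null K M N s"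
    unfolding pm_tensor_sum_def pm_tensor_null_def by (rule colim_null_rel[where V = ?D and r = tensor_le, OF idx x])
  moreover have "dsum_inj ?D (t1, t2) (tensor_trans K M N (s1, s2) (t1, t2) ?x)
      \<in> carrier (pm_tensor_sum K M N s)" "dsum_inj ?D (s1, s2) ?x \<in> carrier (pm_tensor_sum K M N s)"
    unfolding pm_tensor_sum_def
    using inj idx x lin_maps_closed[OF tensor_trans_lin] by auto
  ultimately show ?thesis
    unfolding ptens_def by (simp add: coset_eq_iff[OF pm_tensor_sum_module pm_tensor_null_subspace])
qed

text \<open>Two nested inductions: over the summands of the direct sum and, within a summand, over
  pure tensors.\<close>

lemma pm_tensor_induct:
  assumes H: "submodule H K (pm_ob (pm_tensor K M N) s)"
    and pt: "\<And>s1 s2 v w. s1 + s2 \<le> s \<Longrightarrow> v \<in> carrier (pm_ob M s1) \<Longrightarrow> w \<in> carrier (pm_ob N s2)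
      \<Longrightarrow> ptens K M N s s1 s2 v w \<in> H"
    and x: "x \<in> carrier (pm_ob (pm_tensor K M N) s)"
  shows "x \<in> H"
proof -
  note mods = pm_module[OF M] pm_module[OF N]
  let ?D = "tensor_diag K M N" and ?S = "pm_tensor_sum K M N s"
  let ?p = "\<lambda>h. pm_tensor_null K M N s +>\<^bsub>?S\<^esub> h"
  have p: "?p \<in> lin_maps K ?S (pm_ob (pm_tensor K M N) s)"
    unfolding pm_tensor_ob by (rule quot_proj[OF pm_tensor_sum_module pm_tensor_null_subspace])
  have sub: "submodule {h \<in> carrier ?S. ?p h \<in> H} K (dsum_space (tensor_index s) ?D)"
    using subspace_vimage[OF pm_tensor_sum_module pm_tensor_module p H]
    by (simp add: pm_tensor_sum_def)
  obtain h where h: "h \<in> carrier (dsum_space (tensor_index s) ?D)" "x = ?p h"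
    using x unfolding pm_tensor_ob quot_carrier pm_tensor_sum_def by blast
  have "h \<in> {h \<in> carrier ?S. ?p h \<in> H}"
  proof (rule dsum_induct[OF tensor_diag_module pm_cring[OF M] sub _ h(1)])
    fix i y assume i: "i \<in> tensor_index s" and y: "y \<in> carrier (?D i)"
    obtain s1 s2 where s: "i = (s1, s2)" "s1 + s2 \<le> s"
      using i by (cases i) (auto simp: tensor_index_def)
    have "y \<in> {y \<in> carrier (tensor_space K (pm_ob M s1) (pm_ob N s2)). ?p (dsum_inj ?D (s1, s2) y) \<in> H}"
    proof (rule tensor_induct[OF mods
          subspace_vimage[OF tensor_module[OF mods] pm_tensor_module ptens_lin[OF s(2)] H]])
      show "y \<in> carrier (tensor_space K (pm_ob M s1) (pm_ob N s2))"
        using y by (simp add: s tensor_diag_def)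
    qed (use pt[OF s(2)] tens_closed[OF mods] in \<open>auto simp: ptens_def\<close>)
    then show "dsum_inj ?D i y \<in> {h \<in> carrier ?S. ?p h \<in> H}"
      using lin_maps_closed[OF dsum_inj_lin[of _ K ?D, OF tensor_diag_module i] y]
      by (simp add: s pm_tensor_sum_def)
  qed
  then show ?thesis using h by simp
qed

text \<open>The universal property: a family of bilinear maps compatible with the transition maps
  factors through the colimit. This is what produces linear maps out of
  \<open>(M \<otimes> N)(s)\<close>.\<close>

lemma pm_tensor_ext:
  assumes Z: "module K Z"
    and \<beta>: "\<And>s1 s2. s1 + s2 \<le> s \<Longrightarrow> bilinear_map K (pm_ob M s1) (pm_ob N s2) Z (\<beta> s1 s2)"
    and comp: "\<And>s1 s2 t1 t2 v w. s1 \<le> t1 \<Longrightarrow> s2 \<le> t2 \<Longrightarrow> t1 + t2 \<le> s \<Longrightarrow>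
      v \<in> carrier (pm_ob M s1) \<Longrightarrow> w \<in> carrier (pm_ob N s2) \<Longrightarrow>
      \<beta> t1 t2 (pm_tr M s1 t1 v) (pm_tr N s2 t2 w) = \<beta> s1 s2 v w"
  obtains f where "f \<in> lin_maps K (pm_ob (pm_tensor K M N) s) Z"
    and "\<And>s1 s2 v w. s1 + s2 \<le> s \<Longrightarrow> v \<in> carrier (pm_ob M s1) \<Longrightarrow> w \<in> carrier (pm_ob N s2) \<Longrightarrow>
      f (ptens K M N s s1 s2 v w) = \<beta> s1 s2 v w"
proof -
  note mods = pm_module[OF M] pm_module[OF N]
  interpret Z: module K Z by fact
  let ?D = "tensor_diag K M N" and ?S = "pm_tensor_sum K M N s"
  have "\<forall>i\<in>tensor_index s. \<exists>g. g \<in> lin_maps K (?D i) Z \<and>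
    (\<forall>v\<in>carrier (pm_ob M (fst i)). \<forall>w\<in>carrier (pm_ob N (snd i)).
      g (tens K (pm_ob M (fst i)) (pm_ob N (snd i)) v w) = \<beta> (fst i) (snd i) v w)"
  proof
    fix i assume "i \<in> tensor_index s"
    then have "fst i + snd i \<le> s" by (auto simp: tensor_index_def)
    from tensor_ext[OF mods Z \<beta>[OF this]]
    show "\<exists>g. g \<in> lin_maps K (?D i) Z \<and>
      (\<forall>v\<in>carrier (pm_ob M (fst i)). \<forall>w\<in>carrier (pm_ob N (snd i)).
        g (tens K (pm_ob M (fst i)) (pm_ob N (snd i)) v w) = \<beta> (fst i) (snd i) v w)"
      by (simp add: tensor_diag_def case_prod_beta) metis
  qed
  from bchoice[OF this] obtain g where g: "\<And>i. i \<in> tensor_index s \<Longrightarrow> g i \<in> lin_maps K (?D i) Z"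
    and gt: "\<And>s1 s2 v w. s1 + s2 \<le> s \<Longrightarrow> v \<in> carrier (pm_ob M s1) \<Longrightarrow> w \<in> carrier (pm_ob N s2) \<Longrightarrow>
      g (s1, s2) (tens K (pm_ob M s1) (pm_ob N s2) v w) = \<beta> s1 s2 v w"
    by (fastforce simp: tensor_index_def)
  obtain f where f: "f \<in> lin_maps K ?S Z"
    and fi: "\<And>i x. i \<in> tensor_index s \<Longrightarrow> x \<in> carrier (?D i) \<Longrightarrow> f (dsum_inj ?D i x) = g i x"
    unfolding pm_tensor_sum_def
    by (rule dsum_ext[of "tensor_index s" K ?D, OF tensor_diag_module Z g]) auto
  note inj = lin_maps_closed[OF dsum_inj_lin[of "tensor_index s" K ?D, OF tensor_diag_module],
      folded pm_tensor_sum_def]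
  have null: "f x = \<zero>\<^bsub>Z\<^esub>" if "x \<in> pm_tensor_null K M N s" for x
  proof -
    have "pm_tensor_null K M N s \<subseteq> {x \<in> carrier ?S. f x \<in> {\<zero>\<^bsub>Z\<^esub>}}"
      unfolding pm_tensor_null_def
    proof (rule colim_null_least, unfold pm_tensor_sum_def[symmetric])
      show "submodule {x \<in> carrier ?S. f x \<in> {\<zero>\<^bsub>Z\<^esub>}} K ?S"
        by (intro subspace_vimage[OF pm_tensor_sum_module Z f] subspaceI[OF Z]) auto
      fix i j x
      assume i: "i \<in> tensor_index s" and j: "j \<in> tensor_index s" and le: "tensor_le i j"
        and x: "x \<in> carrier (?D i)"
      obtain s1 s2 t1 t2 where ij: "i = (s1, s2)" "j = (t1, t2)" by (cases i; cases j)
      have st: "s1 \<le> t1" "s2 \<le> t2" "t1 + t2 \<le> s" "s1 + s2 \<le> s"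
        using i j le by (auto simp: ij tensor_le_def tensor_index_def)
      note U = tensor_trans_lin[OF le]
      \<comment> \<open>Compatibility is given on pure tensors; linearity extends it to the whole
        summand.\<close>
      have "g j (tensor_trans K M N i j x) = g i x"
      proof (rule tensor_lin_eq[OF mods Z])
        show "x \<in> carrier (tensor_space K (pm_ob M s1) (pm_ob N s2))"
          using x by (simp add: ij tensor_diag_def)
        show "(\<lambda>x. g j (tensor_trans K M N i j x))
            \<in> lin_maps K (tensor_space K (pm_ob M s1) (pm_ob N s2)) Z"
          using lin_maps_comp[OF U g[OF j]] by (simp add: ij tensor_diag_def)
        show "g i \<in> lin_maps K (tensor_space K (pm_ob M s1) (pm_ob N s2)) Z"
          using g[OF i] by (simp add: ij tensor_diag_def)
        fix v w assume vw: "v \<in> carrier (pm_ob M s1)" "w \<in> carrier (pm_ob N s2)"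
        have "tensor_trans K M N i j (tens K (pm_ob M s1) (pm_ob N s2) v w)
          = tens K (pm_ob M t1) (pm_ob N t2) (pm_tr M s1 t1 v) (pm_tr N s2 t2 w)"
          using tensor_map_tens[OF mods mods pm_tr_lin[OF M st(1)] pm_tr_lin[OF N st(2)] vw]
          by (simp add: tensor_trans_def ij)
        then show "g j (tensor_trans K M N i j (tens K (pm_ob M s1) (pm_ob N s2) v w))
          = g i (tens K (pm_ob M s1) (pm_ob N s2) v w)"
          using gt[OF st(3), of "pm_tr M s1 t1 v" "pm_tr N s2 t2 w"] gt[OF st(4) vw] comp[OF st(1-3) vw]
            lin_maps_closed[OF pm_tr_lin[OF M st(1)]] lin_maps_closed[OF pm_tr_lin[OF N st(2)]] vw
          by (simp add: ij)
      qed
      moreover note Ux = lin_maps_closed[OF U x]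
      ultimately show "dsum_inj ?D j (tensor_trans K M N i j x) \<ominus>\<^bsub>?S\<^esub> dsum_inj ?D i x
          \<in> {x \<in> carrier ?S. f x \<in> {\<zero>\<^bsub>Z\<^esub>}}"
        using inj[OF i x] inj[OF j Ux] fi[OF i x] fi[OF j Ux] lin_maps_closed[OF g[OF i] x]
          abelian_group.minus_closed[OF module.axioms(2)[OF pm_tensor_sum_module]]
        by (simp add: lin_maps_minus[OF pm_tensor_sum_module Z f] Z.M.r_neg a_minus_def[of Z])
    qed
    then show ?thesis using that by auto
  qed
  obtain h where h: "h \<in> lin_maps K (pm_ob (pm_tensor K M N) s) Z"
    "\<And>x. x \<in> carrier ?S \<Longrightarrow> h (pm_tensor_null K M N s +>\<^bsub>?S\<^esub> x) = f x"
    using quot_lift[OF pm_tensor_sum_module Z pm_tensor_null_subspace f null]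
    unfolding pm_tensor_ob by blast
  show ?thesis
  proof (rule that[OF h(1)])
    fix s1 s2 v w
    assume s: "s1 + s2 \<le> s" and vw: "v \<in> carrier (pm_ob M s1)" "w \<in> carrier (pm_ob N s2)"
    then have i: "(s1, s2) \<in> tensor_index s" by (simp add: tensor_index_def)
    have x: "tens K (pm_ob M s1) (pm_ob N s2) v w \<in> carrier (?D (s1, s2))"
      using tens_closed[OF mods vw] by (simp add: tensor_diag_def)
    show "h (ptens K M N s s1 s2 v w) = \<beta> s1 s2 v w"
      unfolding ptens_def using h(2)[OF inj[OF i x]] fi[OF i x] gt[OF s vw] by simp
  qed
qed

text \<open>A relation at \<open>s\<close> is also a relation at \<open>t\<close>: the inclusion of
  direct sums is linear and the identity on functions, so the differences formed in the two sums
  coincide.\<close>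

lemma pm_tensor_tr:
  assumes "s \<le> t"
  shows pm_tensor_tr_lin:
      "pm_tr (pm_tensor K M N) s t \<in> lin_maps K (pm_ob (pm_tensor K M N) s) (pm_ob (pm_tensor K M N) t)"
    and pm_tensor_tr_ptens: "s1 + s2 \<le> s \<Longrightarrow> v \<in> carrier (pm_ob M s1) \<Longrightarrow> w \<in> carrier (pm_ob N s2) \<Longrightarrow>
      pm_tr (pm_tensor K M N) s t (ptens K M N s s1 s2 v w) = ptens K M N t s1 s2 v w"
proof -
  note mods = pm_module[OF M] pm_module[OF N]
  let ?D = "tensor_diag K M N" and ?S = "pm_tensor_sum K M N"
  have I: "tensor_index s \<subseteq> tensor_index t" using assms by (auto simp: tensor_index_def)
  have id: "(\<lambda>h. h) \<in> lin_maps K (?S s) (?S t)"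
    unfolding pm_tensor_sum_def by (rule dsum_incl_lin[OF tensor_diag_module I])
  note inj = lin_maps_closed[OF dsum_inj_lin[of "tensor_index s" K ?D, OF tensor_diag_module],
      folded pm_tensor_sum_def]
  have "pm_tensor_null K M N s \<subseteq> {h \<in> carrier (?S s). h \<in> pm_tensor_null K M N t}"
    unfolding pm_tensor_null_def[of _ _ _ s]
  proof (rule colim_null_least, unfold pm_tensor_sum_def[symmetric])
    show "submodule {h \<in> carrier (?S s). h \<in> pm_tensor_null K M N t} K (?S s)"
      by (rule subspace_vimage[OF pm_tensor_sum_module pm_tensor_sum_module id pm_tensor_null_subspace])
    fix i j x
    assume i: "i \<in> tensor_index s" and j: "j \<in> tensor_index s" and le: "tensor_le i j"
      and x: "x \<in> carrier (?D i)"
    note Ux = lin_maps_closed[OF tensor_trans_lin[OF le] x]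
    have i': "i \<in> tensor_index t" "j \<in> tensor_index t" using i j I by auto
    have "dsum_inj ?D j (tensor_trans K M N i j x) \<ominus>\<^bsub>?S s\<^esub> dsum_inj ?D i x \<in> carrier (?S s)"
      by (rule abelian_group.minus_closed[OF module.axioms(2)[OF pm_tensor_sum_module]
            inj[OF j Ux] inj[OF i x]])
    moreover have "dsum_inj ?D j (tensor_trans K M N i j x) \<ominus>\<^bsub>?S s\<^esub> dsum_inj ?D i x
        \<in> pm_tensor_null K M N t"
      unfolding lin_maps_minus[OF pm_tensor_sum_module pm_tensor_sum_module id inj[OF j Ux] inj[OF i x]]
      unfolding pm_tensor_null_def pm_tensor_sum_def by (rule colim_null_rel[where V = ?D and r = tensor_le, OF i' le x])
    ultimately show "dsum_inj ?D j (tensor_trans K M N i j x) \<ominus>\<^bsub>?S s\<^esub> dsum_inj ?D i x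
          \<in> {h \<in> carrier (?S s). h \<in> pm_tensor_null K M N t}"
      by blast
  qed
  then have sub: "(\<lambda>h. h) ` pm_tensor_null K M N s \<subseteq> pm_tensor_null K M N t" by auto
  note qm = pm_tensor_sum_module pm_tensor_sum_module pm_tensor_null_subspace
    pm_tensor_null_subspace id sub
  have tr: "pm_tr (pm_tensor K M N) s t = quot_map (?S t) (pm_tensor_null K M N t) (\<lambda>h. h)"
    by (simp add: pm_tensor_def)
  show "pm_tr (pm_tensor K M N) s t \<in> lin_maps K (pm_ob (pm_tensor K M N) s) (pm_ob (pm_tensor K M N) t)"
    unfolding pm_tensor_ob tr by (rule quot_map_lin[OF qm])
  show "pm_tr (pm_tensor K M N) s t (ptens K M N s s1 s2 v w) = ptens K M N t s1 s2 v w"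
    if s: "s1 + s2 \<le> s" and vw: "v \<in> carrier (pm_ob M s1)" "w \<in> carrier (pm_ob N s2)"
  proof -
    have i: "(s1, s2) \<in> tensor_index s" using s by (simp add: tensor_index_def)
    have x: "tens K (pm_ob M s1) (pm_ob N s2) v w \<in> carrier (?D (s1, s2))"
      using tens_closed[OF mods vw] by (simp add: tensor_diag_def)
    show ?thesis
      unfolding ptens_def tr by (rule quot_map_coset[OF qm inj[OF i x]])
  qed
qed

end

text \<open>Naturality of \<open>\<phi>\<close> makes the maps on summands commute with the
  transition maps of the diagram, so colimit relations go to colimit relations.\<close>

lemma pm_tensor_map_facts:
  fixes K :: "('k, 'm) ring_scheme" and M :: "('k, 'a) persmod" and M' :: "('k, 'c) persmod"
    and N :: "('k, 'b) persmod"
  assumes M: "persistence_module K M" and M': "persistence_module K M'" and N: "persistence_module K N"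
    and \<phi>: "\<phi> \<in> pm_homs K M M'"
  shows pm_tensor_map_lin:
      "pm_tensor_map K M' N \<phi> s \<in> lin_maps K (pm_ob (pm_tensor K M N) s) (pm_ob (pm_tensor K M' N) s)"
    and pm_tensor_map_ptens: "s1 + s2 \<le> s \<Longrightarrow> v \<in> carrier (pm_ob M s1) \<Longrightarrow> w \<in> carrier (pm_ob N s2) \<Longrightarrow>
      pm_tensor_map K M' N \<phi> s (ptens K M N s s1 s2 v w) = ptens K M' N s s1 s2 (\<phi> s1 v) w"
proof -
  note mods = pm_module[OF M] pm_module[OF N] and mods' = pm_module[OF M'] pm_module[OF N]
  let ?D = "tensor_diag K M N" and ?S = "pm_tensor_sum K M N s"
  let ?D' = "tensor_diag K M' N" and ?S' = "pm_tensor_sum K M' N s"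
  let ?\<phi> = "\<lambda>(s1, s2). tensor_map K (pm_ob M' s1) (pm_ob N s2) (\<phi> s1) (\<lambda>y. y)"
  let ?f = "dsum_map (tensor_index s) ?D' ?\<phi>"
  note D = tensor_diag_module[OF M N] and D' = tensor_diag_module[OF M' N]
  note S = pm_tensor_sum_module[OF M N] and S' = pm_tensor_sum_module[OF M' N]
  have \<phi>i: "?\<phi> i \<in> lin_maps K (?D i) (?D' i)" for i
    by (cases i) (simp add: tensor_diag_def tensor_map_lin[OF mods mods' pm_homs_lin[OF \<phi>] lin_maps_id])
  have f: "?f \<in> lin_maps K ?S ?S'"
    unfolding pm_tensor_sum_def by (rule dsum_map_lin[OF D D' \<phi>i])
  have finj: "?f (dsum_inj ?D i x) = dsum_inj ?D' i (?\<phi> i x)" if "i \<in> tensor_index s" for i x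
    using that lin_maps_zero[OF D D' \<phi>i] by (intro dsum_map_inj) auto
  note inj = lin_maps_closed[OF dsum_inj_lin[of "tensor_index s" K ?D, OF D], folded pm_tensor_sum_def]
  have "pm_tensor_null K M N s \<subseteq> {h \<in> carrier ?S. ?f h \<in> pm_tensor_null K M' N s}"
    unfolding pm_tensor_null_def[of K M]
  proof (rule colim_null_least, unfold pm_tensor_sum_def[symmetric])
    show "submodule {h \<in> carrier ?S. ?f h \<in> pm_tensor_null K M' N s} K ?S"
      by (rule subspace_vimage[OF S S' f pm_tensor_null_subspace[OF M' N]])
    fix i j x
    assume i: "i \<in> tensor_index s" and j: "j \<in> tensor_index s" and le: "tensor_le i j"
      and x: "x \<in> carrier (?D i)"
    obtain s1 s2 t1 t2 where ij: "i = (s1, s2)" "j = (t1, t2)" by (cases i; cases j)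
    have st: "s1 \<le> t1" "s2 \<le> t2"
      using le by (auto simp: ij tensor_le_def)
    note U = tensor_trans_lin[OF M N le] and U' = tensor_trans_lin[OF M' N le]
    note Ux = lin_maps_closed[OF U x]
    have eq: "?\<phi> j (tensor_trans K M N i j x) = tensor_trans K M' N i j (?\<phi> i x)"
    proof (rule tensor_lin_eq[OF mods D'])
      show "x \<in> carrier (tensor_space K (pm_ob M s1) (pm_ob N s2))"
        using x by (simp add: ij tensor_diag_def)
      show "(\<lambda>x. ?\<phi> j (tensor_trans K M N i j x))
          \<in> lin_maps K (tensor_space K (pm_ob M s1) (pm_ob N s2)) (?D' j)"
        using lin_maps_comp[OF U \<phi>i[of j]] by (simp add: ij tensor_diag_def)
      show "(\<lambda>x. tensor_trans K M' N i j (?\<phi> i x))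
          \<in> lin_maps K (tensor_space K (pm_ob M s1) (pm_ob N s2)) (?D' j)"
        using lin_maps_comp[OF \<phi>i[of i] U'] by (simp add: ij tensor_diag_def)
      fix v w assume vw: "v \<in> carrier (pm_ob M s1)" "w \<in> carrier (pm_ob N s2)"
      have vw': "pm_tr M s1 t1 v \<in> carrier (pm_ob M t1)" "pm_tr N s2 t2 w \<in> carrier (pm_ob N t2)"
        "\<phi> s1 v \<in> carrier (pm_ob M' s1)"
        using lin_maps_closed[OF pm_tr_lin[OF M st(1)] vw(1)]
          lin_maps_closed[OF pm_tr_lin[OF N st(2)] vw(2)] lin_maps_closed[OF pm_homs_lin[OF \<phi>] vw(1)]
        by auto
      show "?\<phi> j (tensor_trans K M N i j (tens K (pm_ob M s1) (pm_ob N s2) v w))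
          = tensor_trans K M' N i j (?\<phi> i (tens K (pm_ob M s1) (pm_ob N s2) v w))"
        using tensor_map_tens[OF mods mods pm_tr_lin[OF M st(1)] pm_tr_lin[OF N st(2)] vw]
          tensor_map_tens[OF mods mods' pm_homs_lin[OF \<phi>] lin_maps_id vw]
          tensor_map_tens[OF mods mods' pm_homs_lin[OF \<phi>] lin_maps_id vw'(1,2)]
          tensor_map_tens[OF mods' mods' pm_tr_lin[OF M' st(1)] pm_tr_lin[OF N st(2)] vw'(3) vw(2)]
          pm_homs_natural[OF \<phi> st(1) vw(1)]
        by (simp add: tensor_trans_def ij)
    qed
    have "dsum_inj ?D j (tensor_trans K M N i j x) \<ominus>\<^bsub>?S\<^esub> dsum_inj ?D i x \<in> carrier ?S"
      by (rule abelian_group.minus_closed[OF module.axioms(2)[OF S] inj[OF j Ux] inj[OF i x]])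
    moreover have "?f (dsum_inj ?D j (tensor_trans K M N i j x) \<ominus>\<^bsub>?S\<^esub> dsum_inj ?D i x)
        \<in> pm_tensor_null K M' N s"
      unfolding lin_maps_minus[OF S S' f inj[OF j Ux] inj[OF i x]] finj[OF i] finj[OF j] eq
      unfolding pm_tensor_null_def pm_tensor_sum_def
      by (rule colim_null_rel[where V = ?D' and r = tensor_le, OF i j le lin_maps_closed[OF \<phi>i x]])
    ultimately show "dsum_inj ?D j (tensor_trans K M N i j x) \<ominus>\<^bsub>?S\<^esub> dsum_inj ?D i x
          \<in> {h \<in> carrier ?S. ?f h \<in> pm_tensor_null K M' N s}"
      by blast
  qed
  then have sub: "?f ` pm_tensor_null K M N s \<subseteq> pm_tensor_null K M' N s" by auto
  note qm = S S' pm_tensor_null_subspace[OF M N] pm_tensor_null_subspace[OF M' N] f sub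
  show "pm_tensor_map K M' N \<phi> s \<in> lin_maps K (pm_ob (pm_tensor K M N) s) (pm_ob (pm_tensor K M' N) s)"
    unfolding pm_tensor_ob[OF M N] pm_tensor_ob[OF M' N] pm_tensor_map_def by (rule quot_map_lin[OF qm])
  show "pm_tensor_map K M' N \<phi> s (ptens K M N s s1 s2 v w) = ptens K M' N s s1 s2 (\<phi> s1 v) w"
    if s: "s1 + s2 \<le> s" and vw: "v \<in> carrier (pm_ob M s1)" "w \<in> carrier (pm_ob N s2)"
  proof -
    have i: "(s1, s2) \<in> tensor_index s" using s by (simp add: tensor_index_def)
    have x: "tens K (pm_ob M s1) (pm_ob N s2) v w \<in> carrier (?D (s1, s2))"
      using tens_closed[OF mods vw] by (simp add: tensor_diag_def)
    show ?thesis
      unfolding ptens_def pm_tensor_map_def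
      using quot_map_coset[OF qm inj[OF i x]] finj[OF i]
        tensor_map_tens[OF mods mods' pm_homs_lin[OF \<phi>] lin_maps_id vw]
      by simp
  qed
qed


section \<open>Invariance of persistent magnitude\<close>

lemma field_inverse_ex:
  assumes "field K" "x \<in> carrier K" "x \<noteq> \<zero>\<^bsub>K\<^esub>"
  obtains y where "y \<in> carrier K" "y \<otimes>\<^bsub>K\<^esub> x = \<one>\<^bsub>K\<^esub>"
proof -
  interpret K: field K by fact
  have "x \<in> Units K" using assms by (simp add: K.field_Units)
  then show ?thesis using that K.Units_inv_closed K.Units_l_inv by blast
qed

text \<open>The space of coordinate vectors indexed by \<open>A\<close>, realised by functions on
  the whole index type that vanish outside \<open>A\<close>. Thus a smaller index set gives a
  literal subset, and all spaces of a filtration share one type.\<close>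

definition coord_space :: "('k, 'm) ring_scheme \<Rightarrow> 'i set \<Rightarrow> ('i \<Rightarrow> 'k) set" where
  "coord_space K A = {h. (\<forall>i. h i \<in> carrier K) \<and> (\<forall>i. i \<notin> A \<longrightarrow> h i = \<zero>\<^bsub>K\<^esub>)}"

text \<open>Gaussian elimination, by induction on \<open>B\<close>. If the coordinate
  \<open>b\<close> of the image vanishes throughout, it is dropped; otherwise one coordinate
  \<open>a\<close> of the source is eliminated against a vector \<open>h0\<close> whose image is
  nonzero at \<open>b\<close>.\<close>

lemma coord_dim_le:
  fixes f :: "('i \<Rightarrow> 'k) \<Rightarrow> ('j \<Rightarrow> 'k)"
  assumes K: "field K" and "finite B" "finite A"
    and "\<And>h. h \<in> coord_space K A \<Longrightarrow> f h \<in> coord_space K B"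
    and "\<And>h h'. h \<in> coord_space K A \<Longrightarrow> h' \<in> coord_space K A \<Longrightarrow>
      f (\<lambda>i. h i \<oplus>\<^bsub>K\<^esub> h' i) = (\<lambda>j. f h j \<oplus>\<^bsub>K\<^esub> f h' j)"
    and "\<And>c h. c \<in> carrier K \<Longrightarrow> h \<in> coord_space K A \<Longrightarrow>
      f (\<lambda>i. c \<otimes>\<^bsub>K\<^esub> h i) = (\<lambda>j. c \<otimes>\<^bsub>K\<^esub> f h j)"
    and "\<And>h. h \<in> coord_space K A \<Longrightarrow> f h = (\<lambda>_. \<zero>\<^bsub>K\<^esub>) \<Longrightarrow> h = (\<lambda>_. \<zero>\<^bsub>K\<^esub>)"
  shows "card A \<le> card B"
proof -
  interpret K: field K by fact
  \<comment> \<open>Stated for local \<open>A\<close>, \<open>B\<close> and \<open>f\<close>,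
    because the induction below generalises over them.\<close>
  have f0: "f (\<lambda>_. \<zero>\<^bsub>K\<^esub>) = (\<lambda>_. \<zero>\<^bsub>K\<^esub>)"
    if "\<And>h. h \<in> coord_space K A \<Longrightarrow> f h \<in> coord_space K B"
      and "\<And>c h. c \<in> carrier K \<Longrightarrow> h \<in> coord_space K A \<Longrightarrow>
        f (\<lambda>i. c \<otimes>\<^bsub>K\<^esub> h i) = (\<lambda>j. c \<otimes>\<^bsub>K\<^esub> f h j)"
    for A :: "'i set" and B :: "'j set" and f :: "('i \<Rightarrow> 'k) \<Rightarrow> ('j \<Rightarrow> 'k)"
  proof -
    have z: "(\<lambda>_. \<zero>\<^bsub>K\<^esub>) \<in> coord_space K A" by (simp add: coord_space_def)
    show ?thesis
      using that(2)[OF K.zero_closed z] that(1)[OF z] by (simp add: coord_space_def)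
  qed
  show ?thesis
    using assms(2-)
  proof (induction B arbitrary: A f rule: finite_induct)
    case empty
    have "A = {}"
    proof (rule ccontr)
      assume "A \<noteq> {}"
      then obtain a where a: "a \<in> A" by auto
      define e where "e i = (if i = a then \<one>\<^bsub>K\<^esub> else \<zero>\<^bsub>K\<^esub>)" for i
      have e: "e \<in> coord_space K A" using a by (auto simp: coord_space_def e_def)
      then have "f e = (\<lambda>_. \<zero>\<^bsub>K\<^esub>)" using empty(2)[OF e] by (simp add: coord_space_def fun_eq_iff)
      then have "e a = \<zero>\<^bsub>K\<^esub>" using empty(5)[OF e] by simp
      then show False by (simp add: e_def)
    qed
    then show ?case by simp
  next
    case (insert b B)
    note fcl = insert(5) and fadd = insert(6) and fsm = insert(7) and finj = insert(8)
    have fK: "f h j \<in> carrier K" if "h \<in> coord_space K A" for h j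
      using fcl[OF that] by (simp add: coord_space_def)
    show ?case
    proof (cases "\<forall>h\<in>coord_space K A. f h b = \<zero>\<^bsub>K\<^esub>")
      case True
      have "card A \<le> card B"
      proof (rule insert.IH[OF insert(4) _ fadd fsm finj])
        show "f h \<in> coord_space K B" if "h \<in> coord_space K A" for h
          using fcl[OF that] True that by (auto simp: coord_space_def)
      qed
      then show ?thesis using insert(1,2) by simp
    next
      case False
      then obtain h0 where h0: "h0 \<in> coord_space K A" "f h0 b \<noteq> \<zero>\<^bsub>K\<^esub>" by auto
      have "f (\<lambda>_. \<zero>\<^bsub>K\<^esub>) = (\<lambda>_. \<zero>\<^bsub>K\<^esub>)" by (rule f0[of A f "insert b B"]) (rule fcl fsm; assumption)+
      then have "h0 \<noteq> (\<lambda>_. \<zero>\<^bsub>K\<^esub>)" using h0 by auto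
      then obtain a where a: "h0 a \<noteq> \<zero>\<^bsub>K\<^esub>" by auto
      then have aA: "a \<in> A" using h0 by (auto simp: coord_space_def)
      obtain y where y: "y \<in> carrier K" "y \<otimes>\<^bsub>K\<^esub> f h0 b = \<one>\<^bsub>K\<^esub>"
        using field_inverse_ex[OF K fK[OF h0(1)] h0(2)] .
      \<comment> \<open>\<open>\<sigma> g\<close> corrects \<open>g\<close> by the multiple of
        \<open>h0\<close> that cancels the coordinate \<open>b\<close> of the image.\<close>
      define c where "c g = (\<ominus>\<^bsub>K\<^esub> y) \<otimes>\<^bsub>K\<^esub> f g b" for g
      define \<sigma> where "\<sigma> g = (\<lambda>i. g i \<oplus>\<^bsub>K\<^esub> c g \<otimes>\<^bsub>K\<^esub> h0 i)" for g
      have sub: "g \<in> coord_space K A" if "g \<in> coord_space K (A - {a})" for g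
        using that by (auto simp: coord_space_def)
      have cK: "c g \<in> carrier K" if "g \<in> coord_space K A" for g
        using y fK[OF that] by (simp add: c_def)
      have hK: "g i \<in> carrier K" if "g \<in> coord_space K A" for g i
        using that by (simp add: coord_space_def)
      have smA: "(\<lambda>i. d \<otimes>\<^bsub>K\<^esub> g i) \<in> coord_space K A" if "g \<in> coord_space K A" "d \<in> carrier K" for g d
        using that by (simp add: coord_space_def)
      have adA: "(\<lambda>i. g i \<oplus>\<^bsub>K\<^esub> g' i) \<in> coord_space K A"
        if "g \<in> coord_space K A" "g' \<in> coord_space K A" for g g'
        using that by (simp add: coord_space_def)
      have \<sigma>A: "\<sigma> g \<in> coord_space K A" if "g \<in> coord_space K A" for g
        unfolding \<sigma>_def by (rule adA[OF that smA[OF h0(1) cK[OF that]]])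
      have f\<sigma>: "f (\<sigma> g) = (\<lambda>j. f g j \<oplus>\<^bsub>K\<^esub> c g \<otimes>\<^bsub>K\<^esub> f h0 j)" if "g \<in> coord_space K A" for g
        using fadd[OF that smA[OF h0(1) cK[OF that]]] fsm[OF cK[OF that] h0(1)] by (simp add: \<sigma>_def)
      have "card (A - {a}) \<le> card B"
      proof (rule insert.IH[of _ "\<lambda>g. f (\<sigma> g)"])
        show "finite (A - {a})" using insert(4) by simp
        fix g assume "g \<in> coord_space K (A - {a})"
        then have g: "g \<in> coord_space K A" and ga: "g a = \<zero>\<^bsub>K\<^esub>"
          using sub by (auto simp: coord_space_def)
        have "f (\<sigma> g) b = f g b \<oplus>\<^bsub>K\<^esub> \<ominus>\<^bsub>K\<^esub> (f g b \<otimes>\<^bsub>K\<^esub> (y \<otimes>\<^bsub>K\<^esub> f h0 b))"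
          using y(1) fK[OF g] fK[OF h0(1)] by (simp add: f\<sigma>[OF g] c_def K.l_minus K.r_minus K.m_ac)
        also have "\<dots> = \<zero>\<^bsub>K\<^esub>" using y fK[OF g] by (simp add: K.r_neg)
        finally show "f (\<sigma> g) \<in> coord_space K B"
          using fcl[OF \<sigma>A[OF g]] by (auto simp: coord_space_def)
        show "g = (\<lambda>_. \<zero>\<^bsub>K\<^esub>)" if "f (\<sigma> g) = (\<lambda>_. \<zero>\<^bsub>K\<^esub>)"
        proof -
          have \<sigma>0: "\<sigma> g = (\<lambda>_. \<zero>\<^bsub>K\<^esub>)" using finj[OF \<sigma>A[OF g] that] .
          then have "\<sigma> g a = \<zero>\<^bsub>K\<^esub>" by simp
          \<comment> \<open>As \<open>g\<close> vanishes at \<open>a\<close>, the entry of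
            \<open>\<sigma> g\<close> there is \<open>c g\<close> times the nonzero
            \<open>h0 a\<close>. So the correction is trivial, and injectivity survives the
            elimination of \<open>a\<close>.\<close>
          then have "c g \<otimes>\<^bsub>K\<^esub> h0 a = \<zero>\<^bsub>K\<^esub>"
            using ga cK[OF g] hK[OF h0(1)] by (simp add: \<sigma>_def)
          then have "c g = \<zero>\<^bsub>K\<^esub>" using a cK[OF g] hK[OF h0(1)] K.integral by blast
          then have "\<sigma> g = g" using hK[OF h0(1)] hK[OF g] by (simp add: \<sigma>_def)
          then show ?thesis using \<sigma>0 by simp
        qed
        show "f (\<sigma> (\<lambda>i. d \<otimes>\<^bsub>K\<^esub> g i)) = (\<lambda>j. d \<otimes>\<^bsub>K\<^esub> f (\<sigma> g) j)" if d: "d \<in> carrier K" for d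
          using d y fK[OF g] fK[OF h0(1)]
          by (simp add: f\<sigma>[OF smA[OF g d]] f\<sigma>[OF g] c_def fsm[OF d g] K.r_distr K.m_ac fun_eq_iff)
        fix g' assume "g' \<in> coord_space K (A - {a})"
        then have g': "g' \<in> coord_space K A" using sub by auto
        show "f (\<sigma> (\<lambda>i. g i \<oplus>\<^bsub>K\<^esub> g' i)) = (\<lambda>j. f (\<sigma> g) j \<oplus>\<^bsub>K\<^esub> f (\<sigma> g') j)"
          using y fK[OF g] fK[OF g'] fK[OF h0(1)]
          by (simp add: f\<sigma>[OF adA[OF g g']] f\<sigma>[OF g] f\<sigma>[OF g'] c_def fadd[OF g g'] K.r_distr
              K.l_distr K.a_ac fun_eq_iff)
      qed
      moreover have "card A = Suc (card (A - {a}))"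
        using card.remove[OF insert(4) aA] by simp
      ultimately show ?thesis using insert(1,2) by simp
    qed
  qed
qed

section \<open>Sums of interval modules in coordinates\<close>

definition bars ::
  "('k, 'm) ring_scheme \<Rightarrow> 'i set \<Rightarrow> ('i \<Rightarrow> real) \<Rightarrow> ('i \<Rightarrow> ereal) \<Rightarrow> ('k, 'i \<Rightarrow> 'k) persmod"
  where "bars K I a b = pm_dsum I (\<lambda>i. interval_module K (a i) (b i))"

text \<open>The bars that contain \<open>t\<close>; their number is the dimension at time
  \<open>t\<close>.\<close>

definition alive :: "'i set \<Rightarrow> ('i \<Rightarrow> real) \<Rightarrow> ('i \<Rightarrow> ereal) \<Rightarrow> real \<Rightarrow> 'i set" where
  "alive I a b t = {i \<in> I. a i \<le> t \<and> ereal t < b i}"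

lemma interval_sum_bars: "interval_sum K n a b = bars K {..<n} a b"
  by (simp add: interval_sum_def bars_def)

lemma alive_finite: "finite I \<Longrightarrow> finite (alive I a b t)"
  by (simp add: alive_def)

context
  fixes K :: "('k, 'm) ring_scheme"
  assumes K: "field K"
begin

interpretation K: field K by (rule K)

text \<open>With \<open>I\<close> finite the support condition is automatic, which leaves a plain
  coordinate space.\<close>

lemma bars_carrier:
  assumes "finite I"
  shows "carrier (pm_ob (bars K I a b) t) = coord_space K (alive I a b t)"
proof -
  have "finite {i. h i \<noteq> \<zero>\<^bsub>K\<^esub>}" if "\<forall>i. i \<notin> I \<longrightarrow> h i = \<zero>\<^bsub>K\<^esub>" for h
    by (rule finite_subset[OF _ assms]) (use that in auto)
  then show ?thesis
    by (auto simp: bars_def pm_dsum_def dsum_space_def interval_module_def coord_space_def alive_def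
        Let_def split: if_splits) (metis K.zero_closed)+
qed

lemma bars_zero: "\<zero>\<^bsub>pm_ob (bars K I a b) t\<^esub> = (\<lambda>_. \<zero>\<^bsub>K\<^esub>)"
  by (simp add: bars_def pm_dsum_def dsum_space_def interval_module_def Let_def)

lemma bars_add:
  assumes "h \<in> coord_space K (alive I a b t)" "h' \<in> coord_space K (alive I a b t)"
  shows "h \<oplus>\<^bsub>pm_ob (bars K I a b) t\<^esub> h' = (\<lambda>i. h i \<oplus>\<^bsub>K\<^esub> h' i)"
  using assms by (auto simp: bars_def pm_dsum_def dsum_space_def interval_module_def Let_def
      coord_space_def alive_def fun_eq_iff)

lemma bars_smult:
  assumes "h \<in> coord_space K (alive I a b t)" "c \<in> carrier K"
  shows "c \<odot>\<^bsub>pm_ob (bars K I a b) t\<^esub> h = (\<lambda>i. c \<otimes>\<^bsub>K\<^esub> h i)"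
  using assms by (auto simp: bars_def pm_dsum_def dsum_space_def interval_module_def Let_def
      coord_space_def alive_def fun_eq_iff)

lemma bars_tr:
  assumes "h \<in> coord_space K (alive I a b s)"
  shows "pm_tr (bars K I a b) s t h = (\<lambda>i. if i \<in> alive I a b t then h i else \<zero>\<^bsub>K\<^esub>)"
  using assms by (auto simp: bars_def pm_dsum_def dsum_map_def interval_module_def Let_def
      coord_space_def alive_def fun_eq_iff)

lemma bars_module:
  assumes "finite I"
  shows "module K (pm_ob (bars K I a b) t)"
proof -
  have m: "module K (free_space K (alive I a b t))"
    by (rule free_module) (rule K.is_cring)
  have c: "carrier (free_space K (alive I a b t)) = coord_space K (alive I a b t)"
  proof -
    have "finite {i. h i \<noteq> \<zero>\<^bsub>K\<^esub>}" if "\<forall>i. i \<notin> alive I a b t \<longrightarrow> h i = \<zero>\<^bsub>K\<^esub>" for h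
      by (rule finite_subset[OF _ alive_finite[OF assms]]) (use that in auto)
    then show ?thesis
      by (auto simp: free_space_def coord_space_def)
  qed
  show ?thesis
    by (rule module_transfer[OF m])
      (simp_all only: c bars_carrier[OF assms] bars_add bars_smult bars_zero,
        simp_all add: free_space_def)
qed

lemma bars_persistence_module:
  assumes "finite I"
  shows "persistence_module K (bars K I a b)"
proof (intro persistence_module.intro K persistence_module_axioms.intro bars_module assms)
  have cl: "pm_tr (bars K I a b) s t h \<in> coord_space K (alive I a b t)"
    if "h \<in> coord_space K (alive I a b s)" for s t h
    using that by (simp add: bars_tr) (simp add: coord_space_def)
  have add: "(\<lambda>i. h i \<oplus>\<^bsub>K\<^esub> h' i) \<in> coord_space K (alive I a b s)"
    if "h \<in> coord_space K (alive I a b s)" "h' \<in> coord_space K (alive I a b s)" for s h h'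
    using that by (simp add: coord_space_def)
  have sm: "(\<lambda>i. c \<otimes>\<^bsub>K\<^esub> h i) \<in> coord_space K (alive I a b s)"
    if "h \<in> coord_space K (alive I a b s)" "c \<in> carrier K" for s h c
    using that by (simp add: coord_space_def)
  fix r s t :: real
  show "pm_tr (bars K I a b) s t \<in> lin_maps K (pm_ob (bars K I a b) s) (pm_ob (bars K I a b) t)"
    by (rule lin_mapsI)
      (auto simp: bars_carrier[OF assms] cl bars_add bars_smult bars_tr add sm
        coord_space_def[of _ "alive _ _ _ t"] fun_eq_iff,
        auto simp: bars_add bars_smult coord_space_def)
  fix x
  show "pm_tr (bars K I a b) t t x = x" if "x \<in> carrier (pm_ob (bars K I a b) t)"
    using that by (auto simp: bars_carrier[OF assms] bars_tr) (auto simp: coord_space_def)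
  assume rst: "r \<le> s" "s \<le> t" and "x \<in> carrier (pm_ob (bars K I a b) r)"
  then have x: "x \<in> coord_space K (alive I a b r)" by (simp add: bars_carrier[OF assms])
  \<comment> \<open>Intervals are convex: a bar containing \<open>r\<close> and \<open>t\<close>
    contains \<open>s\<close>, so nothing is lost by stopping at \<open>s\<close>.\<close>
  have "x i = \<zero>\<^bsub>K\<^esub>" if "i \<in> alive I a b t" "i \<notin> alive I a b s" for i
  proof -
    have "ereal s < b i"
      using that(1) rst(2) by (auto simp: alive_def intro: le_less_trans[of "ereal s" "ereal t"])
    then have "i \<notin> alive I a b r" using that rst by (auto simp: alive_def)
    then show ?thesis using x by (simp add: coord_space_def)
  qed
  then show "pm_tr (bars K I a b) s t (pm_tr (bars K I a b) r s x) = pm_tr (bars K I a b) r t x"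
    using cl[OF x, of s] x by (auto simp: bars_tr fun_eq_iff)
qed

section \<open>Isomorphisms and invariance of dimension\<close>

lemma lin_maps_inverse:
  assumes "module K V" "f \<in> lin_maps K V W" "bij_betw f (carrier V) (carrier W)"
  shows "inv_into (carrier V) f \<in> lin_maps K W V"
proof -
  interpret V: module K V by fact
  let ?g = "inv_into (carrier V) f"
  have g: "?g y \<in> carrier V" "f (?g y) = y" if "y \<in> carrier W" for y
    using that assms(3) by (auto simp: bij_betw_def inv_into_into f_inv_into_f)
  have gf: "?g (f x) = x" if "x \<in> carrier V" for x
    using that assms(3) by (simp add: bij_betw_def)
  show ?thesis
  proof (rule lin_mapsI)
    fix y assume y: "y \<in> carrier W"
    show "?g y \<in> carrier V" using g y by simp
    show "?g (c \<odot>\<^bsub>W\<^esub> y) = c \<odot>\<^bsub>V\<^esub> ?g y" if c: "c \<in> carrier K" for c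
      using gf[of "c \<odot>\<^bsub>V\<^esub> ?g y"] lin_maps_smult[OF assms(2) c g(1)[OF y]] g[OF y] c by simp
    fix z assume z: "z \<in> carrier W"
    show "?g (y \<oplus>\<^bsub>W\<^esub> z) = ?g y \<oplus>\<^bsub>V\<^esub> ?g z"
      using gf[of "?g y \<oplus>\<^bsub>V\<^esub> ?g z"] lin_maps_add[OF assms(2) g(1)[OF y] g(1)[OF z]] g[OF y] g[OF z]
      by simp
  qed
qed

lemma pm_iso_inverse:
  assumes X: "persistence_module K X" and f: "f \<in> pm_homs K X Y"
    and bij: "\<And>t. bij_betw (f t) (carrier (pm_ob X t)) (carrier (pm_ob Y t))"
  defines "g \<equiv> \<lambda>t. inv_into (carrier (pm_ob X t)) (f t)"
  shows "g \<in> pm_homs K Y X" "\<And>t. bij_betw (g t) (carrier (pm_ob Y t)) (carrier (pm_ob X t))"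
    "\<And>t x. x \<in> carrier (pm_ob X t) \<Longrightarrow> g t (f t x) = x"
    "\<And>t y. y \<in> carrier (pm_ob Y t) \<Longrightarrow> f t (g t y) = y"
proof -
  show gf: "g t (f t x) = x" if "x \<in> carrier (pm_ob X t)" for t x
    using that bij[of t] by (simp add: g_def bij_betw_def)
  show fg: "f t (g t y) = y" if "y \<in> carrier (pm_ob Y t)" for t y
    using that bij[of t] by (simp add: g_def bij_betw_def f_inv_into_f)
  show "bij_betw (g t) (carrier (pm_ob Y t)) (carrier (pm_ob X t))" for t
    unfolding g_def by (rule bij_betw_inv_into[OF bij])
  have gl: "g t \<in> lin_maps K (pm_ob Y t) (pm_ob X t)" for t
    unfolding g_def by (rule lin_maps_inverse[OF pm_module[OF X] pm_homs_lin[OF f] bij])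
  show "g \<in> pm_homs K Y X"
    unfolding pm_homs_def
  proof (intro CollectI conjI allI impI ballI gl)
    fix s t :: real and y assume st: "s \<le> t" and y: "y \<in> carrier (pm_ob Y s)"
    have x: "g s y \<in> carrier (pm_ob X s)" by (rule lin_maps_closed[OF gl y])
    have "f t (pm_tr X s t (g s y)) = pm_tr Y s t y"
      using pm_homs_natural[OF f st x] fg[OF y] by simp
    then show "g t (pm_tr Y s t y) = pm_tr X s t (g s y)"
      using gf[OF lin_maps_closed[OF pm_tr_lin[OF X st] x]] by simp
  qed
qed

lemma pm_homs_comp:
  assumes f: "f \<in> pm_homs K X Y" and g: "g \<in> pm_homs K Y Z"
  shows "(\<lambda>t x. g t (f t x)) \<in> pm_homs K X Z"
  unfolding pm_homs_def
proof (intro CollectI conjI allI impI ballI)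
  show "(\<lambda>x. g t (f t x)) \<in> lin_maps K (pm_ob X t) (pm_ob Z t)" for t
    by (rule lin_maps_comp[OF pm_homs_lin[OF f] pm_homs_lin[OF g]])
  show "g t (f t (pm_tr X s t x)) = pm_tr Z s t (g s (f s x))"
    if "s \<le> t" "x \<in> carrier (pm_ob X s)" for s t x
    using pm_homs_natural[OF f that] pm_homs_natural[OF g that(1) lin_maps_closed[OF pm_homs_lin[OF f] that(2)]]
    by simp
qed

lemma alive_card_le:
  assumes I: "finite I" and J: "finite J"
    and f: "f \<in> lin_maps K (pm_ob (bars K I a b) t) (pm_ob (bars K J a' b') t)"
    and inj: "inj_on f (carrier (pm_ob (bars K I a b) t))"
  shows "card (alive I a b t) \<le> card (alive J a' b' t)"
proof (rule coord_dim_le[OF K alive_finite[OF J] alive_finite[OF I]])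
  note cl = lin_maps_closed[OF f, unfolded bars_carrier[OF I] bars_carrier[OF J]]
  fix h assume h: "h \<in> coord_space K (alive I a b t)"
  show "f h \<in> coord_space K (alive J a' b' t)" by (rule cl[OF h])
  show "f (\<lambda>i. c \<otimes>\<^bsub>K\<^esub> h i) = (\<lambda>j. c \<otimes>\<^bsub>K\<^esub> f h j)" if "c \<in> carrier K" for c
    using lin_maps_smult[OF f that, of h] h cl[OF h] that
    by (simp add: bars_carrier[OF I] bars_smult)
  show "h = (\<lambda>_. \<zero>\<^bsub>K\<^esub>)" if "f h = (\<lambda>_. \<zero>\<^bsub>K\<^esub>)"
  proof -
    have "f (\<lambda>_. \<zero>\<^bsub>K\<^esub>) = (\<lambda>_. \<zero>\<^bsub>K\<^esub>)"
      using lin_maps_zero[OF bars_module[OF I] bars_module[OF J] f] by (simp add: bars_zero)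
    then show ?thesis
      using inj_onD[OF inj, of h "\<lambda>_. \<zero>\<^bsub>K\<^esub>"] that h
      by (simp add: bars_carrier[OF I]) (simp add: coord_space_def)
  qed
  fix h' assume h': "h' \<in> coord_space K (alive I a b t)"
  show "f (\<lambda>i. h i \<oplus>\<^bsub>K\<^esub> h' i) = (\<lambda>j. f h j \<oplus>\<^bsub>K\<^esub> f h' j)"
    using lin_maps_add[OF f, of h h'] h h' cl[OF h] cl[OF h']
    by (simp add: bars_carrier[OF I] bars_add)
qed

text \<open>Inverting one isomorphism and composing with the other gives an injection between
  coordinate spaces. The resulting inequality is proved for fresh index types, so that it can be
  used in both directions.\<close>

lemma alive_card_eq:
  assumes I: "finite I" and J: "finite J" and X: "\<And>t. module K (pm_ob X t)"
    and iso: "pm_isomorphic K X (bars K I a b)" "pm_isomorphic K X (bars K J a' b')"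
  shows "card (alive I a b t) = card (alive J a' b' t)"
proof -
  have le: "card (alive I a b t) \<le> card (alive J a' b' t)"
    if I: "finite I" and J: "finite J"
      and iso: "pm_isomorphic K X (bars K I a b)" "pm_isomorphic K X (bars K J a' b')"
    for I :: "'u set" and J :: "'v set" and a b a' b'
  proof -
    obtain f where f: "f \<in> pm_homs K X (bars K I a b)"
      "bij_betw (f t) (carrier (pm_ob X t)) (carrier (pm_ob (bars K I a b) t))"
      using iso(1) by (auto simp: pm_isomorphic_def)
    obtain g where g: "g \<in> pm_homs K X (bars K J a' b')"
      "bij_betw (g t) (carrier (pm_ob X t)) (carrier (pm_ob (bars K J a' b') t))"
      using iso(2) by (auto simp: pm_isomorphic_def)
    let ?k = "inv_into (carrier (pm_ob X t)) (f t)"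
    have "(\<lambda>h. g t (?k h)) \<in> lin_maps K (pm_ob (bars K I a b) t) (pm_ob (bars K J a' b') t)"
      by (rule lin_maps_comp[OF lin_maps_inverse[OF X pm_homs_lin[OF f(1)] f(2)] pm_homs_lin[OF g(1)]])
    moreover have "bij_betw (g t \<circ> ?k) (carrier (pm_ob (bars K I a b) t))
        (carrier (pm_ob (bars K J a' b') t))"
      by (rule bij_betw_trans[OF bij_betw_inv_into[OF f(2)] g(2)])
    ultimately show ?thesis
      using alive_card_le[OF I J, of "\<lambda>h. g t (?k h)"] by (simp add: bij_betw_def comp_def)
  qed
  show ?thesis using le[OF I J iso] le[OF J I iso(2,1)] by simp
qed

end

text \<open>This is the origin of the expression \<open>exp (- a) - exp_neg b\<close>: it measures
  the bar with density \<open>exp (- t)\<close>. The convention for infinite \<open>b\<close> is the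
  value of the integral over a ray.\<close>

lemma has_integral_bar:
  assumes "ereal a < b"
  shows "((\<lambda>t. if a \<le> t \<and> ereal t < b then exp (- t) else 0) has_integral
    (exp (- a) - exp_neg b)) UNIV"
proof (cases b)
  case (real c)
  then have ac: "a \<le> c" using assms by simp
  have "((\<lambda>t. exp (- t)) has_integral (- exp (- c) - (- exp (- a)))) {a..c}"
    by (rule fundamental_theorem_of_calculus[OF ac])
      (auto intro!: derivative_eq_intros simp: has_real_derivative_iff_has_vector_derivative[symmetric])
  then have "((\<lambda>t. if t \<in> {a..c} then exp (- t) else 0) has_integral (exp (- a) - exp (- c))) UNIV"
    by (simp only: has_integral_restrict_UNIV) simp
  \<comment> \<open>The bar is open at its right end; the single point \<open>c\<close> is
    negligible.\<close>
  then have "((\<lambda>t. if a \<le> t \<and> ereal t < b then exp (- t) else 0) has_integral (exp (- a) - exp (- c))) UNIV"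
    by (rule has_integral_spike[of "{c}", rotated 2]) (use real in auto)
  then show ?thesis using real by (simp add: exp_neg_def)
next
  case PInf
  have "((\<lambda>t. exp (- t)) has_integral exp (- a)) {a..}"
    using has_integral_exp_minus_to_infinity[of 1 a] by simp
  then have "((\<lambda>t. if t \<in> {a..} then exp (- t) else 0) has_integral exp (- a)) UNIV"
    by (simp only: has_integral_restrict_UNIV)
  then show ?thesis using PInf by (simp add: exp_neg_def)
next
  case MInf
  then show ?thesis using assms by simp
qed

text \<open>Hence the magnitude only depends on the pointwise dimensions.\<close>

lemma has_integral_bars:
  assumes I: "finite I" and ab: "\<And>i. i \<in> I \<Longrightarrow> ereal (a i) < b i"
  shows "((\<lambda>t. exp (- t) * real (card (alive I a b t))) has_integral
    (\<Sum>i\<in>I. exp (- a i) - exp_neg (b i))) UNIV"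
proof -
  have "((\<lambda>t. \<Sum>i\<in>I. if a i \<le> t \<and> ereal t < b i then exp (- t) else 0) has_integral
    (\<Sum>i\<in>I. exp (- a i) - exp_neg (b i))) UNIV"
    by (rule has_integral_sum[OF I has_integral_bar[OF ab]])
  moreover have "(\<Sum>i\<in>I. if a i \<le> t \<and> ereal t < b i then exp (- t) else 0)
      = exp (- t) * real (card (alive I a b t))" for t
    using I by (simp add: sum.If_cases alive_def Int_def conj_commute)
  ultimately show ?thesis by simp
qed

text \<open>Both sides integrate the same function, \<open>exp (- t)\<close> times the dimension of
  \<open>X\<close> at \<open>t\<close>. This is what makes the definite description in
  \<open>persistent_magnitude\<close> well defined.\<close>

lemma magnitude_unique:
  assumes "field K" "finite I" "finite J" "\<And>t. module K (pm_ob X t)"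
    and "pm_isomorphic K X (bars K I a b)" "pm_isomorphic K X (bars K J a' b')"
    and "\<And>i. i \<in> I \<Longrightarrow> ereal (a i) < b i" "\<And>j. j \<in> J \<Longrightarrow> ereal (a' j) < b' j"
  shows "(\<Sum>i\<in>I. exp (- a i) - exp_neg (b i)) = (\<Sum>j\<in>J. exp (- a' j) - exp_neg (b' j))"
proof (rule has_integral_unique)
  show "((\<lambda>t. exp (- t) * real (card (alive J a' b' t))) has_integral
      (\<Sum>i\<in>I. exp (- a i) - exp_neg (b i))) UNIV"
    using has_integral_bars[of I a b, OF assms(2,7)] unfolding alive_card_eq[OF assms(1-6)] .
  show "((\<lambda>t. exp (- t) * real (card (alive J a' b' t))) has_integral
      (\<Sum>j\<in>J. exp (- a' j) - exp_neg (b' j))) UNIV"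
    by (rule has_integral_bars[OF assms(3,8)])
qed

text \<open>Decompositions arise over index sets such as \<open>I \<times> J\<close>, whereas
  \<open>persistent_magnitude\<close> considers initial segments of the naturals; an enumeration of
  \<open>I\<close> mediates.\<close>

lemma bars_reindex:
  assumes K: "field K" and I: "finite I" and f: "bij_betw f {..<n::nat} I"
    and iso: "pm_isomorphic K X (bars K I a b)"
  shows "pm_isomorphic K X (bars K {..<n} (\<lambda>k. a (f k)) (\<lambda>k. b (f k)))"
proof -
  interpret K: field K by fact
  let ?J = "{..<n}" and ?a = "\<lambda>k. a (f k)" and ?b = "\<lambda>k. b (f k)"
  have J: "finite ?J" by simp
  let ?g = "inv_into ?J f"
  have fI: "f k \<in> I" if "k < n" for k using f that by (auto simp: bij_betw_def)
  have gf: "?g (f k) = k" if "k < n" for k using f that by (simp add: bij_betw_def)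
  have fg: "f (?g i) = i" "?g i < n" if "i \<in> I" for i
    using f that by (auto simp: bij_betw_def f_inv_into_f dest: inv_into_into)
  \<comment> \<open>\<open>r\<close> renumbers coordinates and \<open>q\<close> undoes this; both
    fill in zero outside the index sets.\<close>
  define r where "r h k = (if k < n then h (f k) else \<zero>\<^bsub>K\<^esub>)" for h :: "_ \<Rightarrow> _" and k
  define q where "q h i = (if i \<in> I then h (?g i) else \<zero>\<^bsub>K\<^esub>)" for h :: "_ \<Rightarrow> _" and i
  have al: "k \<in> alive ?J ?a ?b t \<longleftrightarrow> k < n \<and> f k \<in> alive I a b t" for k t
    using fI by (auto simp: alive_def)
  have rc: "r h \<in> coord_space K (alive ?J ?a ?b t)" if "h \<in> coord_space K (alive I a b t)" for h t
    using that by (simp add: coord_space_def al r_def)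
  have rhom: "(\<lambda>_. r) \<in> pm_homs K (bars K I a b) (bars K ?J ?a ?b)"
    unfolding pm_homs_def
  proof (intro CollectI conjI allI impI ballI)
    show "r \<in> lin_maps K (pm_ob (bars K I a b) t) (pm_ob (bars K ?J ?a ?b) t)" for t
      by (rule lin_mapsI)
        (simp_all add: bars_carrier[OF K I] bars_carrier[OF K J] rc bars_add[OF K] bars_smult[OF K],
          simp_all add: r_def fun_eq_iff)
    fix s t :: real and h assume "h \<in> carrier (pm_ob (bars K I a b) s)"
    then have h: "h \<in> coord_space K (alive I a b s)" by (simp add: bars_carrier[OF K I])
    show "r (pm_tr (bars K I a b) s t h) = pm_tr (bars K ?J ?a ?b) s t (r h)"
      using h rc[OF h] by (auto simp: bars_tr[OF K] al r_def fun_eq_iff)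
  qed
  have rbij: "bij_betw r (carrier (pm_ob (bars K I a b) t)) (carrier (pm_ob (bars K ?J ?a ?b) t))" for t
    unfolding bars_carrier[OF K I] bars_carrier[OF K J]
  proof (rule bij_betw_byWitness[where f' = q])
    show "\<forall>h\<in>coord_space K (alive I a b t). q (r h) = h"
      using fg by (auto simp: q_def r_def coord_space_def alive_def fun_eq_iff)
    show "\<forall>h\<in>coord_space K (alive ?J ?a ?b t). r (q h) = h"
      using gf fI by (auto simp: q_def r_def coord_space_def alive_def fun_eq_iff)
    show "r ` coord_space K (alive I a b t) \<subseteq> coord_space K (alive ?J ?a ?b t)" using rc by auto
    show "q ` coord_space K (alive ?J ?a ?b t) \<subseteq> coord_space K (alive I a b t)"
      using fg by (auto simp: q_def coord_space_def al alive_def)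
  qed
  obtain \<phi> where \<phi>: "\<phi> \<in> pm_homs K X (bars K I a b)"
    "\<And>t. bij_betw (\<phi> t) (carrier (pm_ob X t)) (carrier (pm_ob (bars K I a b) t))"
    using iso by (auto simp: pm_isomorphic_def)
  show ?thesis
    unfolding pm_isomorphic_def
    using pm_homs_comp[OF K \<phi>(1) rhom] bij_betw_trans[OF \<phi>(2) rbij]
    by (auto simp: comp_def intro!: bexI[of _ "\<lambda>t x. r (\<phi> t x)"])
qed

text \<open>Existence by renumbering, uniqueness by integration. All four magnitudes of the theorem
  are evaluated with this rule, each from some decomposition into nonempty bars.\<close>

lemma persistent_magnitude_bars:
  fixes I :: "'i set"
  assumes K: "field K" and I: "finite I" and X: "\<And>t. module K (pm_ob X t)"
    and iso: "pm_isomorphic K X (bars K I a b)" and ab: "\<And>i. i \<in> I \<Longrightarrow> ereal (a i) < b i"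
  shows "persistent_magnitude K X = (\<Sum>i\<in>I. exp (- a i) - exp_neg (b i))"
  unfolding persistent_magnitude_def
proof (rule the_equality)
  obtain f where f: "bij_betw f {..<card I} I"
    using ex_bij_betw_nat_finite[OF I] by (auto simp: atLeast0LessThan)
  have "(\<Sum>i\<in>I. exp (- a i) - exp_neg (b i)) = (\<Sum>k<card I. exp (- a (f k)) - exp_neg (b (f k)))"
    using sum.reindex_bij_betw[OF f, of "\<lambda>i. exp (- a i) - exp_neg (b i)"] by simp
  moreover have "\<forall>k<card I. ereal (a (f k)) < b (f k)"
    using f ab by (auto simp: bij_betw_def)
  moreover have "pm_isomorphic K X (interval_sum K (card I) (\<lambda>k. a (f k)) (\<lambda>k. b (f k)))"
    unfolding interval_sum_bars by (rule bars_reindex[OF K I f iso])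
  ultimately show "\<exists>n a' b'. (\<forall>k<n. ereal (a' k) < b' k) \<and> pm_isomorphic K X (interval_sum K n a' b') \<and>
      (\<Sum>i\<in>I. exp (- a i) - exp_neg (b i)) = (\<Sum>k<n. exp (- a' k) - exp_neg (b' k))"
    by (intro exI[of _ "card I"] exI[of _ "\<lambda>k. a (f k)"] exI[of _ "\<lambda>k. b (f k)"]) simp
next
  fix r assume "\<exists>n a' b'. (\<forall>k<n. ereal (a' k) < b' k) \<and> pm_isomorphic K X (interval_sum K n a' b') \<and>
      r = (\<Sum>k<n. exp (- a' k) - exp_neg (b' k))"
  then obtain n a' b' where "(\<forall>k<n. ereal (a' k) < b' k) \<and>
      pm_isomorphic K X (interval_sum K n a' b') \<and> r = (\<Sum>k<n. exp (- a' k) - exp_neg (b' k))"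
    by (elim exE) (rule that)
  then have **: "\<forall>k<n. ereal (a' k) < b' k" "pm_isomorphic K X (bars K {..<n} a' b')"
    "r = (\<Sum>k<n. exp (- a' k) - exp_neg (b' k))"
    by (simp_all add: interval_sum_bars)
  then have *: "\<And>k. k \<in> {..<n} \<Longrightarrow> ereal (a' k) < b' k" by simp
  show "r = (\<Sum>i\<in>I. exp (- a i) - exp_neg (b i))"
    unfolding **(3) by (rule magnitude_unique[OF K _ I X **(2) iso * ab]) auto
qed


section \<open>The structure theorem\<close>

text \<open>Generators may be born simultaneously. Ties are broken by index, so that a nonzero
  vector supported on \<open>{..<n}\<close> has exactly one coordinate of highest rank; the rank of
  \<open>i\<close> counts its predecessors.\<close>

lemma ex_ranking:
  fixes a :: "nat \<Rightarrow> real"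
  obtains rk :: "nat \<Rightarrow> nat" where "inj_on rk {..<n}"
    and "\<And>i j. i < n \<Longrightarrow> j < n \<Longrightarrow> rk i \<le> rk j \<Longrightarrow> a i \<le> a j"
proof -
  define lt where "lt j i \<longleftrightarrow> a j < a i \<or> a j = a i \<and> j < i" for i j
  define rk where "rk i = card {j. j < n \<and> lt j i}" for i
  have less: "rk i < rk j" if "i < n" "lt i j" for i j
    unfolding rk_def
  proof (rule psubset_card_mono)
    show "{k. k < n \<and> lt k i} \<subset> {k. k < n \<and> lt k j}"
      using that by (auto simp: lt_def)
  qed simp
  have "inj_on rk {..<n}"
  proof (rule inj_onI)
    fix i j assume ij: "i \<in> {..<n}" "j \<in> {..<n}" "rk i = rk j"
    have "\<not> lt i j" "\<not> lt j i" using less[of i j] less[of j i] ij by auto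
    then show "i = j" by (auto simp: lt_def)
  qed
  moreover have "a i \<le> a j" if "i < n" "j < n" "rk i \<le> rk j" for i j
    using less[of j i] that by (fastforce simp: lt_def)
  ultimately show ?thesis using that by blast
qed

text \<open>
  A presentation exhibits \<open>M\<close> as the quotient \<open>V / R\<close> of two filtrations of a coordinate space:
  \<open>V t\<close> is spanned by the generators born up to time \<open>t\<close>, and \<open>R t\<close> by the relations born up to
  time \<open>t\<close>. Order the generators by birth. For a generator \<open>p\<close>, let \<open>\<beta> p\<close> be the first time at
  which \<open>R\<close> contains a vector \<open>v p\<close> with leading coordinate \<open>p\<close> (if there is none, \<open>\<beta> p = \<infinity>\<close> and
  \<open>v p\<close> is a unit vector). The vectors \<open>v p\<close> form a basis adapted to both filtrations, so their
  classes generate the bars \<open>[a p, \<beta> p)\<close> of \<open>M\<close>.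
\<close>

lemma finitely_presented_bars:
  fixes K :: "('k, 'm) ring_scheme" and M :: "('k, 'x) persmod"
  assumes K: "field K" and fp: "finitely_presented K M"
  obtains I :: "nat set" and a b \<phi> where "finite I" "\<And>i. i \<in> I \<Longrightarrow> ereal (a i) < b i"
    "\<phi> \<in> pm_homs K (bars K I a b) M"
    "\<And>t. bij_betw (\<phi> t) (carrier (pm_ob (bars K I a b) t)) (carrier (pm_ob M t))"
proof -
  interpret K: field K by fact
  have M: "persistence_module K M" using fp by (simp add: finitely_presented_def)
  obtain m n a b \<phi> \<pi> where pres:
    "\<phi> \<in> pm_homs K (fg_free K m b) (fg_free K n a)" "\<pi> \<in> pm_homs K (fg_free K n a) M"
    "pm_exact (fg_free K m b) (fg_free K n a) M \<phi> \<pi>" "pm_epi (fg_free K n a) M \<pi>"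
    using fp by (auto simp: finitely_presented_def)
  define V where "V t = coord_space K {i. i < n \<and> a i \<le> t}" for t
  define V1 where "V1 t = coord_space K {j. j < m \<and> b j \<le> t}" for t
  define R where "R t = {h \<in> V t. \<pi> t h = \<zero>\<^bsub>pm_ob M t\<^esub>}" for t
  have free: "fg_free K k c = bars K {..<k} c (\<lambda>_. \<infinity>)" for k c
    by (simp add: fg_free_def interval_sum_bars)
  have al: "alive {..<k} c (\<lambda>_. \<infinity>) t = {i. i < k \<and> c i \<le> t}" for k :: nat and c t
    by (auto simp: alive_def)
  have VF: "carrier (pm_ob (fg_free K n a) t) = V t" for t
    unfolding free by (simp add: bars_carrier[OF K] al V_def)
  have V1F: "carrier (pm_ob (fg_free K m b) t) = V1 t" for t
    unfolding free by (simp add: bars_carrier[OF K] al V1_def)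
  \<comment> \<open>Bars of a free module never die, so its transition maps are inclusions of
    coordinate spaces.\<close>
  have trV: "pm_tr (fg_free K n a) s t h = h" if "s \<le> t" "h \<in> V s" for s t h
    unfolding free using that by (auto simp: bars_tr[OF K] al V_def) (auto simp: coord_space_def fun_eq_iff)
  have trV1: "pm_tr (fg_free K m b) s t h = h" if "s \<le> t" "h \<in> V1 s" for s t h
    unfolding free using that by (auto simp: bars_tr[OF K] al V1_def) (auto simp: coord_space_def fun_eq_iff)
  have Vmono: "h \<in> V t" if "s \<le> t" "h \<in> V s" for s t h
    using that by (auto simp: V_def coord_space_def)
  have VK: "h i \<in> carrier K" if "h \<in> V t" for h t i
    using that by (simp add: V_def coord_space_def)
  have V0: "i < n" "a i \<le> t" if "h \<in> V t" "h i \<noteq> \<zero>\<^bsub>K\<^esub>" for h t i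
    using that by (auto simp: V_def coord_space_def)
  have Vadd: "(\<lambda>i. h i \<oplus>\<^bsub>K\<^esub> h' i) \<in> V t" if "h \<in> V t" "h' \<in> V t" for h h' t
    using that by (simp add: V_def coord_space_def)
  have Vsm: "(\<lambda>i. c \<otimes>\<^bsub>K\<^esub> h i) \<in> V t" if "h \<in> V t" "c \<in> carrier K" for h t c
    using that by (simp add: V_def coord_space_def)
  have Vz: "(\<lambda>_. \<zero>\<^bsub>K\<^esub>) \<in> V t" for t
    by (simp add: V_def coord_space_def)
  have mM: "module K (pm_ob M t)" for t by (rule pm_module[OF M])
  note \<pi>lin = pm_homs_lin[OF pres(2)]
  have \<pi>cl: "\<pi> t h \<in> carrier (pm_ob M t)" if "h \<in> V t" for h t
    using lin_maps_closed[OF \<pi>lin] that by (simp add: VF)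
  have \<pi>add: "\<pi> t (\<lambda>i. h i \<oplus>\<^bsub>K\<^esub> h' i) = \<pi> t h \<oplus>\<^bsub>pm_ob M t\<^esub> \<pi> t h'" if "h \<in> V t" "h' \<in> V t" for h h' t
    using lin_maps_add[OF \<pi>lin, of h t h'] that unfolding VF
    by (simp add: free bars_add[OF K] al V_def)
  have \<pi>sm: "\<pi> t (\<lambda>i. c \<otimes>\<^bsub>K\<^esub> h i) = c \<odot>\<^bsub>pm_ob M t\<^esub> \<pi> t h" if "h \<in> V t" "c \<in> carrier K" for h c t
    using lin_maps_smult[OF \<pi>lin that(2), of h t] that unfolding VF
    by (simp add: free bars_smult[OF K] al V_def)
  have \<pi>0: "\<pi> t (\<lambda>_. \<zero>\<^bsub>K\<^esub>) = \<zero>\<^bsub>pm_ob M t\<^esub>" for t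
    using \<pi>sm[OF Vz K.zero_closed, of t] module.smult_l_null[OF mM \<pi>cl[OF Vz]] by simp
  have \<pi>tr: "pm_tr M s t (\<pi> s h) = \<pi> t h" if "s \<le> t" "h \<in> V s" for s t h
    using pm_homs_natural[OF pres(2) that(1), of h] that trV[OF that] by (simp add: VF)
  have \<pi>surj: "\<pi> t ` V t = carrier (pm_ob M t)" for t
    using pres(4) by (simp add: pm_epi_def VF)
  \<comment> \<open>Exactness: the relations at time \<open>t\<close> are the images of vectors
    supported on relation generators born by \<open>t\<close>.\<close>
  have R\<phi>: "R t = \<phi> t ` V1 t" for t
    using pres(3) by (simp add: pm_exact_def V1F a_kernel_def' VF R_def)
  have \<phi>tr: "\<phi> t u = \<phi> s u" if "s \<le> t" "u \<in> V1 s" for s t u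
  proof -
    have "\<phi> s u \<in> V s" using lin_maps_closed[OF pm_homs_lin[OF pres(1)], of u s] that by (simp add: VF V1F)
    then show ?thesis
      using pm_homs_natural[OF pres(1) that(1), of u] that trV1[OF that] trV[OF that(1)]
      by (simp add: V1F)
  qed
  have Rmono: "h \<in> R t" if "s \<le> t" "h \<in> R s" for s t h
  proof -
    have h: "h \<in> V s" "\<pi> s h = \<zero>\<^bsub>pm_ob M s\<^esub>" using that by (auto simp: R_def)
    then show ?thesis
      using \<pi>tr[OF that(1) h(1)] Vmono[OF that(1) h(1)] lin_maps_zero[OF mM mM pm_tr_lin[OF M that(1)]]
      by (simp add: R_def)
  qed
  have Rsm: "(\<lambda>i. c \<otimes>\<^bsub>K\<^esub> h i) \<in> R t" if "h \<in> R t" "c \<in> carrier K" for h t c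
    using that Vsm[of h t c] \<pi>sm[of h t c] module.smult_r_null[OF mM that(2)] by (simp add: R_def)
  \<comment> \<open>Relations change only at the finitely many times \<open>b j\<close>: a nonzero
    relation at \<open>t\<close> is already one at the latest such time up to \<open>t\<close>.
    Hence first times of occurrence exist.\<close>
  have Rfirst: "\<exists>\<tau>\<in>b ` {..<m}. \<tau> \<le> t \<and> h \<in> R \<tau>" if h: "h \<in> R t" "h \<noteq> (\<lambda>_. \<zero>\<^bsub>K\<^esub>)" for h t
  proof -
    obtain u where u: "u \<in> V1 t" "h = \<phi> t u" using h(1) unfolding R\<phi> by auto
    let ?B = "b ` {j. j < m \<and> b j \<le> t}"
    have fin: "finite ?B" by simp
    have "?B \<noteq> {}"
    proof
      assume "?B = {}"
      then have "u = (\<lambda>_. \<zero>\<^bsub>K\<^esub>)" using u(1) by (auto simp: V1_def coord_space_def)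
      then have "h = (\<lambda>_. \<zero>\<^bsub>K\<^esub>)"
        using lin_maps_zero[OF _ _ pm_homs_lin[OF pres(1)], of t] u(2)
        by (simp add: free bars_zero[OF K] bars_module[OF K])
      then show False using h(2) by simp
    qed
    then have "Max ?B \<in> ?B" using fin by (rule Max_in[rotated])
    then have \<tau>: "Max ?B \<in> b ` {..<m}" "Max ?B \<le> t" by auto
    have le: "b j \<le> Max ?B" if "j < m" "b j \<le> t" for j
      using that fin by (intro Max_ge) auto
    have "u j = \<zero>\<^bsub>K\<^esub>" if "\<not> (j < m \<and> b j \<le> Max ?B)" for j
      using le[of j] that u(1) unfolding V1_def coord_space_def by blast
    then have "u \<in> V1 (Max ?B)" using u(1) by (simp add: V1_def coord_space_def)
    then have "h \<in> R (Max ?B)" using \<phi>tr[OF \<tau>(2)] u(2) unfolding R\<phi> by auto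
    then show ?thesis using \<tau> by blast
  qed
  obtain rk :: "nat \<Rightarrow> nat" where rk: "inj_on rk {..<n}"
    "\<And>i j. i < n \<Longrightarrow> j < n \<Longrightarrow> rk i \<le> rk j \<Longrightarrow> a i \<le> a j"
    using ex_ranking[of n a] by blast
  \<comment> \<open>\<open>p\<close> is the leading coordinate of \<open>v\<close> with respect to
    the ranking, with coefficient normalised to one.\<close>
  define low where "low v p \<longleftrightarrow> v p = \<one>\<^bsub>K\<^esub> \<and> (\<forall>i. v i \<noteq> \<zero>\<^bsub>K\<^esub> \<longrightarrow> rk i \<le> rk p)" for v and p :: nat
  \<comment> \<open>By \<open>Rfirst\<close> the minimum may be sought among the finitely many times
    \<open>b j\<close>.\<close>
  have first: "\<exists>\<tau>. (\<exists>v\<in>R \<tau>. low v p) \<and> (\<forall>t. (\<exists>v\<in>R t. low v p) \<longrightarrow> \<tau> \<le> t)"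
    if ex: "\<exists>t. \<exists>v\<in>R t. low v p" for p
  proof -
    let ?B = "{\<tau> \<in> b ` {..<m}. \<exists>v\<in>R \<tau>. low v p}"
    have step: "\<exists>\<tau>\<in>?B. \<tau> \<le> t" if v: "v \<in> R t" "low v p" for v t
    proof -
      have "v \<noteq> (\<lambda>_. \<zero>\<^bsub>K\<^esub>)" using v(2) by (auto simp: low_def)
      then show ?thesis using Rfirst[OF v(1)] v(2) by blast
    qed
    have fin: "finite ?B" by simp
    have "?B \<noteq> {}" using ex step by blast
    then have "Min ?B \<in> ?B" using fin by (rule Min_in[rotated])
    moreover have "Min ?B \<le> t" if "\<exists>v\<in>R t. low v p" for t
      using that step Min_le[OF fin] by (meson order_trans)
    ultimately show ?thesis by blast
  qed
  \<comment> \<open>Vector and death time are chosen jointly as a pair \<open>vb\<close>. The death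
    time is an extended real, to cover generators that never occur as leading coordinate of a
    relation.\<close>
  have "\<forall>p\<in>{..<n}. \<exists>vb. fst vb \<in> V (a p) \<and> low (fst vb) p \<and>
      (\<forall>t. snd vb \<le> ereal t \<longrightarrow> fst vb \<in> R t) \<and>
      (\<forall>t. (\<exists>v\<in>R t. low v p) \<longrightarrow> snd vb \<le> ereal t)"
  proof
    fix p assume p: "p \<in> {..<n}"
    show "\<exists>vb. fst vb \<in> V (a p) \<and> low (fst vb) p \<and>
      (\<forall>t. snd vb \<le> ereal t \<longrightarrow> fst vb \<in> R t) \<and>
      (\<forall>t. (\<exists>v\<in>R t. low v p) \<longrightarrow> snd vb \<le> ereal t)"
    proof (cases "\<exists>t. \<exists>v\<in>R t. low v p")
      case True
      then obtain \<tau> v where v: "v \<in> R \<tau>" "low v p" "\<And>t. \<exists>v\<in>R t. low v p \<Longrightarrow> \<tau> \<le> t"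
        using first[OF True] by blast
      have vV: "v \<in> V \<tau>" using v(1) by (simp add: R_def)
      \<comment> \<open>No coordinate in the support of \<open>v\<close> ranks above
        \<open>p\<close>, so none is born after \<open>p\<close>: the vector exists from the birth
        of \<open>p\<close> on, although it becomes a relation only at
        \<open>\<tau>\<close>.\<close>
      have "i < n \<and> a i \<le> a p" if "v i \<noteq> \<zero>\<^bsub>K\<^esub>" for i
        using V0(1)[OF vV that] v(2) rk(2)[of i p] p that by (simp add: low_def)
      then have "v \<in> V (a p)"
        using VK[OF vV] by (auto simp: V_def coord_space_def)
      then show ?thesis
        using v Rmono by (intro exI[of _ "(v, ereal \<tau>)"]) auto
    next
      case False
      have "(\<lambda>i. if i = p then \<one>\<^bsub>K\<^esub> else \<zero>\<^bsub>K\<^esub>) \<in> V (a p)"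
        using p by (auto simp: V_def coord_space_def)
      then show ?thesis
        using False by (intro exI[of _ "(\<lambda>i. if i = p then \<one>\<^bsub>K\<^esub> else \<zero>\<^bsub>K\<^esub>, \<infinity>)"]) (auto simp: low_def)
    qed
  qed
  from bchoice[OF this] obtain vb where vb0: "\<forall>p\<in>{..<n}. fst (vb p) \<in> V (a p) \<and> low (fst (vb p)) p \<and>
      (\<forall>t. snd (vb p) \<le> ereal t \<longrightarrow> fst (vb p) \<in> R t) \<and>
      (\<forall>t. (\<exists>v\<in>R t. low v p) \<longrightarrow> snd (vb p) \<le> ereal t)"
    by (elim exE) (rule that)
  then have vb: "\<And>p. p < n \<Longrightarrow> fst (vb p) \<in> V (a p)"
    "\<And>p. p < n \<Longrightarrow> low (fst (vb p)) p"
    "\<And>p t. p < n \<Longrightarrow> snd (vb p) \<le> ereal t \<Longrightarrow> fst (vb p) \<in> R t"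
    "\<And>p t v. p < n \<Longrightarrow> v \<in> R t \<Longrightarrow> low v p \<Longrightarrow> snd (vb p) \<le> ereal t"
    by blast+
  define v where "v p = fst (vb p)" for p
  define \<beta> where "\<beta> p = snd (vb p)" for p
  have vV: "v p \<in> V t" if "p < n" "a p \<le> t" for p t
    using Vmono[OF that(2) vb(1)[OF that(1)]] by (simp add: v_def)
  have vlow: "low (v p) p" if "p < n" for p using vb(2)[OF that] by (simp add: v_def)
  have vR: "v p \<in> R t" if "p < n" "\<beta> p \<le> ereal t" for p t
    using vb(3)[OF that(1)] that(2) by (simp add: v_def \<beta>_def)
  have \<beta>le: "\<beta> p \<le> ereal t" if "p < n" "w \<in> R t" "low w p" for p t w
    using vb(4)[OF that] by (simp add: \<beta>_def)
  \<comment> \<open>A generator whose vector is a relation from birth would give an empty bar and is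
    discarded.\<close>
  define I where "I = {p. p < n \<and> ereal (a p) < \<beta> p}"
  define S where "S t = alive I a \<beta> t" for t
  have finI: "finite I" and finS: "finite (S t)" for t
    by (simp_all add: I_def S_def alive_def)
  have S: "p \<in> S t \<longleftrightarrow> p < n \<and> a p \<le> t \<and> ereal t < \<beta> p" for p t
    by (auto simp: S_def alive_def I_def intro: le_less_trans[of "ereal (a p)" "ereal t"])
  \<comment> \<open>The unit vector at \<open>p\<close> goes to the class of \<open>v p\<close> in
    \<open>M\<close>.\<close>
  define \<Xi> where "\<Xi> t h = (\<Oplus>\<^bsub>pm_ob M t\<^esub>p\<in>S t. h p \<odot>\<^bsub>pm_ob M t\<^esub> \<pi> t (v p))" for t h
  define C where "C t = coord_space K (S t)" for t
  have CF: "carrier (pm_ob (bars K I a \<beta>) t) = C t" for t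
    by (simp add: bars_carrier[OF K finI] C_def S_def)
  have CK: "h p \<in> carrier K" if "h \<in> C t" for h t p
    using that by (simp add: C_def coord_space_def)
  have x: "\<pi> t (v p) \<in> carrier (pm_ob M t)" if "p \<in> S t" for p t
    using that \<pi>cl[OF vV] by (simp add: S)
  have trm: "h p \<odot>\<^bsub>pm_ob M t\<^esub> \<pi> t (v p) \<in> carrier (pm_ob M t)" if "h \<in> C t" "p \<in> S t" for h p t
    by (rule module.smult_closed[OF mM CK[OF that(1)] x[OF that(2)]])
  have \<Xi>lin: "\<Xi> t \<in> lin_maps K (pm_ob (bars K I a \<beta>) t) (pm_ob M t)" for t
  proof (rule lin_mapsI, unfold CF)
    interpret Mt: module K "pm_ob M t" by (rule mM)
    fix h assume h: "h \<in> C t"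
    show "\<Xi> t h \<in> carrier (pm_ob M t)"
      unfolding \<Xi>_def using trm[OF h] by (intro Mt.M.finsum_closed) auto
    show "\<Xi> t (c \<odot>\<^bsub>pm_ob (bars K I a \<beta>) t\<^esub> h) = c \<odot>\<^bsub>pm_ob M t\<^esub> \<Xi> t h" if c: "c \<in> carrier K" for c
    proof -
      have "c \<odot>\<^bsub>pm_ob (bars K I a \<beta>) t\<^esub> h = (\<lambda>i. c \<otimes>\<^bsub>K\<^esub> h i)"
        using h c by (intro bars_smult[OF K]) (simp_all add: C_def S_def)
      then have "\<Xi> t (c \<odot>\<^bsub>pm_ob (bars K I a \<beta>) t\<^esub> h)
          = (\<Oplus>\<^bsub>pm_ob M t\<^esub>p\<in>S t. c \<odot>\<^bsub>pm_ob M t\<^esub> (h p \<odot>\<^bsub>pm_ob M t\<^esub> \<pi> t (v p)))"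
        unfolding \<Xi>_def using CK[OF h] c x trm[OF h]
        by (intro Mt.M.finsum_cong') (auto simp: Mt.smult_assoc1)
      also have "\<dots> = c \<odot>\<^bsub>pm_ob M t\<^esub> \<Xi> t h"
        unfolding \<Xi>_def using trm[OF h] c finS by (intro Mt.finsum_smult_ldistr[symmetric]) auto
      finally show ?thesis .
    qed
    fix h' assume h': "h' \<in> C t"
    have "h \<oplus>\<^bsub>pm_ob (bars K I a \<beta>) t\<^esub> h' = (\<lambda>i. h i \<oplus>\<^bsub>K\<^esub> h' i)"
      using h h' by (intro bars_add[OF K]) (simp_all add: C_def S_def)
    then have "\<Xi> t (h \<oplus>\<^bsub>pm_ob (bars K I a \<beta>) t\<^esub> h') = (\<Oplus>\<^bsub>pm_ob M t\<^esub>p\<in>S t.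
        h p \<odot>\<^bsub>pm_ob M t\<^esub> \<pi> t (v p) \<oplus>\<^bsub>pm_ob M t\<^esub> h' p \<odot>\<^bsub>pm_ob M t\<^esub> \<pi> t (v p))"
      unfolding \<Xi>_def using CK[OF h] CK[OF h'] x trm[OF h] trm[OF h']
      by (intro Mt.M.finsum_cong') (auto simp: Mt.smult_l_distr)
    also have "\<dots> = \<Xi> t h \<oplus>\<^bsub>pm_ob M t\<^esub> \<Xi> t h'"
      unfolding \<Xi>_def using trm[OF h] trm[OF h'] by (intro Mt.M.finsum_addf) auto
    finally show "\<Xi> t (h \<oplus>\<^bsub>pm_ob (bars K I a \<beta>) t\<^esub> h') = \<Xi> t h \<oplus>\<^bsub>pm_ob M t\<^esub> \<Xi> t h'" .
  qed
  have \<Xi>hom: "\<Xi> \<in> pm_homs K (bars K I a \<beta>) M"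
    unfolding pm_homs_def
  proof (intro CollectI conjI allI impI ballI \<Xi>lin)
    fix s t :: real and h assume st: "s \<le> t" and "h \<in> carrier (pm_ob (bars K I a \<beta>) s)"
    then have h: "h \<in> C s" by (simp add: CF)
    interpret Mt: module K "pm_ob M t" by (rule mM)
    \<comment> \<open>\<open>S s\<close> and \<open>S t\<close> need not be comparable, so both sums
      are extended to the union: for bars that have died by \<open>t\<close> the class vanishes, for
      bars not yet born at \<open>s\<close> the coefficient does.\<close>
    let ?U = "S s \<union> S t"
    let ?f = "\<lambda>p. h p \<odot>\<^bsub>pm_ob M t\<^esub> \<pi> t (v p)"
    have tcl: "\<pi> t (v p) \<in> carrier (pm_ob M t)" if "p \<in> ?U" for p
      using that \<pi>cl[OF vV] st by (auto simp: S)
    have fcl: "?f \<in> ?U \<rightarrow> carrier (pm_ob M t)"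
      using tcl CK[OF h] by auto
    have trh: "pm_tr (bars K I a \<beta>) s t h = (\<lambda>p. if p \<in> S t then h p else \<zero>\<^bsub>K\<^esub>)"
      using bars_tr[OF K, of h I a \<beta> s t] h by (simp add: C_def S_def)
    have "\<Xi> t (pm_tr (bars K I a \<beta>) s t h) = (\<Oplus>\<^bsub>pm_ob M t\<^esub>p\<in>S t. ?f p)"
      unfolding \<Xi>_def trh using fcl by (intro Mt.M.finsum_cong') auto
    also have "\<dots> = (\<Oplus>\<^bsub>pm_ob M t\<^esub>p\<in>?U. ?f p)"
    proof (rule finsum_superset[OF mM _ _ _ fcl])
      fix p assume p: "p \<in> ?U - S t"
      then have "p < n" "\<beta> p \<le> ereal t" using st by (auto simp: S)
      then have "\<pi> t (v p) = \<zero>\<^bsub>pm_ob M t\<^esub>" using vR by (simp add: R_def)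
      then show "?f p = \<zero>\<^bsub>pm_ob M t\<^esub>" using CK[OF h] by simp
    qed (auto simp: finS)
    also have "\<dots> = (\<Oplus>\<^bsub>pm_ob M t\<^esub>p\<in>S s. ?f p)"
    proof (rule finsum_superset[OF mM _ _ _ fcl, symmetric])
      fix p assume p: "p \<in> ?U - S s"
      then have "h p = \<zero>\<^bsub>K\<^esub>" using h by (simp add: C_def coord_space_def)
      moreover have "\<pi> t (v p) \<in> carrier (pm_ob M t)" using p by (intro tcl) auto
      ultimately show "?f p = \<zero>\<^bsub>pm_ob M t\<^esub>" by simp
    qed (auto simp: finS)
    also have "\<dots> = (\<Oplus>\<^bsub>pm_ob M t\<^esub>p\<in>S s. pm_tr M s t (h p \<odot>\<^bsub>pm_ob M s\<^esub> \<pi> s (v p)))"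
    proof (rule Mt.M.finsum_cong'[OF refl])
      show "(\<lambda>p. pm_tr M s t (h p \<odot>\<^bsub>pm_ob M s\<^esub> \<pi> s (v p))) \<in> S s \<rightarrow> carrier (pm_ob M t)"
        using lin_maps_closed[OF pm_tr_lin[OF M st] trm[OF h]] by auto
      fix p assume p: "p \<in> S s"
      then have "pm_tr M s t (\<pi> s (v p)) = \<pi> t (v p)"
        using \<pi>tr[OF st vV] by (simp add: S)
      then show "?f p = pm_tr M s t (h p \<odot>\<^bsub>pm_ob M s\<^esub> \<pi> s (v p))"
        using lin_maps_smult[OF pm_tr_lin[OF M st] CK[OF h] x[OF p]] by simp
    qed
    also have "\<dots> = pm_tr M s t (\<Xi> s h)"
      unfolding \<Xi>_def using trm[OF h]
      by (intro lin_maps_finsum[OF mM mM pm_tr_lin[OF M st] finS, symmetric]) auto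
    finally show "\<Xi> t (pm_tr (bars K I a \<beta>) s t h) = pm_tr M s t (\<Xi> s h)" .
  qed
  \<comment> \<open>For \<open>A = S t\<close> this lifts \<open>\<Xi> t h\<close> from
    \<open>M\<close> to the coordinate space \<open>V t\<close>.\<close>
  define comb where "comb A h = (\<lambda>i. \<Oplus>\<^bsub>K\<^esub>p\<in>A. h p \<otimes>\<^bsub>K\<^esub> v p i)" for A and h :: "nat \<Rightarrow> 'k"
  have vK: "v p i \<in> carrier K" if "p \<in> S t" for p t i
    using that by (intro VK[OF vV[of p t]]) (simp_all add: S)
  have comb: "comb A h \<in> V t \<and> \<pi> t (comb A h) = (\<Oplus>\<^bsub>pm_ob M t\<^esub>p\<in>A. h p \<odot>\<^bsub>pm_ob M t\<^esub> \<pi> t (v p))"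
    if "finite A" "A \<subseteq> S t" and h: "h \<in> C t" for A h t
    using that(1,2)
  proof induct
    case empty
    interpret Mt: module K "pm_ob M t" by (rule mM)
    show ?case by (simp add: comb_def Vz \<pi>0)
  next
    case (insert p A)
    interpret Mt: module K "pm_ob M t" by (rule mM)
    have p: "p \<in> S t" and A: "A \<subseteq> S t" using insert by auto
    have eq: "comb (insert p A) h = (\<lambda>i. (h p \<otimes>\<^bsub>K\<^esub> v p i) \<oplus>\<^bsub>K\<^esub> comb A h i)"
      unfolding comb_def using insert(1,2) A CK[OF h] vK[OF p] vK
      by (intro ext K.finsum_insert) auto
    have vp: "v p \<in> V t" using p vV by (simp add: S)
    have "(\<Oplus>\<^bsub>pm_ob M t\<^esub>p\<in>insert p A. h p \<odot>\<^bsub>pm_ob M t\<^esub> \<pi> t (v p))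
      = h p \<odot>\<^bsub>pm_ob M t\<^esub> \<pi> t (v p) \<oplus>\<^bsub>pm_ob M t\<^esub> (\<Oplus>\<^bsub>pm_ob M t\<^esub>p\<in>A. h p \<odot>\<^bsub>pm_ob M t\<^esub> \<pi> t (v p))"
      using insert(1,2) A trm[OF h] p by (intro Mt.M.finsum_insert) auto
    then show ?case
      using insert(3)[OF A] Vadd[OF Vsm[OF vp CK[OF h]]] \<pi>add[OF Vsm[OF vp CK[OF h]]]
        \<pi>sm[OF vp CK[OF h]] by (simp add: eq)
  qed
  \<comment> \<open>If \<open>h\<close> were nonzero, let \<open>p\<close> be the index of highest
    rank in its support. The lift of \<open>\<Xi> t h\<close> is then a relation with leading
    coordinate \<open>p\<close>; normalised, it forces \<open>\<beta> p \<le> t\<close>, although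
    \<open>p\<close> is alive at \<open>t\<close>.\<close>
  have inj: "h = (\<lambda>_. \<zero>\<^bsub>K\<^esub>)" if h: "h \<in> C t" and 0: "\<Xi> t h = \<zero>\<^bsub>pm_ob M t\<^esub>" for h t
  proof (rule ccontr)
    assume "h \<noteq> (\<lambda>_. \<zero>\<^bsub>K\<^esub>)"
    let ?P = "{p. h p \<noteq> \<zero>\<^bsub>K\<^esub>}"
    have PS: "?P \<subseteq> S t" using h by (auto simp: C_def coord_space_def)
    have finP: "finite ?P" using PS finS by (rule finite_subset)
    have "?P \<noteq> {}" using \<open>h \<noteq> (\<lambda>_. \<zero>\<^bsub>K\<^esub>)\<close> by auto
    then have "Max (rk ` ?P) \<in> rk ` ?P" using finP by (intro Max_in) auto
    then obtain p where p: "h p \<noteq> \<zero>\<^bsub>K\<^esub>" "Max (rk ` ?P) = rk p" by auto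
    have pmax: "rk q \<le> rk p" if "h q \<noteq> \<zero>\<^bsub>K\<^esub>" for q
      unfolding p(2)[symmetric] using finP that by (intro Max_ge) auto
    have pS: "p \<in> S t" using PS p(1) by auto
    let ?w = "comb (S t) h"
    have wR: "?w \<in> R t" using comb[OF finS subset_refl h] 0 by (simp add: R_def \<Xi>_def)
    have tK: "h q \<otimes>\<^bsub>K\<^esub> v q i \<in> carrier K" if "q \<in> S t" for q i
      using CK[OF h] vK[OF that] by simp
    have w0: "rk i \<le> rk p" if "?w i \<noteq> \<zero>\<^bsub>K\<^esub>" for i
    proof (rule ccontr)
      assume i: "\<not> rk i \<le> rk p"
      have "h q \<otimes>\<^bsub>K\<^esub> v q i = \<zero>\<^bsub>K\<^esub>" if q: "q \<in> S t" for q
      proof (cases "h q = \<zero>\<^bsub>K\<^esub>")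
        case False
        have "v q i = \<zero>\<^bsub>K\<^esub>"
          using vlow[of q] q pmax[OF False] i by (force simp: low_def S)
        then show ?thesis using CK[OF h] by simp
      qed (use vK[OF q] in simp)
      then have "?w i = (\<Oplus>\<^bsub>K\<^esub>q\<in>S t. \<zero>\<^bsub>K\<^esub>)" unfolding comb_def by (intro K.finsum_cong') auto
      then show False using that by simp
    qed
    have "?w p = (\<Oplus>\<^bsub>K\<^esub>q\<in>{p}. h q \<otimes>\<^bsub>K\<^esub> v q p)"
      unfolding comb_def
    proof (rule K.add.finprod_mono_neutral_cong_right)
      fix q assume q: "q \<in> S t - {p}"
      show "h q \<otimes>\<^bsub>K\<^esub> v q p = \<zero>\<^bsub>K\<^esub>"
      proof (cases "h q = \<zero>\<^bsub>K\<^esub>")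
        case False
        have "v q p = \<zero>\<^bsub>K\<^esub>"
        proof (rule ccontr)
          assume "v q p \<noteq> \<zero>\<^bsub>K\<^esub>"
          then have "rk p \<le> rk q" using vlow[of q] q by (simp add: low_def S)
          then have "rk p = rk q" using pmax[OF False] by simp
          then show False using rk(1) q pS by (auto simp: inj_on_def S)
        qed
        then show ?thesis using CK[OF h] by simp
      qed (use vK[of q t p] q in simp)
    qed (use pS tK finS in auto)
    also have "\<dots> = h p" using vlow[of p] pS CK[OF h] by (simp add: low_def S)
    finally have wp: "?w p = h p" .
    obtain y where y: "y \<in> carrier K" "y \<otimes>\<^bsub>K\<^esub> h p = \<one>\<^bsub>K\<^esub>"
      using field_inverse_ex[OF K CK[OF h] p(1)] .
    have "?w i \<noteq> \<zero>\<^bsub>K\<^esub>" if "y \<otimes>\<^bsub>K\<^esub> ?w i \<noteq> \<zero>\<^bsub>K\<^esub>" for i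
      using that y(1) by auto
    then have "low (\<lambda>i. y \<otimes>\<^bsub>K\<^esub> ?w i) p"
      using y wp w0 by (simp add: low_def)
    then have "\<beta> p \<le> ereal t" using \<beta>le[OF _ Rsm[OF wR y(1)]] pS by (simp add: S)
    then show False using pS by (simp add: S not_less[symmetric])
  qed
  have surj: "carrier (pm_ob M t) \<subseteq> \<Xi> t ` C t" for t
  proof
    interpret Mt: module K "pm_ob M t" by (rule mM)
    have D: "submodule (\<Xi> t ` C t) K (pm_ob M t)"
      using subspace_image[OF bars_module[OF K finI] mM \<Xi>lin
          module.carrier_is_submodule[OF bars_module[OF K finI]], of t] by (simp add: CF)
    \<comment> \<open>By time \<open>t\<close> the vector \<open>v p\<close> either has become a
      relation, with class zero, or its class is the image of a unit vector.\<close>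
    have xD: "\<pi> t (v p) \<in> \<Xi> t ` C t" if p: "p < n" "a p \<le> t" for p
    proof (cases "\<beta> p \<le> ereal t")
      case True
      then show ?thesis using vR[OF p(1)] subspace_zero[OF D] by (simp add: R_def)
    next
      case False
      then have pS: "p \<in> S t" using p by (simp add: S)
      let ?e = "\<lambda>q. if q = p then \<one>\<^bsub>K\<^esub> else \<zero>\<^bsub>K\<^esub>"
      have e: "?e \<in> C t" using pS by (auto simp: C_def coord_space_def)
      have "\<Xi> t ?e = (\<Oplus>\<^bsub>pm_ob M t\<^esub>q\<in>{p}. ?e q \<odot>\<^bsub>pm_ob M t\<^esub> \<pi> t (v q))"
        unfolding \<Xi>_def
        by (rule finsum_superset[OF mM finS, symmetric]) (use pS x trm[OF e] in auto)
      also have "\<dots> = \<pi> t (v p)" using x[OF pS] by simp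
      finally show ?thesis using e by (metis image_eqI)
    qed
    \<comment> \<open>Elimination from the top rank downwards: subtracting \<open>w p\<close> times
      \<open>v p\<close> removes the leading coordinate of \<open>w\<close> and creates none of
      equal or higher rank.\<close>
    have claim: "\<pi> t w \<in> \<Xi> t ` C t" if "w \<in> V t" "\<forall>i. w i \<noteq> \<zero>\<^bsub>K\<^esub> \<longrightarrow> rk i < k" for w k
      using that
    proof (induction k arbitrary: w)
      case 0
      then have "w = (\<lambda>_. \<zero>\<^bsub>K\<^esub>)" by auto
      then show ?case using \<pi>0 subspace_zero[OF D] by simp
    next
      case (Suc k)
      note wV = Suc.prems(1)
      show ?case
      proof (cases "\<exists>p. w p \<noteq> \<zero>\<^bsub>K\<^esub> \<and> rk p = k")
        case False
        then have "\<forall>i. w i \<noteq> \<zero>\<^bsub>K\<^esub> \<longrightarrow> rk i < k" using Suc.prems(2) by (metis less_antisym)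
        then show ?thesis using Suc.IH[OF wV] by blast
      next
        case True
        then obtain p where p: "w p \<noteq> \<zero>\<^bsub>K\<^esub>" "rk p = k" by auto
        note pn = V0[OF wV p(1)]
        note vp = vV[OF pn]
        have vpp: "v p p = \<one>\<^bsub>K\<^esub>" "\<And>i. v p i \<noteq> \<zero>\<^bsub>K\<^esub> \<Longrightarrow> rk i \<le> k"
          using vlow[OF pn(1)] p by (auto simp: low_def)
        have c: "\<ominus>\<^bsub>K\<^esub> (w p) \<in> carrier K" "w p \<in> carrier K" using VK[OF wV] by auto
        let ?w = "\<lambda>i. w i \<oplus>\<^bsub>K\<^esub> (\<ominus>\<^bsub>K\<^esub> (w p)) \<otimes>\<^bsub>K\<^esub> v p i"
        have w'V: "?w \<in> V t" by (rule Vadd[OF wV Vsm[OF vp c(1)]])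
        have "rk i < k" if i: "?w i \<noteq> \<zero>\<^bsub>K\<^esub>" for i
        proof -
          have "i \<noteq> p" using i vpp c by (auto simp: K.r_neg)
          have "w i \<noteq> \<zero>\<^bsub>K\<^esub> \<or> v p i \<noteq> \<zero>\<^bsub>K\<^esub>" using i c by auto
          then have "rk i \<le> k" using Suc.prems(2) vpp(2) by auto
          moreover have "rk i \<noteq> k"
            using \<open>i \<noteq> p\<close> V0(1)[OF w'V i] pn(1) rk(1) p(2) by (auto simp: inj_on_def)
          ultimately show ?thesis by simp
        qed
        then have IH: "\<pi> t ?w \<in> \<Xi> t ` C t" using Suc.IH[OF w'V] by blast
        have "w = (\<lambda>i. ?w i \<oplus>\<^bsub>K\<^esub> w p \<otimes>\<^bsub>K\<^esub> v p i)"
          using VK[OF wV] VK[OF vp] by (simp add: K.a_assoc K.l_minus K.l_neg)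
        then have "\<pi> t w = \<pi> t ?w \<oplus>\<^bsub>pm_ob M t\<^esub> w p \<odot>\<^bsub>pm_ob M t\<^esub> \<pi> t (v p)"
          using \<pi>add[OF w'V Vsm[OF vp c(2)]] \<pi>sm[OF vp c(2)] by simp
        then show ?thesis
          using subspace_add[OF D IH subspace_smult[OF D c(2) xD[OF pn]]] by simp
      qed
    qed
    fix y assume "y \<in> carrier (pm_ob M t)"
    then obtain w where w: "w \<in> V t" "y = \<pi> t w" using \<pi>surj[of t] by auto
    obtain k where "\<forall>r\<in>rk ` {..<n}. r < k"
      using finite_nat_set_iff_bounded[of "rk ` {..<n}"] by auto
    then have "\<forall>i. w i \<noteq> \<zero>\<^bsub>K\<^esub> \<longrightarrow> rk i < k" using V0(1)[OF w(1)] by auto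
    then show "y \<in> \<Xi> t ` C t" using claim[OF w(1)] w(2) by simp
  qed
  show ?thesis
  proof (rule that[OF finI _ \<Xi>hom])
    show "ereal (a i) < \<beta> i" if "i \<in> I" for i using that by (simp add: I_def)
    show "bij_betw (\<Xi> t) (carrier (pm_ob (bars K I a \<beta>) t)) (carrier (pm_ob M t))" for t
    proof (rule bij_betw_imageI)
      show "inj_on (\<Xi> t) (carrier (pm_ob (bars K I a \<beta>) t))"
        using inj[of _ t]
        by (intro lin_maps_injI[OF bars_module[OF K finI] mM \<Xi>lin]) (simp add: CF bars_zero[OF K])
      show "\<Xi> t ` carrier (pm_ob (bars K I a \<beta>) t) = carrier (pm_ob M t)"
        using surj[of t] lin_maps_closed[OF \<Xi>lin, of _ t] by (auto simp: CF)
    qed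
  qed
qed


section \<open>Transition maps of projective persistence modules\<close>

text \<open>A projective module embeds into the free module on all its elements.\<close>

lemma projective_tr_inj:
  fixes K :: "('k, 'm) ring_scheme" and P :: "('k, 'p) persmod"
  assumes proj: "pm_projective K P" and st: "s \<le> t"
    and xy: "x \<in> carrier (pm_ob P s)" "y \<in> carrier (pm_ob P s)" "pm_tr P s t x = pm_tr P s t y"
  shows "x = y"
proof -
  have P: "persistence_module K P" using proj by (simp add: pm_projective_def)
  have K: "field K" using P by (simp add: persistence_module_def)
  have cK: "cring K" using P by (rule pm_cring)
  define S where "S t = {(r, x). r \<le> t \<and> x \<in> carrier (pm_ob P r)}" for t
  \<comment> \<open>A generator \<open>(r, x)\<close> is present from time \<open>r\<close> on, and
    the transition maps are inclusions. The type is the one that \<open>pm_projective\<close> fixes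
    for its test modules \<open>E\<close>.\<close>
  define E :: "('k, real \<times> 'p \<Rightarrow> 'k) persmod"
    where "E = \<lparr> pm_ob = (\<lambda>t. free_space K (S t)), pm_tr = (\<lambda>s t h. h) \<rparr>"
  have E_ob: "pm_ob E t = free_space K (S t)" and E_tr: "pm_tr E s t = (\<lambda>h. h)" for s t
    by (simp_all add: E_def)
  have incl: "(\<lambda>h. h) \<in> lin_maps K (free_space K (S s)) (free_space K (S t))" if "s \<le> t" for s t
  proof -
    have "S s \<subseteq> S t" using that by (auto simp: S_def)
    moreover have "\<zero>\<^bsub>K\<^esub> \<in> carrier K" using K by (simp add: cring.cring_simprules(2) cK)
    ultimately show ?thesis
      by (intro lin_mapsI) (auto simp: free_space_def subset_iff, metis)
  qed
  have E: "persistence_module K E"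
    by (intro persistence_module.intro persistence_module_axioms.intro K)
      (auto simp: E_ob E_tr incl free_module[OF cK])
  have "\<forall>t. \<exists>e. e \<in> lin_maps K (free_space K (S t)) (pm_ob P t) \<and>
      (\<forall>q\<in>S t. e (free_gen K q) = pm_tr P (fst q) t (snd q))"
  proof
    fix t
    have "pm_tr P (fst q) t (snd q) \<in> carrier (pm_ob P t)" if "q \<in> S t" for q
      using that lin_maps_closed[OF pm_tr_lin[OF P]] by (auto simp: S_def)
    then show "\<exists>e. e \<in> lin_maps K (free_space K (S t)) (pm_ob P t) \<and>
      (\<forall>q\<in>S t. e (free_gen K q) = pm_tr P (fst q) t (snd q))"
    proof (rule free_ext[OF cK pm_module[OF P]])
      fix f assume "f \<in> lin_maps K (free_space K (S t)) (pm_ob P t)"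
        "\<And>q. q \<in> S t \<Longrightarrow> f (free_gen K q) = pm_tr P (fst q) t (snd q)"
      then show ?thesis by (intro exI[of _ f]) simp
    qed
  qed
  from choice[OF this] obtain e where "\<forall>t. e t \<in> lin_maps K (free_space K (S t)) (pm_ob P t) \<and>
      (\<forall>q\<in>S t. e t (free_gen K q) = pm_tr P (fst q) t (snd q))"
    by (elim exE) (rule that)
  then have e: "e t \<in> lin_maps K (free_space K (S t)) (pm_ob P t)"
    and eg: "q \<in> S t \<Longrightarrow> e t (free_gen K q) = pm_tr P (fst q) t (snd q)" for t q
    by auto
  have e_hom: "e \<in> pm_homs K E P"
    unfolding pm_homs_def E_ob E_tr
  proof (intro CollectI conjI allI impI ballI e)
    fix s t :: real and h assume st: "s \<le> t" and h: "h \<in> carrier (free_space K (S s))"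
    note m = free_module[OF cK] pm_module[OF P]
    note l1 = lin_maps_comp[OF incl[OF st] e] and l2 = lin_maps_comp[OF e pm_tr_lin[OF P st]]
    have "h \<in> {h \<in> carrier (free_space K (S s)). e t h = pm_tr P s t (e s h)}"
    proof (rule free_induct[OF cK subspace_equalizer[OF m l1 l2] _ h])
      fix q assume q: "q \<in> S s"
      then have q': "q \<in> S t" using st by (auto simp: S_def)
      have "pm_tr P (fst q) t (snd q) = pm_tr P s t (pm_tr P (fst q) s (snd q))"
        using persistence_module.tr_trans[OF P _ st, of "fst q" "snd q"] q by (auto simp: S_def)
      then show "free_gen K q \<in> {h \<in> carrier (free_space K (S s)). e t h = pm_tr P s t (e s h)}"
        using q q' by (simp add: eg free_gen_closed[OF cK])
    qed
    then show "e t h = pm_tr P s t (e s h)" by simp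
  qed
  have e_epi: "pm_epi E P e"
    unfolding pm_epi_def E_ob
  proof (intro allI equalityI subsetI)
    fix t x assume "x \<in> e t ` carrier (free_space K (S t))"
    then show "x \<in> carrier (pm_ob P t)" using lin_maps_closed[OF e] by auto
  next
    fix t x assume x: "x \<in> carrier (pm_ob P t)"
    then have q: "(t, x) \<in> S t" by (simp add: S_def)
    have "e t (free_gen K (t, x)) = x"
      using eg[OF q] persistence_module.tr_refl[OF P x] by simp
    then show "x \<in> e t ` carrier (free_space K (S t))"
      using free_gen_closed[OF cK q] by (metis image_eqI)
  qed
  \<comment> \<open>Lifting the identity of \<open>P\<close> along \<open>e\<close> gives a section
    \<open>h\<close>, which embeds \<open>P\<close> into \<open>E\<close>.\<close>
  have "(\<lambda>_ x. x) \<in> pm_homs K P P"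
    by (auto simp: pm_homs_def lin_maps_id)
  then obtain h where h: "h \<in> pm_homs K P E" "\<And>t x. x \<in> carrier (pm_ob P t) \<Longrightarrow> e t (h t x) = x"
    using proj E P e_hom e_epi unfolding pm_projective_def by metis
  \<comment> \<open>Transition maps of \<open>E\<close> change nothing, so elements with the same
    image at \<open>t\<close> have the same lift already at \<open>s\<close>, and \<open>e\<close>
    recovers them from it.\<close>
  have "h s x = h t (pm_tr P s t x)" "h s y = h t (pm_tr P s t y)"
    using pm_homs_natural[OF h(1) st xy(1)] pm_homs_natural[OF h(1) st xy(2)] by (simp_all add: E_tr)
  then have "h s x = h s y" using xy(3) by simp
  then have "e s (h s x) = e s (h s y)" by (rule arg_cong)
  then show ?thesis unfolding h(2)[OF xy(1)] h(2)[OF xy(2)] .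
qed


section \<open>Tensoring with a sum of interval modules\<close>

definition unit_vec :: "('k, 'm) ring_scheme \<Rightarrow> 'i \<Rightarrow> 'i \<Rightarrow> 'k" where
  "unit_vec K i = (\<lambda>j. if j = i then \<one>\<^bsub>K\<^esub> else \<zero>\<^bsub>K\<^esub>)"

lemma bars_expand:
  assumes K: "field K" and I: "finite I" and h: "h \<in> coord_space K (alive I a b t)"
  shows "h = (\<Oplus>\<^bsub>pm_ob (bars K I a b) t\<^esub>i\<in>alive I a b t. h i \<odot>\<^bsub>pm_ob (bars K I a b) t\<^esub> unit_vec K i)"
proof -
  interpret K: field K by fact
  interpret B: module K "pm_ob (bars K I a b) t" by (rule bars_module[OF K I])
  let ?A = "alive I a b t" and ?B = "pm_ob (bars K I a b) t"
  have hK: "h i \<in> carrier K" for i using h by (simp add: coord_space_def)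
  have e: "unit_vec K i \<in> coord_space K ?A" if "i \<in> ?A" for i
    using that by (simp add: coord_space_def unit_vec_def)
  have he: "h i \<odot>\<^bsub>?B\<^esub> unit_vec K i = (\<lambda>j. h i \<otimes>\<^bsub>K\<^esub> unit_vec K i j)" if "i \<in> ?A" for i
    by (rule bars_smult[OF K e[OF that] hK])
  have "finite X \<Longrightarrow> X \<subseteq> ?A \<Longrightarrow>
      (\<Oplus>\<^bsub>?B\<^esub>i\<in>X. h i \<odot>\<^bsub>?B\<^esub> unit_vec K i) = (\<lambda>i. if i \<in> X then h i else \<zero>\<^bsub>K\<^esub>)" for X
  proof (induct rule: finite_induct)
    case empty
    then show ?case by (simp add: bars_zero[OF K])
  next
    case (insert k X)
    have k: "k \<in> ?A" "X \<subseteq> ?A" using insert by auto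
    have cl: "h i \<odot>\<^bsub>?B\<^esub> unit_vec K i \<in> carrier ?B" if "i \<in> ?A" for i
      by (rule B.smult_closed[OF hK]) (simp add: e[OF that] bars_carrier[OF K I])
    have "(\<Oplus>\<^bsub>?B\<^esub>i\<in>insert k X. h i \<odot>\<^bsub>?B\<^esub> unit_vec K i)
        = h k \<odot>\<^bsub>?B\<^esub> unit_vec K k \<oplus>\<^bsub>?B\<^esub> (\<Oplus>\<^bsub>?B\<^esub>i\<in>X. h i \<odot>\<^bsub>?B\<^esub> unit_vec K i)"
      using insert(1,2) k cl by (intro B.M.finsum_insert) auto
    also have "\<dots> = (\<lambda>j. h k \<otimes>\<^bsub>K\<^esub> unit_vec K k j \<oplus>\<^bsub>K\<^esub> (if j \<in> X then h j else \<zero>\<^bsub>K\<^esub>))"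
      unfolding insert(3)[OF k(2)] he[OF k(1)]
    proof (rule bars_add[OF K])
      show "(\<lambda>j. h k \<otimes>\<^bsub>K\<^esub> unit_vec K k j) \<in> coord_space K ?A"
        using k(1) hK by (auto simp: coord_space_def unit_vec_def)
      show "(\<lambda>i. if i \<in> X then h i else \<zero>\<^bsub>K\<^esub>) \<in> coord_space K ?A"
        using k(2) hK by (auto simp: coord_space_def)
    qed
    also have "\<dots> = (\<lambda>i. if i \<in> insert k X then h i else \<zero>\<^bsub>K\<^esub>)"
      using insert(2) hK by (auto simp: unit_vec_def fun_eq_iff)
    finally show ?case .
  qed
  from this[OF alive_finite[OF I] subset_refl] show ?thesis
    using h by (auto simp: coord_space_def fun_eq_iff)
qed

text \<open>The decomposition is carried as data rather than as mere existence:
  \<open>\<eta>\<close> supplies generators of \<open>N\<close>, and \<open>\<psi>\<close> the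
  coordinates of its elements.\<close>

locale bars_iso =
  fixes K :: "('k, 'm) ring_scheme" and N :: "('k, 'b) persmod"
    and J :: "'j set" and c :: "'j \<Rightarrow> real" and d :: "'j \<Rightarrow> ereal"
    and \<eta> :: "real \<Rightarrow> ('j \<Rightarrow> 'k) \<Rightarrow> 'b" and \<psi> :: "real \<Rightarrow> 'b \<Rightarrow> ('j \<Rightarrow> 'k)"
  assumes N: "persistence_module K N" and J: "finite J"
    and cd: "\<And>j. j \<in> J \<Longrightarrow> ereal (c j) < d j"
    and \<eta>: "\<eta> \<in> pm_homs K (bars K J c d) N" and \<psi>: "\<psi> \<in> pm_homs K N (bars K J c d)"
    and \<psi>\<eta>: "\<And>t h. h \<in> carrier (pm_ob (bars K J c d) t) \<Longrightarrow> \<psi> t (\<eta> t h) = h"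
    and \<eta>\<psi>: "\<And>t x. x \<in> carrier (pm_ob N t) \<Longrightarrow> \<eta> t (\<psi> t x) = x"
begin

lemma field_K: "field K"
  using N by (simp add: persistence_module_def)

sublocale K: field K by (rule field_K)

lemmas BC = bars_carrier[OF field_K J, of c d]

lemma \<psi>_coord: "w \<in> carrier (pm_ob N t) \<Longrightarrow> \<psi> t w \<in> coord_space K (alive J c d t)"
  using lin_maps_closed[OF pm_homs_lin[OF \<psi>]] by (simp add: BC)

lemma unit_coord: "j \<in> alive J c d t \<Longrightarrow> unit_vec K j \<in> coord_space K (alive J c d t)"
  by (simp add: coord_space_def unit_vec_def)

lemma birth_alive: "j \<in> J \<Longrightarrow> j \<in> alive J c d (c j)"
  using cd by (simp add: alive_def)

section \<open>Generators of \<open>N\<close> and expansion in them\<close>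

definition gen :: "'j \<Rightarrow> 'b" where "gen j = \<eta> (c j) (unit_vec K j)"

lemma gen_closed: "j \<in> J \<Longrightarrow> gen j \<in> carrier (pm_ob N (c j))"
  unfolding gen_def
  by (rule lin_maps_closed[OF pm_homs_lin[OF \<eta>]]) (simp add: BC unit_coord birth_alive)

lemma \<psi>_gen: "j \<in> J \<Longrightarrow> \<psi> (c j) (gen j) = unit_vec K j"
  unfolding gen_def by (rule \<psi>\<eta>) (simp add: BC unit_coord birth_alive)

lemma tr_gen:
  assumes "j \<in> J" "c j \<le> t"
  shows "pm_tr N (c j) t (gen j) = (if ereal t < d j then \<eta> t (unit_vec K j) else \<zero>\<^bsub>pm_ob N t\<^esub>)"
proof -
  have u: "unit_vec K j \<in> coord_space K (alive J c d (c j))"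
    using assms unit_coord birth_alive by simp
  have "pm_tr N (c j) t (gen j) = \<eta> t (pm_tr (bars K J c d) (c j) t (unit_vec K j))"
    unfolding gen_def using pm_homs_natural[OF \<eta> assms(2), of "unit_vec K j"] u by (simp add: BC)
  also have "pm_tr (bars K J c d) (c j) t (unit_vec K j)
      = (if ereal t < d j then unit_vec K j else (\<lambda>_. \<zero>\<^bsub>K\<^esub>))"
    using bars_tr[OF field_K u, of t] assms by (auto simp: unit_vec_def alive_def fun_eq_iff)
  finally show ?thesis
    using lin_maps_zero[OF bars_module[OF field_K J] pm_module[OF N] pm_homs_lin[OF \<eta>], of t]
    by (simp add: bars_zero[OF field_K])
qed

lemma expand:
  assumes w: "w \<in> carrier (pm_ob N t)"
  shows "w = (\<Oplus>\<^bsub>pm_ob N t\<^esub>j\<in>alive J c d t. \<psi> t w j \<odot>\<^bsub>pm_ob N t\<^esub> pm_tr N (c j) t (gen j))"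
proof -
  interpret Nt: module K "pm_ob N t" by (rule pm_module[OF N])
  let ?B = "pm_ob (bars K J c d) t" and ?A = "alive J c d t"
  interpret B: module K ?B by (rule bars_module[OF field_K J])
  note h = \<psi>_coord[OF w]
  have hK: "\<psi> t w j \<in> carrier K" for j using h by (simp add: coord_space_def)
  have cl: "unit_vec K j \<in> carrier ?B" if "j \<in> ?A" for j using unit_coord[OF that] by (simp add: BC)
  have "w = \<eta> t (\<psi> t w)" using \<eta>\<psi>[OF w] by simp
  also have "\<dots> = \<eta> t (\<Oplus>\<^bsub>?B\<^esub>j\<in>?A. \<psi> t w j \<odot>\<^bsub>?B\<^esub> unit_vec K j)"
    using bars_expand[OF field_K J h] by simp
  also have "\<dots> = (\<Oplus>\<^bsub>pm_ob N t\<^esub>j\<in>?A. \<eta> t (\<psi> t w j \<odot>\<^bsub>?B\<^esub> unit_vec K j))"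
    using cl hK
    by (intro lin_maps_finsum[OF B.module_axioms Nt.module_axioms pm_homs_lin[OF \<eta>] alive_finite[OF J]]) auto
  also have "\<dots> = (\<Oplus>\<^bsub>pm_ob N t\<^esub>j\<in>?A. \<psi> t w j \<odot>\<^bsub>pm_ob N t\<^esub> pm_tr N (c j) t (gen j))"
  proof (rule Nt.M.finsum_cong'[OF refl])
    have g: "pm_tr N (c j) t (gen j) = \<eta> t (unit_vec K j)" if "j \<in> ?A" for j
      using that tr_gen[of j t] by (simp add: alive_def)
    show "(\<lambda>j. \<psi> t w j \<odot>\<^bsub>pm_ob N t\<^esub> pm_tr N (c j) t (gen j)) \<in> ?A \<rightarrow> carrier (pm_ob N t)"
      using g hK lin_maps_closed[OF pm_homs_lin[OF \<eta>] cl] by auto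
    show "\<eta> t (\<psi> t w j \<odot>\<^bsub>?B\<^esub> unit_vec K j) = \<psi> t w j \<odot>\<^bsub>pm_ob N t\<^esub> pm_tr N (c j) t (gen j)"
      if "j \<in> ?A" for j
      using lin_maps_smult[OF pm_homs_lin[OF \<eta>] hK cl[OF that]] g[OF that] by simp
  qed
  finally show ?thesis .
qed

text \<open>The map from the direct sum of the \<open>P (s - c j)\<close> to
  \<open>(P \<otimes> N)(s)\<close> that sends a family to the sum of the tensors of
  \<open>p j\<close> with \<open>gen j\<close>. It turns out to be onto, and its kernel consists of
  the families with all entries dead; so \<open>(P \<otimes> N)(s)\<close> is the direct sum of the
  quotients of \<open>P (s - c j)\<close> by \<open>dead P s j\<close>.\<close>

definition gam :: "('k, 'p) persmod \<Rightarrow> real \<Rightarrow> ('j \<Rightarrow> 'p) \<Rightarrow> (real \<times> real \<Rightarrow> ('p \<times> 'b \<Rightarrow> 'k) set) set"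
  where "gam P s p = (\<Oplus>\<^bsub>pm_ob (pm_tensor K P N) s\<^esub>j\<in>J. ptens K P N s (s - c j) (c j) (p j) (gen j))"

text \<open>Entries outside \<open>J\<close> are left free, as \<open>gam\<close> reads only those
  in \<open>J\<close>.\<close>

definition fam :: "('k, 'p) persmod \<Rightarrow> real \<Rightarrow> ('j \<Rightarrow> 'p) set" where
  "fam P s = {p. \<forall>j\<in>J. p j \<in> carrier (pm_ob P (s - c j))}"

text \<open>What the death of generator \<open>j\<close> annihilates: the image of
  \<open>P (s - d j)\<close>, or zero alone if the bar is infinite.\<close>

definition dead :: "('k, 'p) persmod \<Rightarrow> real \<Rightarrow> 'j \<Rightarrow> 'p set" where
  "dead P s j = (if d j = \<infinity> then {\<zero>\<^bsub>pm_ob P (s - c j)\<^esub>}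
     else pm_tr P (s - real_of_ereal (d j)) (s - c j) ` carrier (pm_ob P (s - real_of_ereal (d j))))"

lemma famD: "p \<in> fam P s \<Longrightarrow> j \<in> J \<Longrightarrow> p j \<in> carrier (pm_ob P (s - c j))"
  by (simp add: fam_def)

lemma death_real: "j \<in> J \<Longrightarrow> d j \<noteq> \<infinity> \<Longrightarrow> d j = ereal (real_of_ereal (d j)) \<and> c j < real_of_ereal (d j)"
  using cd[of j] by (cases "d j") auto

lemma pt_closed:
  assumes "persistence_module K P" "p \<in> fam P s" "j \<in> J"
  shows "ptens K P N s (s - c j) (c j) (p j) (gen j) \<in> carrier (pm_ob (pm_tensor K P N) s)"
  by (rule ptens_closed[OF assms(1) N]) (use famD[OF assms(2,3)] gen_closed[OF assms(3)] in auto)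

lemma pt_lin:
  assumes "persistence_module K P" "j \<in> J"
  shows "(\<lambda>v. ptens K P N s (s - c j) (c j) v (gen j))
    \<in> lin_maps K (pm_ob P (s - c j)) (pm_ob (pm_tensor K P N) s)"
  by (rule bilinear_mapD(1)[OF ptens_bilinear[OF assms(1) N]]) (use gen_closed[OF assms(2)] in auto)

lemma gam_closed:
  assumes P: "persistence_module K P" and p: "p \<in> fam P s"
  shows "gam P s p \<in> carrier (pm_ob (pm_tensor K P N) s)"
proof -
  interpret T: module K "pm_ob (pm_tensor K P N) s" by (rule pm_tensor_module[OF P N])
  show ?thesis unfolding gam_def using pt_closed[OF P p] by (intro T.M.finsum_closed) auto
qed

lemma gam_add:
  assumes P: "persistence_module K P" and p: "p \<in> fam P s" and q: "q \<in> fam P s"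
  shows "gam P s (\<lambda>j. p j \<oplus>\<^bsub>pm_ob P (s - c j)\<^esub> q j)
    = gam P s p \<oplus>\<^bsub>pm_ob (pm_tensor K P N) s\<^esub> gam P s q"
proof -
  interpret T: module K "pm_ob (pm_tensor K P N) s" by (rule pm_tensor_module[OF P N])
  have "gam P s (\<lambda>j. p j \<oplus>\<^bsub>pm_ob P (s - c j)\<^esub> q j)
    = (\<Oplus>\<^bsub>pm_ob (pm_tensor K P N) s\<^esub>j\<in>J. ptens K P N s (s - c j) (c j) (p j) (gen j)
        \<oplus>\<^bsub>pm_ob (pm_tensor K P N) s\<^esub> ptens K P N s (s - c j) (c j) (q j) (gen j))"
    unfolding gam_def using pt_closed[OF P p] pt_closed[OF P q]
      lin_maps_add[OF pt_lin[OF P] famD[OF p] famD[OF q]]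
    by (intro T.M.finsum_cong') auto
  also have "\<dots> = gam P s p \<oplus>\<^bsub>pm_ob (pm_tensor K P N) s\<^esub> gam P s q"
    unfolding gam_def using pt_closed[OF P p] pt_closed[OF P q] by (intro T.M.finsum_addf) auto
  finally show ?thesis .
qed

lemma gam_smult:
  assumes P: "persistence_module K P" and p: "p \<in> fam P s" and k: "k \<in> carrier K"
  shows "gam P s (\<lambda>j. k \<odot>\<^bsub>pm_ob P (s - c j)\<^esub> p j) = k \<odot>\<^bsub>pm_ob (pm_tensor K P N) s\<^esub> gam P s p"
proof -
  interpret T: module K "pm_ob (pm_tensor K P N) s" by (rule pm_tensor_module[OF P N])
  have "gam P s (\<lambda>j. k \<odot>\<^bsub>pm_ob P (s - c j)\<^esub> p j)
    = (\<Oplus>\<^bsub>pm_ob (pm_tensor K P N) s\<^esub>j\<in>J. k \<odot>\<^bsub>pm_ob (pm_tensor K P N) s\<^esub>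
        ptens K P N s (s - c j) (c j) (p j) (gen j))"
    unfolding gam_def using pt_closed[OF P p] k lin_maps_smult[OF pt_lin[OF P] k famD[OF p]]
    by (intro T.M.finsum_cong') auto
  also have "\<dots> = k \<odot>\<^bsub>pm_ob (pm_tensor K P N) s\<^esub> gam P s p"
    unfolding gam_def using pt_closed[OF P p] k by (intro T.finsum_smult_ldistr[symmetric] J) auto
  finally show ?thesis .
qed

lemma fam_add:
  "persistence_module K P \<Longrightarrow> p \<in> fam P s \<Longrightarrow> q \<in> fam P s \<Longrightarrow>
    (\<lambda>j. p j \<oplus>\<^bsub>pm_ob P (s - c j)\<^esub> q j) \<in> fam P s"
  by (simp add: fam_def abelian_groupE(1)[OF module.axioms(2)[OF pm_module]])

lemma fam_smult:
  "persistence_module K P \<Longrightarrow> p \<in> fam P s \<Longrightarrow> k \<in> carrier K \<Longrightarrow>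
    (\<lambda>j. k \<odot>\<^bsub>pm_ob P (s - c j)\<^esub> p j) \<in> fam P s"
  by (simp add: fam_def module.smult_closed[OF pm_module])

lemma fam_zero: "persistence_module K P \<Longrightarrow> (\<lambda>j. \<zero>\<^bsub>pm_ob P (s - c j)\<^esub>) \<in> fam P s"
  by (simp add: fam_def abelian_groupE(2)[OF module.axioms(2)[OF pm_module]])

lemma fam_hom:
  "\<phi> \<in> pm_homs K P P' \<Longrightarrow> p \<in> fam P s \<Longrightarrow> (\<lambda>j. \<phi> (s - c j) (p j)) \<in> fam P' s"
  by (simp add: fam_def lin_maps_closed[OF pm_homs_lin])

lemma fam_tr:
  "persistence_module K P \<Longrightarrow> s \<le> t \<Longrightarrow> p \<in> fam P s \<Longrightarrow> (\<lambda>j. pm_tr P (s - c j) (t - c j) (p j)) \<in> fam P t"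
  by (simp add: fam_def lin_maps_closed[OF pm_tr_lin])

lemma dead_subspace:
  assumes P: "persistence_module K P" and j: "j \<in> J"
  shows "submodule (dead P s j) K (pm_ob P (s - c j))"
proof (cases "d j = \<infinity>")
  case True
  interpret Ps: module K "pm_ob P (s - c j)" by (rule pm_module[OF P])
  show ?thesis using True by (auto simp: dead_def intro!: subspaceI Ps.module_axioms)
next
  case False
  note m = pm_module[OF P]
  have "pm_tr P (s - real_of_ereal (d j)) (s - c j)
    \<in> lin_maps K (pm_ob P (s - real_of_ereal (d j))) (pm_ob P (s - c j))"
    using death_real[OF j False] by (intro pm_tr_lin[OF P]) simp
  from subspace_image[OF m m this module.carrier_is_submodule[OF m]]
  show ?thesis using False by (simp add: dead_def)
qed

text \<open>A vector coming from \<open>P (s - e)\<close> is pulled back there, and the generator is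
  moved from its birth to its death time \<open>e\<close> instead, where it is zero. Both moves are
  colimit relations.\<close>

lemma pt_dead:
  assumes P: "persistence_module K P" and j: "j \<in> J" and v: "v \<in> dead P s j"
  shows "ptens K P N s (s - c j) (c j) v (gen j) = \<zero>\<^bsub>pm_ob (pm_tensor K P N) s\<^esub>"
proof (cases "d j = \<infinity>")
  case True
  then show ?thesis
    using v lin_maps_zero[OF pm_module[OF P] pm_tensor_module[OF P N] pt_lin[OF P j]]
    by (simp add: dead_def)
next
  case False
  define e where "e = real_of_ereal (d j)"
  have e: "d j = ereal e" "c j \<le> e" using death_real[OF j False] by (simp_all add: e_def)
  obtain q where q: "q \<in> carrier (pm_ob P (s - e))" "v = pm_tr P (s - e) (s - c j) q"
    using v False by (auto simp: dead_def e_def)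
  have "ptens K P N s (s - c j) (c j) (pm_tr P (s - e) (s - c j) q) (pm_tr N (c j) (c j) (gen j))
      = ptens K P N s (s - e) (c j) q (gen j)"
    using e by (intro ptens_trans[OF P N _ _ _ q(1) gen_closed[OF j]]) auto
  also have "\<dots> = ptens K P N s (s - e) e (pm_tr P (s - e) (s - e) q) (pm_tr N (c j) e (gen j))"
    using e by (intro ptens_trans[OF P N _ _ _ q(1) gen_closed[OF j], symmetric]) auto
  also have "\<dots> = ptens K P N s (s - e) e q \<zero>\<^bsub>pm_ob N e\<^esub>"
    using tr_gen[OF j e(2)] e persistence_module.tr_refl[OF P q(1)] by simp
  also have "\<dots> = \<zero>\<^bsub>pm_ob (pm_tensor K P N) s\<^esub>"
    by (rule lin_maps_zero[OF pm_module[OF N] pm_tensor_module[OF P N]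
          bilinear_mapD(2)[OF ptens_bilinear[OF P N] q(1)]]) simp
  finally show ?thesis
    using persistence_module.tr_refl[OF N gen_closed[OF j]] q(2) by simp
qed

lemma gam_dead:
  assumes P: "persistence_module K P" and p: "\<And>j. j \<in> J \<Longrightarrow> p j \<in> dead P s j"
  shows "gam P s p = \<zero>\<^bsub>pm_ob (pm_tensor K P N) s\<^esub>"
proof -
  interpret T: module K "pm_ob (pm_tensor K P N) s" by (rule pm_tensor_module[OF P N])
  have "gam P s p = (\<Oplus>\<^bsub>pm_ob (pm_tensor K P N) s\<^esub>j\<in>J. \<zero>\<^bsub>pm_ob (pm_tensor K P N) s\<^esub>)"
    unfolding gam_def using pt_dead[OF P _ p] by (intro T.M.finsum_cong') auto
  then show ?thesis by simp
qed

text \<open>The entry \<open>p k\<close> is recovered from the tensor by a linear map to the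
  quotient of \<open>P (s - c k)\<close> by its dead part, obtained from the universal property of
  the colimit.\<close>

lemma gam_kernel:
  assumes P: "persistence_module K P" and p: "p \<in> fam P s"
    and zero: "gam P s p = \<zero>\<^bsub>pm_ob (pm_tensor K P N) s\<^esub>" and k: "k \<in> J"
  shows "p k \<in> dead P s k"
proof -
  define Pk where "Pk = pm_ob P (s - c k)"
  define Q where "Q = quot_space Pk (dead P s k)"
  have mP: "module K Pk" unfolding Pk_def by (rule pm_module[OF P])
  have D: "submodule (dead P s k) K Pk" unfolding Pk_def by (rule dead_subspace[OF P k])
  have mQ: "module K Q" unfolding Q_def by (rule quot_module[OF mP D])
  interpret Pk: module K Pk by (rule mP)
  interpret Q: module K Q by (rule mQ)
  note mT = pm_tensor_module[OF P N, of s]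
  \<comment> \<open>The coordinate of \<open>w\<close> at \<open>k\<close> times \<open>v\<close>
    moved to time \<open>s - c k\<close>. For \<open>s2 < c k\<close> that coordinate is zero and
    the move might go backwards in time, hence the default.\<close>
  define \<beta>0 where "\<beta>0 s1 s2 v w = (if c k \<le> s2 then \<psi> s2 w k \<odot>\<^bsub>Pk\<^esub> pm_tr P s1 (s - c k) v else \<zero>\<^bsub>Pk\<^esub>)"
    for s1 s2 v w
  define \<beta> where "\<beta> s1 s2 v w = dead P s k +>\<^bsub>Pk\<^esub> \<beta>0 s1 s2 v w" for s1 s2 v w
  have \<psi>K: "\<psi> t w j \<in> carrier K" if "w \<in> carrier (pm_ob N t)" for t w j
    using \<psi>_coord[OF that] by (simp add: coord_space_def)
  have trl: "pm_tr P s1 (s - c k) \<in> lin_maps K (pm_ob P s1) Pk" if "s1 \<le> s - c k" for s1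
    unfolding Pk_def by (rule pm_tr_lin[OF P that])
  have bil0: "bilinear_map K (pm_ob P s1) (pm_ob N s2) Pk (\<beta>0 s1 s2)" if s12: "s1 + s2 \<le> s" for s1 s2
  proof (cases "c k \<le> s2")
    case False
    then show ?thesis
      by (auto simp: bilinear_map_def \<beta>0_def intro!: lin_mapsI)
  next
    case True
    then have s1: "s1 \<le> s - c k" using s12 by simp
    note cl = lin_maps_closed[OF trl[OF s1]]
    note \<psi>l = pm_homs_lin[OF \<psi>, of s2]
    have \<psi>a: "\<psi> s2 (w \<oplus>\<^bsub>pm_ob N s2\<^esub> w') k = \<psi> s2 w k \<oplus>\<^bsub>K\<^esub> \<psi> s2 w' k"
      if "w \<in> carrier (pm_ob N s2)" "w' \<in> carrier (pm_ob N s2)" for w w'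
      using lin_maps_add[OF \<psi>l that] bars_add[OF field_K \<psi>_coord[OF that(1)] \<psi>_coord[OF that(2)]]
      by simp
    have \<psi>s: "\<psi> s2 (x \<odot>\<^bsub>pm_ob N s2\<^esub> w) k = x \<otimes>\<^bsub>K\<^esub> \<psi> s2 w k"
      if "w \<in> carrier (pm_ob N s2)" "x \<in> carrier K" for w x
      using lin_maps_smult[OF \<psi>l that(2,1)] bars_smult[OF field_K \<psi>_coord[OF that(1)] that(2)]
      by simp
    show ?thesis
      unfolding bilinear_map_def
    proof (intro conjI ballI)
      show "(\<lambda>v. \<beta>0 s1 s2 v w) \<in> lin_maps K (pm_ob P s1) Pk" if w: "w \<in> carrier (pm_ob N s2)" for w
        using True \<psi>K[OF w]
        by (intro lin_mapsI) (simp_all add: \<beta>0_def cl lin_maps_add[OF trl[OF s1]]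
            lin_maps_smult[OF trl[OF s1]] Pk.smult_r_distr Pk.smult_assoc1[symmetric] K.m_comm)
      show "\<beta>0 s1 s2 v \<in> lin_maps K (pm_ob N s2) Pk" if v: "v \<in> carrier (pm_ob P s1)" for v
        using True cl[OF v] \<psi>K
        by (intro lin_mapsI) (simp_all add: \<beta>0_def \<psi>a \<psi>s Pk.smult_l_distr Pk.smult_assoc1)
    qed
  qed
  have bil: "bilinear_map K (pm_ob P s1) (pm_ob N s2) Q (\<beta> s1 s2)" if s12: "s1 + s2 \<le> s" for s1 s2
    unfolding \<beta>_def Q_def by (rule bilinear_map_comp[OF bil0[OF s12] quot_proj[OF mP D]])
  \<comment> \<open>Compatibility holds only modulo the dead part. If bar \<open>k\<close> has ended
    by \<open>t2\<close>, at time \<open>e\<close> say, its coordinate is lost on the left; but then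
    \<open>s1 \<le> s - e\<close>, so the value on the right factors through
    \<open>P (s - e)\<close> and is dead.\<close>
  have comp: "\<beta> t1 t2 (pm_tr P s1 t1 v) (pm_tr N s2 t2 w) = \<beta> s1 s2 v w"
    if st: "s1 \<le> t1" "s2 \<le> t2" "t1 + t2 \<le> s" and v: "v \<in> carrier (pm_ob P s1)"
      and w: "w \<in> carrier (pm_ob N s2)" for s1 s2 t1 t2 v w
  proof (cases "c k \<le> t2")
    case False
    then show ?thesis using st by (simp add: \<beta>_def \<beta>0_def)
  next
    case True
    then have t1: "t1 \<le> s - c k" using st by simp
    have \<psi>t: "\<psi> t2 (pm_tr N s2 t2 w) k = (if k \<in> alive J c d t2 then \<psi> s2 w k else \<zero>\<^bsub>K\<^esub>)"
      using pm_homs_natural[OF \<psi> st(2) w] bars_tr[OF field_K \<psi>_coord[OF w], of t2] by simp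
    have trv: "pm_tr P t1 (s - c k) (pm_tr P s1 t1 v) = pm_tr P s1 (s - c k) v"
      by (rule persistence_module.tr_trans[OF P st(1) t1 v])
    have cl: "pm_tr P s1 (s - c k) v \<in> carrier Pk"
      using st t1 by (intro lin_maps_closed[OF trl _] v) simp
    have L: "\<beta>0 t1 t2 (pm_tr P s1 t1 v) (pm_tr N s2 t2 w)
        = (if k \<in> alive J c d t2 then \<psi> s2 w k \<odot>\<^bsub>Pk\<^esub> pm_tr P s1 (s - c k) v else \<zero>\<^bsub>Pk\<^esub>)"
      using True cl by (simp add: \<beta>0_def \<psi>t trv)
    show ?thesis
    proof (cases "c k \<le> s2")
      case False
      then have "k \<notin> alive J c d s2" by (simp add: alive_def)
      then have "\<psi> s2 w k = \<zero>\<^bsub>K\<^esub>" using \<psi>_coord[OF w] by (simp add: coord_space_def)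
      then show ?thesis using False cl by (simp add: \<beta>_def L) (simp add: \<beta>0_def)
    next
      case s2: True
      have R: "\<beta>0 s1 s2 v w = \<psi> s2 w k \<odot>\<^bsub>Pk\<^esub> pm_tr P s1 (s - c k) v"
        using s2 by (simp add: \<beta>0_def)
      show ?thesis
      proof (cases "k \<in> alive J c d t2")
        case True
        then show ?thesis by (simp add: \<beta>_def L R)
      next
        case False
        define e where "e = real_of_ereal (d k)"
        have fin: "d k \<noteq> \<infinity>" using False True k by (auto simp: alive_def)
        have e: "d k = ereal e" "c k < e" using death_real[OF k fin] by (simp_all add: e_def)
        have et: "e \<le> t2" using False True k e by (simp add: alive_def)
        then have s1: "s1 \<le> s - e" "s - e \<le> s - c k" using st e by simp_all
        have "pm_tr P s1 (s - c k) v = pm_tr P (s - e) (s - c k) (pm_tr P s1 (s - e) v)"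
          by (rule persistence_module.tr_trans[OF P s1 v, symmetric])
        then have "pm_tr P s1 (s - c k) v \<in> dead P s k"
          using fin lin_maps_closed[OF pm_tr_lin[OF P s1(1)] v] by (simp add: dead_def e_def)
        then have "\<beta>0 s1 s2 v w \<in> dead P s k"
          unfolding R by (intro subspace_smult[OF D \<psi>K[OF w]])
        then have "dead P s k +>\<^bsub>Pk\<^esub> \<zero>\<^bsub>Pk\<^esub> = dead P s k +>\<^bsub>Pk\<^esub> \<beta>0 s1 s2 v w"
          using subspace_minus[OF mP D subspace_zero[OF D]] subspace_subset[OF D]
          by (subst coset_eq_iff[OF mP D]) auto
        then show ?thesis using False by (simp add: \<beta>_def L)
      qed
    qed
  qed
  obtain f where f: "f \<in> lin_maps K (pm_ob (pm_tensor K P N) s) Q"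
    and fp: "\<And>s1 s2 v w. s1 + s2 \<le> s \<Longrightarrow> v \<in> carrier (pm_ob P s1) \<Longrightarrow> w \<in> carrier (pm_ob N s2) \<Longrightarrow>
      f (ptens K P N s s1 s2 v w) = \<beta> s1 s2 v w"
    by (rule pm_tensor_ext[where M = P and \<beta> = \<beta>, OF P N mQ bil comp]) auto
  have Q0: "dead P s k +>\<^bsub>Pk\<^esub> \<zero>\<^bsub>Pk\<^esub> = \<zero>\<^bsub>Q\<^esub>" unfolding Q_def by (rule quot_zero[OF mP D, symmetric])
  \<comment> \<open>On the summand \<open>j\<close> the map reads the coordinate of
    \<open>gen j\<close> at \<open>k\<close>, so only \<open>j = k\<close> survives.\<close>
  have val: "f (ptens K P N s (s - c j) (c j) (p j) (gen j))
      = (if j = k then dead P s k +>\<^bsub>Pk\<^esub> p k else \<zero>\<^bsub>Q\<^esub>)" if j: "j \<in> J" for j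
  proof -
    have "f (ptens K P N s (s - c j) (c j) (p j) (gen j)) = \<beta> (s - c j) (c j) (p j) (gen j)"
      using famD[OF p j] gen_closed[OF j] by (intro fp) auto
    also have "\<dots> = (if j = k then dead P s k +>\<^bsub>Pk\<^esub> p k else \<zero>\<^bsub>Q\<^esub>)"
    proof (cases "j = k")
      case True
      have pk: "p k \<in> carrier Pk" using famD[OF p k] by (simp add: Pk_def)
      then show ?thesis
        using True \<psi>_gen[OF k] persistence_module.tr_refl[OF P, of "p k" "s - c k"]
        by (simp add: \<beta>_def \<beta>0_def unit_vec_def Pk_def[symmetric])
    next
      case False
      have "\<beta>0 (s - c j) (c j) (p j) (gen j) = \<zero>\<^bsub>Pk\<^esub>"
        using False \<psi>_gen[OF j] lin_maps_closed[OF trl famD[OF p j]]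
        by (auto simp: \<beta>0_def unit_vec_def)
      then show ?thesis using False Q0 by (simp add: \<beta>_def)
    qed
    finally show ?thesis .
  qed
  have pkQ: "dead P s k +>\<^bsub>Pk\<^esub> p k \<in> carrier Q"
    using famD[OF p k] by (auto simp: Q_def quot_carrier Pk_def)
  have "f (gam P s p) = (\<Oplus>\<^bsub>Q\<^esub>j\<in>J. f (ptens K P N s (s - c j) (c j) (p j) (gen j)))"
    unfolding gam_def using pt_closed[OF P p] by (intro lin_maps_finsum[OF mT mQ f J]) auto
  also have "\<dots> = (\<Oplus>\<^bsub>Q\<^esub>j\<in>{k}. f (ptens K P N s (s - c j) (c j) (p j) (gen j)))"
    by (rule finsum_superset[OF mQ J, symmetric]) (use k val pkQ in auto)
  also have "\<dots> = dead P s k +>\<^bsub>Pk\<^esub> p k"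
    using val[OF k] pkQ by simp
  finally have "dead P s k +>\<^bsub>Pk\<^esub> p k = dead P s k +>\<^bsub>Pk\<^esub> \<zero>\<^bsub>Pk\<^esub>"
    using zero lin_maps_zero[OF mT mQ f] Q0 by simp
  then have "p k \<ominus>\<^bsub>Pk\<^esub> \<zero>\<^bsub>Pk\<^esub> \<in> dead P s k"
    using famD[OF p k] by (subst (asm) coset_eq_iff[OF mP D]) (auto simp: Pk_def[symmetric])
  moreover have "p k \<ominus>\<^bsub>Pk\<^esub> \<zero>\<^bsub>Pk\<^esub> = p k"
    using famD[OF p k] by (simp add: a_minus_def Pk_def[symmetric])
  ultimately show ?thesis by simp
qed

text \<open>The difference of the families is written with the scalar minus one, so that additivity
  and homogeneity of \<open>gam\<close> apply.\<close>

lemma gam_eqI: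
  assumes P: "persistence_module K P" and p: "p \<in> fam P s" and q: "q \<in> fam P s"
    and "\<And>j. j \<in> J \<Longrightarrow> p j \<ominus>\<^bsub>pm_ob P (s - c j)\<^esub> q j \<in> dead P s j"
  shows "gam P s p = gam P s q"
proof -
  interpret T: module K "pm_ob (pm_tensor K P N) s" by (rule pm_tensor_module[OF P N])
  have m1: "\<ominus>\<^bsub>K\<^esub> \<one>\<^bsub>K\<^esub> \<in> carrier K" by simp
  let ?r = "\<lambda>j. p j \<oplus>\<^bsub>pm_ob P (s - c j)\<^esub> (\<ominus>\<^bsub>K\<^esub> \<one>\<^bsub>K\<^esub>) \<odot>\<^bsub>pm_ob P (s - c j)\<^esub> q j"
  have "gam P s ?r = \<zero>\<^bsub>pm_ob (pm_tensor K P N) s\<^esub>"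
    using assms(4) module_minus_eq[OF pm_module[OF P] famD[OF p] famD[OF q]]
    by (intro gam_dead[OF P]) simp
  then have "gam P s p \<ominus>\<^bsub>pm_ob (pm_tensor K P N) s\<^esub> gam P s q = \<zero>\<^bsub>pm_ob (pm_tensor K P N) s\<^esub>"
    using gam_add[OF P p fam_smult[OF P q m1]] gam_smult[OF P q m1]
      module_minus_eq[OF T.module_axioms gam_closed[OF P p] gam_closed[OF P q]] by simp
  then show ?thesis
    by (rule module_minus_eq_zeroD[OF T.module_axioms gam_closed[OF P p] gam_closed[OF P q]])
qed

lemma gam_eqD:
  assumes P: "persistence_module K P" and p: "p \<in> fam P s" and q: "q \<in> fam P s"
    and eq: "gam P s p = gam P s q" and j: "j \<in> J"
  shows "p j \<ominus>\<^bsub>pm_ob P (s - c j)\<^esub> q j \<in> dead P s j"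
proof -
  interpret T: module K "pm_ob (pm_tensor K P N) s" by (rule pm_tensor_module[OF P N])
  have m1: "\<ominus>\<^bsub>K\<^esub> \<one>\<^bsub>K\<^esub> \<in> carrier K" by simp
  let ?r = "\<lambda>j. p j \<oplus>\<^bsub>pm_ob P (s - c j)\<^esub> (\<ominus>\<^bsub>K\<^esub> \<one>\<^bsub>K\<^esub>) \<odot>\<^bsub>pm_ob P (s - c j)\<^esub> q j"
  have "gam P s ?r = gam P s p \<ominus>\<^bsub>pm_ob (pm_tensor K P N) s\<^esub> gam P s q"
    using gam_add[OF P p fam_smult[OF P q m1]] gam_smult[OF P q m1]
      module_minus_eq[OF T.module_axioms gam_closed[OF P p] gam_closed[OF P q]] by simp
  then have "gam P s ?r = \<zero>\<^bsub>pm_ob (pm_tensor K P N) s\<^esub>"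
    using eq module_minus_self[OF T.module_axioms gam_closed[OF P q]] by simp
  from gam_kernel[OF P fam_add[OF P p fam_smult[OF P q m1]] this j]
  show ?thesis
    using module_minus_eq[OF pm_module[OF P] famD[OF p j] famD[OF q j]] by simp
qed

text \<open>The image is a subspace, so pure tensors suffice. There \<open>w\<close> is expanded in
  the generators alive at \<open>s2\<close>, and each resulting tensor of \<open>v\<close> with a
  generator is slid to the position \<open>(s - c j, c j)\<close>.\<close>

lemma gam_surj:
  assumes P: "persistence_module K P" and z: "z \<in> carrier (pm_ob (pm_tensor K P N) s)"
  shows "\<exists>p\<in>fam P s. z = gam P s p"
proof -
  define T where "T = pm_ob (pm_tensor K P N) s"
  have mT: "module K T" unfolding T_def by (rule pm_tensor_module[OF P N])
  interpret T: module K T by (rule mT)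
  have H: "submodule (gam P s ` fam P s) K T"
  proof (rule subspaceI[OF mT])
    show "gam P s ` fam P s \<subseteq> carrier T" using gam_closed[OF P] by (auto simp: T_def)
    have "gam P s (\<lambda>j. \<zero>\<^bsub>pm_ob P (s - c j)\<^esub>) = \<zero>\<^bsub>T\<^esub>"
      unfolding T_def using subspace_zero[OF dead_subspace[OF P]] by (intro gam_dead[OF P]) auto
    from this[symmetric] fam_zero[OF P, of s] show "\<zero>\<^bsub>T\<^esub> \<in> gam P s ` fam P s" by (rule image_eqI)
    show "x \<oplus>\<^bsub>T\<^esub> y \<in> gam P s ` fam P s" if xy: "x \<in> gam P s ` fam P s" "y \<in> gam P s ` fam P s" for x y
    proof -
      obtain p q where pq: "p \<in> fam P s" "x = gam P s p" "q \<in> fam P s" "y = gam P s q"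
        using xy by auto
      have "x \<oplus>\<^bsub>T\<^esub> y = gam P s (\<lambda>j. p j \<oplus>\<^bsub>pm_ob P (s - c j)\<^esub> q j)"
        using gam_add[OF P pq(1,3)] pq by (simp add: T_def)
      then show ?thesis using fam_add[OF P pq(1,3)] by (rule image_eqI)
    qed
    show "k \<odot>\<^bsub>T\<^esub> x \<in> gam P s ` fam P s" if k: "k \<in> carrier K" and x: "x \<in> gam P s ` fam P s" for k x
    proof -
      obtain p where p: "p \<in> fam P s" "x = gam P s p" using x by auto
      have "k \<odot>\<^bsub>T\<^esub> x = gam P s (\<lambda>j. k \<odot>\<^bsub>pm_ob P (s - c j)\<^esub> p j)"
        using gam_smult[OF P p(1) k] p by (simp add: T_def)
      then show ?thesis using fam_smult[OF P p(1) k] by (rule image_eqI)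
    qed
  qed
  have pure: "ptens K P N s s1 s2 v w \<in> gam P s ` fam P s"
    if s12: "s1 + s2 \<le> s" and v: "v \<in> carrier (pm_ob P s1)" and w: "w \<in> carrier (pm_ob N s2)"
    for s1 s2 v w
  proof -
    let ?A = "alive J c d s2"
    have AJ: "?A \<subseteq> J" by (auto simp: alive_def)
    define p where "p j = (if j \<in> ?A then \<psi> s2 w j \<odot>\<^bsub>pm_ob P (s - c j)\<^esub> pm_tr P s1 (s - c j) v
        else \<zero>\<^bsub>pm_ob P (s - c j)\<^esub>)" for j
    have \<psi>K: "\<psi> s2 w j \<in> carrier K" for j
      using \<psi>_coord[OF w] by (simp add: coord_space_def)
    have cs: "c j \<le> s2" "s1 \<le> s - c j" if "j \<in> ?A" for j
      using that s12 by (auto simp: alive_def)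
    have trv: "pm_tr P s1 (s - c j) v \<in> carrier (pm_ob P (s - c j))" if "j \<in> ?A" for j
      by (rule lin_maps_closed[OF pm_tr_lin[OF P cs(2)[OF that]] v])
    have p: "p \<in> fam P s"
      unfolding fam_def p_def
      using module.smult_closed[OF pm_module[OF P] \<psi>K trv]
        abelian_groupE(2)[OF module.axioms(2)[OF pm_module[OF P]]] by auto
    have trg: "pm_tr N (c j) s2 (gen j) \<in> carrier (pm_ob N s2)" if "j \<in> ?A" for j
      using that AJ by (intro lin_maps_closed[OF pm_tr_lin[OF N cs(1)[OF that]] gen_closed]) auto
    note lw = bilinear_mapD(2)[OF ptens_bilinear[OF P N s12] v]
    have "ptens K P N s s1 s2 v w
      = ptens K P N s s1 s2 v (\<Oplus>\<^bsub>pm_ob N s2\<^esub>j\<in>?A. \<psi> s2 w j \<odot>\<^bsub>pm_ob N s2\<^esub> pm_tr N (c j) s2 (gen j))"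
      using expand[OF w] by simp
    also have "\<dots> = (\<Oplus>\<^bsub>T\<^esub>j\<in>?A. ptens K P N s s1 s2 v (\<psi> s2 w j \<odot>\<^bsub>pm_ob N s2\<^esub> pm_tr N (c j) s2 (gen j)))"
      unfolding T_def
      using module.smult_closed[OF pm_module[OF N] \<psi>K trg]
      by (intro lin_maps_finsum[OF pm_module[OF N] pm_tensor_module[OF P N] lw alive_finite[OF J]]) auto
    also have "\<dots> = (\<Oplus>\<^bsub>T\<^esub>j\<in>?A. ptens K P N s (s - c j) (c j) (p j) (gen j))"
    proof (rule T.M.finsum_cong'[OF refl])
      show "(\<lambda>j. ptens K P N s (s - c j) (c j) (p j) (gen j)) \<in> ?A \<rightarrow> carrier T"
        using pt_closed[OF P p] AJ by (auto simp: T_def)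
      fix j assume j: "j \<in> ?A"
      then have jJ: "j \<in> J" using AJ by auto
      note g = gen_closed[OF jJ]
      \<comment> \<open>The generator is pulled back to its birth time, and \<open>v\<close> is
        pushed forward into the room this leaves below \<open>s\<close>.\<close>
      have "ptens K P N s s1 s2 v (pm_tr N (c j) s2 (gen j))
          = ptens K P N s s1 s2 (pm_tr P s1 s1 v) (pm_tr N (c j) s2 (gen j))"
        using persistence_module.tr_refl[OF P v] by simp
      also have "\<dots> = ptens K P N s s1 (c j) v (gen j)"
        using cs[OF j] s12 by (intro ptens_trans[OF P N _ _ _ v g]) auto
      also have "\<dots> = ptens K P N s (s - c j) (c j) (pm_tr P s1 (s - c j) v) (pm_tr N (c j) (c j) (gen j))"
        using cs[OF j] by (intro ptens_trans[OF P N _ _ _ v g, symmetric]) auto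
      also have "\<dots> = ptens K P N s (s - c j) (c j) (pm_tr P s1 (s - c j) v) (gen j)"
        using persistence_module.tr_refl[OF N g] by simp
      finally show "ptens K P N s s1 s2 v (\<psi> s2 w j \<odot>\<^bsub>pm_ob N s2\<^esub> pm_tr N (c j) s2 (gen j))
          = ptens K P N s (s - c j) (c j) (p j) (gen j)"
        using j lin_maps_smult[OF lw \<psi>K trg[OF j]] lin_maps_smult[OF pt_lin[OF P jJ] \<psi>K trv[OF j]]
        by (simp add: p_def)
    qed
    also have "\<dots> = gam P s p"
      unfolding gam_def T_def[symmetric]
    proof (rule finsum_superset[OF mT J AJ])
      fix j assume j: "j \<in> J - ?A"
      then have "p j \<in> dead P s j"
        using subspace_zero[OF dead_subspace[OF P]] by (simp add: p_def)
      then show "ptens K P N s (s - c j) (c j) (p j) (gen j) = \<zero>\<^bsub>T\<^esub>"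
        unfolding T_def using j by (intro pt_dead[OF P]) auto
    qed (use pt_closed[OF P p] in \<open>auto simp: T_def\<close>)
    finally show ?thesis using p by simp
  qed
  have "z \<in> gam P s ` fam P s"
    by (rule pm_tensor_induct[OF P N H[unfolded T_def] pure z])
  then show ?thesis by auto
qed

text \<open>Naturality in \<open>P\<close>: the differentials of the complex
  \<open>P \<otimes> N\<close> act entrywise on families.\<close>

lemma gam_hom:
  assumes P: "persistence_module K P" and P': "persistence_module K P'" and \<phi>: "\<phi> \<in> pm_homs K P P'"
    and p: "p \<in> fam P s"
  shows "pm_tensor_map K P' N \<phi> s (gam P s p) = gam P' s (\<lambda>j. \<phi> (s - c j) (p j))"
proof -
  interpret T: module K "pm_ob (pm_tensor K P' N) s" by (rule pm_tensor_module[OF P' N])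
  note ml = pm_tensor_map_lin[OF P P' N \<phi>, of s]
  have "pm_tensor_map K P' N \<phi> s (gam P s p) = (\<Oplus>\<^bsub>pm_ob (pm_tensor K P' N) s\<^esub>j\<in>J.
      pm_tensor_map K P' N \<phi> s (ptens K P N s (s - c j) (c j) (p j) (gen j)))"
    unfolding gam_def using pt_closed[OF P p]
    by (intro lin_maps_finsum[OF pm_tensor_module[OF P N] pm_tensor_module[OF P' N] ml J]) auto
  also have "\<dots> = gam P' s (\<lambda>j. \<phi> (s - c j) (p j))"
    unfolding gam_def
    using pm_tensor_map_ptens[OF P P' N \<phi> _ famD[OF p] gen_closed] pt_closed[OF P' fam_hom[OF \<phi> p]]
    by (intro T.M.finsum_cong'[OF refl]) auto
  finally show ?thesis .
qed

lemma gam_tr: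
  assumes P: "persistence_module K P" and st: "s \<le> t" and p: "p \<in> fam P s"
  shows "pm_tr (pm_tensor K P N) s t (gam P s p) = gam P t (\<lambda>j. pm_tr P (s - c j) (t - c j) (p j))"
proof -
  interpret T: module K "pm_ob (pm_tensor K P N) t" by (rule pm_tensor_module[OF P N])
  note tl = pm_tensor_tr_lin[OF P N st]
  have "pm_tr (pm_tensor K P N) s t (gam P s p) = (\<Oplus>\<^bsub>pm_ob (pm_tensor K P N) t\<^esub>j\<in>J.
      pm_tr (pm_tensor K P N) s t (ptens K P N s (s - c j) (c j) (p j) (gen j)))"
    unfolding gam_def using pt_closed[OF P p]
    by (intro lin_maps_finsum[OF pm_tensor_module[OF P N] pm_tensor_module[OF P N] tl J]) auto
  also have "\<dots> = gam P t (\<lambda>j. pm_tr P (s - c j) (t - c j) (p j))"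
    unfolding gam_def
  proof (rule T.M.finsum_cong'[OF refl])
    fix j assume j: "j \<in> J"
    note g = gen_closed[OF j] and pj = famD[OF p j]
    have "pm_tr (pm_tensor K P N) s t (ptens K P N s (s - c j) (c j) (p j) (gen j))
        = ptens K P N t (s - c j) (c j) (p j) (gen j)"
      using pj g by (intro pm_tensor_tr_ptens[OF P N st]) auto
    also have "\<dots> = ptens K P N t (t - c j) (c j) (pm_tr P (s - c j) (t - c j) (p j))
        (pm_tr N (c j) (c j) (gen j))"
      using st by (intro ptens_trans[OF P N _ _ _ pj g, symmetric]) auto
    finally show "pm_tr (pm_tensor K P N) s t (ptens K P N s (s - c j) (c j) (p j) (gen j))
        = ptens K P N t (t - c j) (c j) (pm_tr P (s - c j) (t - c j) (p j)) (gen j)"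
      using persistence_module.tr_refl[OF N g] by simp
  qed (use pt_closed[OF P fam_tr[OF P st p]] in auto)
  finally show ?thesis .
qed

end


section \<open>The tensor product of two sums of interval modules\<close>

lemma bars_minus:
  assumes K: "field K" and I: "finite I"
    and h: "h \<in> coord_space K (alive I a b t)" and h': "h' \<in> coord_space K (alive I a b t)"
  shows "h \<ominus>\<^bsub>pm_ob (bars K I a b) t\<^esub> h' = (\<lambda>i. h i \<ominus>\<^bsub>K\<^esub> h' i)"
proof -
  interpret K: field K by fact
  have m1: "\<ominus>\<^bsub>K\<^esub> \<one>\<^bsub>K\<^esub> \<in> carrier K" by simp
  have hK: "h i \<in> carrier K" "h' i \<in> carrier K" for i using h h' by (simp_all add: coord_space_def)
  have sm: "(\<lambda>i. (\<ominus>\<^bsub>K\<^esub> \<one>\<^bsub>K\<^esub>) \<otimes>\<^bsub>K\<^esub> h' i) \<in> coord_space K (alive I a b t)"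
    using h' by (simp add: coord_space_def)
  have "h \<ominus>\<^bsub>pm_ob (bars K I a b) t\<^esub> h' = (\<lambda>i. h i \<oplus>\<^bsub>K\<^esub> (\<ominus>\<^bsub>K\<^esub> \<one>\<^bsub>K\<^esub>) \<otimes>\<^bsub>K\<^esub> h' i)"
    using module_minus_eq[OF bars_module[OF K I], of h a b t h'] h h' bars_smult[OF K h' m1]
      bars_add[OF K h sm] by (simp add: bars_carrier[OF K I])
  then show ?thesis using hK by (simp add: a_minus_def K.l_minus)
qed

lemma ereal_less_diff_iff: "ereal (s - c) < b \<longleftrightarrow> ereal s < b + ereal c"
  by (cases b) auto

text \<open>At time \<open>s\<close> the pair \<open>(i, j)\<close> contributes if bar
  \<open>i\<close> is alive at \<open>s - c j\<close>, that is
  \<open>a i + c j \<le> s < b i + c j\<close>, and was not yet born at \<open>s - d j\<close>, that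
  is \<open>s < a i + d j\<close>. The two upper bounds combine to the minimum.\<close>

lemma tensor_bars_iso:
  fixes K :: "('k, 'm) ring_scheme" and I :: "'i set" and J :: "'j set"
  assumes "bars_iso K M I a b \<xi> \<zeta>" and "bars_iso K N J c d \<eta> \<psi>"
  shows "pm_isomorphic K (pm_tensor K M N)
    (bars K (I \<times> J) (\<lambda>(i, j). a i + c j) (\<lambda>(i, j). min (ereal (a i) + d j) (b i + ereal (c j))))"
proof -
  interpret MB: bars_iso K M I a b \<xi> \<zeta> by fact
  interpret NB: bars_iso K N J c d \<eta> \<psi> by fact
  let ?A = "\<lambda>(i, j). a i + c j" and ?B = "\<lambda>(i, j). min (ereal (a i) + d j) (b i + ereal (c j))"
  define T where "T = bars K (I \<times> J) ?A ?B"
  define \<alpha> where "\<alpha> s = alive (I \<times> J) ?A ?B s" for s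
  note K = NB.field_K and M = MB.N
  have Kmm: "x \<ominus>\<^bsub>K\<^esub> x = \<zero>\<^bsub>K\<^esub>" if "x \<in> carrier K" for x
    using that by (simp add: a_minus_def MB.K.r_neg)
  have fin: "finite (I \<times> J)" using MB.J NB.J by simp
  have \<alpha>: "(i, j) \<in> \<alpha> s \<longleftrightarrow> j \<in> J \<and> i \<in> alive I a b (s - c j) \<and> ereal s < ereal (a i) + d j" for i j s
    by (auto simp: \<alpha>_def alive_def ereal_less_diff_iff)
  have TC: "carrier (pm_ob T s) = coord_space K (\<alpha> s)" for s
    by (simp add: T_def \<alpha>_def bars_carrier[OF K fin])
  define row where "row h j = (\<lambda>i. h (i, j))" for h :: "'i \<times> 'j \<Rightarrow> 'k" and j
  have row: "row h j \<in> carrier (pm_ob (bars K I a b) (s - c j))" if "h \<in> coord_space K (\<alpha> s)" for h j s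
    using that \<alpha> by (auto simp: row_def coord_space_def MB.BC)
  note \<xi>l = pm_homs_lin[OF MB.\<eta>] and \<zeta>l = pm_homs_lin[OF MB.\<psi>]
  note mB = bars_module[OF K MB.J] and mM = pm_module[OF M]
  \<comment> \<open>Dead vectors are those supported on bars already born at \<open>s - d j\<close>;
    the inequality is arranged so that it also makes sense for an infinite
    \<open>d j\<close>.\<close>
  have dead: "\<xi> (s - c j) g \<in> NB.dead M s j \<longleftrightarrow> (\<forall>i. g i \<noteq> \<zero>\<^bsub>K\<^esub> \<longrightarrow> ereal (a i) + d j \<le> ereal s)"
    if j: "j \<in> J" and g: "g \<in> coord_space K (alive I a b (s - c j))" for s j g
  proof (cases "d j = \<infinity>")
    case True
    have gB: "g \<in> carrier (pm_ob (bars K I a b) (s - c j))" using g by (simp add: MB.BC)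
    have "g = (\<lambda>_. \<zero>\<^bsub>K\<^esub>)" if "\<xi> (s - c j) g = \<zero>\<^bsub>pm_ob M (s - c j)\<^esub>"
      using MB.\<psi>\<eta>[OF gB] that lin_maps_zero[OF mM mB \<zeta>l] by (simp add: bars_zero[OF K])
    moreover have "\<xi> (s - c j) (\<lambda>_. \<zero>\<^bsub>K\<^esub>) = \<zero>\<^bsub>pm_ob M (s - c j)\<^esub>"
      using lin_maps_zero[OF mB mM \<xi>l] by (simp add: bars_zero[OF K])
    moreover have "(\<forall>i. g i \<noteq> \<zero>\<^bsub>K\<^esub> \<longrightarrow> ereal (a i) + d j \<le> ereal s) \<longleftrightarrow> g = (\<lambda>_. \<zero>\<^bsub>K\<^esub>)"
      using True by auto
    ultimately show ?thesis using True by (auto simp: NB.dead_def)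
  next
    case False
    define e where "e = real_of_ereal (d j)"
    have e: "d j = ereal e" "c j < e" using NB.death_real[OF j False] by (simp_all add: e_def)
    have le: "s - e \<le> s - c j" using e by simp
    show ?thesis
    proof
      assume "\<xi> (s - c j) g \<in> NB.dead M s j"
      then obtain q where q: "q \<in> carrier (pm_ob M (s - e))" "\<xi> (s - c j) g = pm_tr M (s - e) (s - c j) q"
        using False by (auto simp: NB.dead_def e_def)
      have "g = \<zeta> (s - c j) (\<xi> (s - c j) g)" using MB.\<psi>\<eta> g by (simp add: MB.BC)
      also have "\<dots> = pm_tr (bars K I a b) (s - e) (s - c j) (\<zeta> (s - e) q)"
        unfolding q(2) by (rule pm_homs_natural[OF MB.\<psi> le q(1)])
      finally have eq: "g = pm_tr (bars K I a b) (s - e) (s - c j) (\<zeta> (s - e) q)" .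
      have \<zeta>q: "\<zeta> (s - e) q \<in> coord_space K (alive I a b (s - e))" by (rule MB.\<psi>_coord[OF q(1)])
      show "\<forall>i. g i \<noteq> \<zero>\<^bsub>K\<^esub> \<longrightarrow> ereal (a i) + d j \<le> ereal s"
      proof (intro allI impI)
        fix i assume "g i \<noteq> \<zero>\<^bsub>K\<^esub>"
        then have "\<zeta> (s - e) q i \<noteq> \<zero>\<^bsub>K\<^esub>"
          using eq bars_tr[OF K \<zeta>q, of "s - c j"] by (metis (full_types))
        then have "i \<in> alive I a b (s - e)" using \<zeta>q by (auto simp: coord_space_def)
        then show "ereal (a i) + d j \<le> ereal s" using e by (simp add: alive_def)
      qed
    next
      assume late: "\<forall>i. g i \<noteq> \<zero>\<^bsub>K\<^esub> \<longrightarrow> ereal (a i) + d j \<le> ereal s"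
      \<comment> \<open>A bar born by \<open>s - e\<close> and alive at \<open>s - c j\<close>
        contains \<open>s - e\<close>, so \<open>g\<close> itself serves as preimage under the
        transition map.\<close>
      have al: "i \<in> alive I a b (s - e) \<and> i \<in> alive I a b (s - c j)" if "g i \<noteq> \<zero>\<^bsub>K\<^esub>" for i
      proof -
        have i: "i \<in> alive I a b (s - c j)" using that g by (auto simp: coord_space_def)
        have "a i \<le> s - e" using that late e by auto
        moreover have "ereal (s - e) < b i"
          using i le by (auto simp: alive_def intro: le_less_trans[of _ "ereal (s - c j)"])
        ultimately show ?thesis using i by (simp add: alive_def)
      qed
      then have g': "g \<in> coord_space K (alive I a b (s - e))" using g by (auto simp: coord_space_def)
      have "pm_tr (bars K I a b) (s - e) (s - c j) g = g"
        unfolding bars_tr[OF K g']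
      proof
        fix i show "(if i \<in> alive I a b (s - c j) then g i else \<zero>\<^bsub>K\<^esub>) = g i"
          using al[of i] by (cases "g i = \<zero>\<^bsub>K\<^esub>") simp_all
      qed
      then have "\<xi> (s - c j) g = pm_tr M (s - e) (s - c j) (\<xi> (s - e) g)"
        using pm_homs_natural[OF MB.\<eta> le, of g] g' by (simp add: MB.BC)
      then show "\<xi> (s - c j) g \<in> NB.dead M s j"
        using False lin_maps_closed[OF \<xi>l, of g "s - e"] g' by (simp add: NB.dead_def e_def MB.BC)
    qed
  qed
  define \<Phi> where "\<Phi> s h = NB.gam M s (\<lambda>j. \<xi> (s - c j) (row h j))" for s h
  have fam: "(\<lambda>j. \<xi> (s - c j) (row h j)) \<in> NB.fam M s" if "h \<in> coord_space K (\<alpha> s)" for s h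
    using lin_maps_closed[OF \<xi>l row[OF that]] by (simp add: NB.fam_def)
  \<comment> \<open>Coordinates outside \<open>\<alpha> s\<close> may be changed freely, as they
    contribute only dead vectors. This absorbs the truncations in naturality and
    surjectivity.\<close>
  have close: "NB.gam M s (\<lambda>j. \<xi> (s - c j) (g j)) = \<Phi> s h"
    if h: "h \<in> coord_space K (\<alpha> s)"
      and g: "\<And>j. j \<in> J \<Longrightarrow> g j \<in> coord_space K (alive I a b (s - c j))"
      and gh: "\<And>i j. j \<in> J \<Longrightarrow> (i, j) \<in> \<alpha> s \<Longrightarrow> g j i = h (i, j)" for s g h
    unfolding \<Phi>_def
  proof (rule NB.gam_eqI[OF M _ fam[OF h]])
    show "(\<lambda>j. \<xi> (s - c j) (g j)) \<in> NB.fam M s"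
      using lin_maps_closed[OF \<xi>l] g by (simp add: NB.fam_def MB.BC)
    fix j assume j: "j \<in> J"
    have gj: "g j \<in> carrier (pm_ob (bars K I a b) (s - c j))" using g[OF j] by (simp add: MB.BC)
    have rj: "row h j \<in> coord_space K (alive I a b (s - c j))" using row[OF h] by (simp add: MB.BC)
    let ?D = "\<lambda>i. g j i \<ominus>\<^bsub>K\<^esub> row h j i"
    have D: "g j \<ominus>\<^bsub>pm_ob (bars K I a b) (s - c j)\<^esub> row h j = ?D"
      by (rule bars_minus[OF K MB.J g[OF j] rj])
    have Dc: "?D \<in> coord_space K (alive I a b (s - c j))"
      using g[OF j] rj by (simp add: coord_space_def Kmm)
    have "ereal (a i) + d j \<le> ereal s" if i: "?D i \<noteq> \<zero>\<^bsub>K\<^esub>" for i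
    proof (rule ccontr)
      assume n: "\<not> ereal (a i) + d j \<le> ereal s"
      have "i \<in> alive I a b (s - c j)" using i Dc by (auto simp: coord_space_def)
      then have "(i, j) \<in> \<alpha> s" using j n by (simp add: \<alpha>)
      then have "?D i = \<zero>\<^bsub>K\<^esub>"
        using gh[OF j] h by (simp add: row_def coord_space_def Kmm)
      then show False using i by simp
    qed
    then have "\<xi> (s - c j) ?D \<in> NB.dead M s j" using dead[OF j Dc] by simp
    then show "\<xi> (s - c j) (g j) \<ominus>\<^bsub>pm_ob M (s - c j)\<^esub> \<xi> (s - c j) (row h j) \<in> NB.dead M s j"
      using lin_maps_minus[OF mB mM \<xi>l gj row[OF h]] D by simp
  qed
  have \<Phi>l: "\<Phi> s \<in> lin_maps K (pm_ob T s) (pm_ob (pm_tensor K M N) s)" for s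
  proof (rule lin_mapsI, unfold TC)
    fix h assume h: "h \<in> coord_space K (\<alpha> s)"
    show "\<Phi> s h \<in> carrier (pm_ob (pm_tensor K M N) s)"
      unfolding \<Phi>_def by (rule NB.gam_closed[OF M fam[OF h]])
    show "\<Phi> s (k \<odot>\<^bsub>pm_ob T s\<^esub> h) = k \<odot>\<^bsub>pm_ob (pm_tensor K M N) s\<^esub> \<Phi> s h" if k: "k \<in> carrier K" for k
    proof -
      have "row (k \<odot>\<^bsub>pm_ob T s\<^esub> h) j = k \<odot>\<^bsub>pm_ob (bars K I a b) (s - c j)\<^esub> row h j" for j
        using bars_smult[OF K h[unfolded \<alpha>_def] k] bars_smult[OF K row[OF h, unfolded MB.BC] k]
        by (simp add: T_def row_def)
      then show ?thesis
        unfolding \<Phi>_def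
        using NB.gam_smult[OF M fam[OF h] k] lin_maps_smult[OF \<xi>l k row[OF h]] by simp
    qed
    fix h' assume h': "h' \<in> coord_space K (\<alpha> s)"
    have "row (h \<oplus>\<^bsub>pm_ob T s\<^esub> h') j = row h j \<oplus>\<^bsub>pm_ob (bars K I a b) (s - c j)\<^esub> row h' j" for j
      using bars_add[OF K h[unfolded \<alpha>_def] h'[unfolded \<alpha>_def]]
        bars_add[OF K row[OF h, unfolded MB.BC] row[OF h', unfolded MB.BC]]
      by (simp add: T_def row_def)
    then show "\<Phi> s (h \<oplus>\<^bsub>pm_ob T s\<^esub> h') = \<Phi> s h \<oplus>\<^bsub>pm_ob (pm_tensor K M N) s\<^esub> \<Phi> s h'"
      unfolding \<Phi>_def
      using NB.gam_add[OF M fam[OF h] fam[OF h']] lin_maps_add[OF \<xi>l row[OF h] row[OF h']] by simp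
  qed
  have \<Phi>hom: "\<Phi> \<in> pm_homs K T (pm_tensor K M N)"
    unfolding pm_homs_def
  proof (intro CollectI conjI allI impI ballI \<Phi>l)
    fix s t :: real and h assume st: "s \<le> t" and "h \<in> carrier (pm_ob T s)"
    then have h: "h \<in> coord_space K (\<alpha> s)" by (simp add: TC)
    have trh: "pm_tr T s t h = (\<lambda>i. if i \<in> \<alpha> t then h i else \<zero>\<^bsub>K\<^esub>)"
      using bars_tr[OF K h[unfolded \<alpha>_def], of t] by (simp add: T_def \<alpha>_def)
    have rh: "row h j \<in> coord_space K (alive I a b (s - c j))" for j
      using row[OF h] by (simp add: MB.BC)
    have trr: "pm_tr (bars K I a b) (s - c j) (t - c j) (row h j)
        = (\<lambda>i. if i \<in> alive I a b (t - c j) then h (i, j) else \<zero>\<^bsub>K\<^esub>)" for j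
      unfolding bars_tr[OF K rh] by (auto simp: row_def fun_eq_iff)
    have "pm_tr (pm_tensor K M N) s t (\<Phi> s h)
        = NB.gam M t (\<lambda>j. pm_tr M (s - c j) (t - c j) (\<xi> (s - c j) (row h j)))"
      unfolding \<Phi>_def by (rule NB.gam_tr[OF M st fam[OF h]])
    also have "\<dots> = NB.gam M t (\<lambda>j. \<xi> (t - c j) (pm_tr (bars K I a b) (s - c j) (t - c j) (row h j)))"
      using pm_homs_natural[OF MB.\<eta> _ row[OF h]] st by simp
    also have "\<dots> = \<Phi> t (pm_tr T s t h)"
    proof (rule close)
      show "pm_tr T s t h \<in> coord_space K (\<alpha> t)" using h by (simp add: trh coord_space_def)
      show "pm_tr (bars K I a b) (s - c j) (t - c j) (row h j) \<in> coord_space K (alive I a b (t - c j))" for j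
        using h by (simp add: trr coord_space_def)
    qed (simp add: trr trh \<alpha>)
    finally show "\<Phi> t (pm_tr T s t h) = pm_tr (pm_tensor K M N) s t (\<Phi> s h)" by simp
  qed
  have \<Phi>bij: "bij_betw (\<Phi> s) (carrier (pm_ob T s)) (carrier (pm_ob (pm_tensor K M N) s))" for s
  proof (rule bij_betw_imageI)
    have mT: "module K (pm_ob T s)" unfolding T_def by (rule bars_module[OF K fin])
    show "inj_on (\<Phi> s) (carrier (pm_ob T s))"
    proof (rule lin_maps_injI[OF mT pm_tensor_module[OF M NB.N] \<Phi>l])
      fix h assume "h \<in> carrier (pm_ob T s)" and 0: "\<Phi> s h = \<zero>\<^bsub>pm_ob (pm_tensor K M N) s\<^esub>"
      then have h: "h \<in> coord_space K (\<alpha> s)" by (simp add: TC)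
      have "h (i, j) = \<zero>\<^bsub>K\<^esub>" for i j
      proof (rule ccontr)
        assume hij: "h (i, j) \<noteq> \<zero>\<^bsub>K\<^esub>"
        then have al: "(i, j) \<in> \<alpha> s" using h by (auto simp: coord_space_def)
        then have j: "j \<in> J" by (simp add: \<alpha>)
        have "\<xi> (s - c j) (row h j) \<in> NB.dead M s j"
          using NB.gam_kernel[OF M fam[OF h] 0[unfolded \<Phi>_def] j] .
        then have "ereal (a i) + d j \<le> ereal s"
          using dead[OF j row[OF h, unfolded MB.BC]] hij by (simp add: row_def)
        then show False using al by (auto simp: \<alpha>)
      qed
      then show "h = \<zero>\<^bsub>pm_ob T s\<^esub>" by (auto simp: T_def bars_zero[OF K])
    qed
    show "\<Phi> s ` carrier (pm_ob T s) = carrier (pm_ob (pm_tensor K M N) s)"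
    proof (intro equalityI subsetI)
      fix z assume "z \<in> \<Phi> s ` carrier (pm_ob T s)"
      then show "z \<in> carrier (pm_ob (pm_tensor K M N) s)" using lin_maps_closed[OF \<Phi>l] by auto
    next
      fix z assume "z \<in> carrier (pm_ob (pm_tensor K M N) s)"
      then obtain p where p: "p \<in> NB.fam M s" "z = NB.gam M s p" using NB.gam_surj[OF M] by blast
      define h where "h = (\<lambda>(i, j). if (i, j) \<in> \<alpha> s then \<zeta> (s - c j) (p j) i else \<zero>\<^bsub>K\<^esub>)"
      have \<zeta>p: "\<zeta> (s - c j) (p j) \<in> coord_space K (alive I a b (s - c j))" if "j \<in> J" for j
        by (rule MB.\<psi>_coord[OF NB.famD[OF p(1) that]])
      have h: "h \<in> coord_space K (\<alpha> s)"
        using \<zeta>p by (auto simp: h_def coord_space_def \<alpha>)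
      have "z = NB.gam M s (\<lambda>j. \<xi> (s - c j) (\<zeta> (s - c j) (p j)))"
        unfolding p(2)
      proof (rule NB.gam_eqI[OF M p(1)])
        show "(\<lambda>j. \<xi> (s - c j) (\<zeta> (s - c j) (p j))) \<in> NB.fam M s"
          using NB.famD[OF p(1)] by (simp add: NB.fam_def MB.\<eta>\<psi>)
        show "p j \<ominus>\<^bsub>pm_ob M (s - c j)\<^esub> \<xi> (s - c j) (\<zeta> (s - c j) (p j)) \<in> NB.dead M s j" if "j \<in> J" for j
          using NB.famD[OF p(1) that] module_minus_self[OF mM]
            subspace_zero[OF NB.dead_subspace[OF M that]] by (simp add: MB.\<eta>\<psi>)
      qed
      also have "\<dots> = \<Phi> s h"
        by (rule close[OF h \<zeta>p]) (simp_all add: h_def)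
      finally show "z \<in> \<Phi> s ` carrier (pm_ob T s)" using h by (simp add: TC)
    qed
  qed
  have "persistence_module K T" unfolding T_def by (rule bars_persistence_module[OF K fin])
  \<comment> \<open>The isomorphism was built from the bars to the tensor product, and
    \<open>pm_isomorphic\<close> asks for the opposite direction.\<close>
  note inv = pm_iso_inverse(1,2)[OF K this \<Phi>hom \<Phi>bij]
  show ?thesis
    unfolding pm_isomorphic_def T_def[symmetric] by (rule bexI[OF _ inv(1)]) (rule allI, rule inv(2))
qed


section \<open>Tor of two sums of interval modules\<close>

text \<open>Suited to maps defined by a diagram chase, whose intermediate lifts are not unique:
  \<open>\<rho>\<close> is a linear relation. Its values become unique on cosets because elements of
  \<open>B\<close> are related only to zero, and the converse gives injectivity.\<close>

lemma relation_quotient_iso: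
  fixes K :: "('k, 'm) ring_scheme" and V :: "('k, 'v) module" and W :: "('k, 'w) module"
  assumes V: "module K V" and W: "module K W" and Z: "submodule Z K V" and B: "submodule B K V"
    and BZ: "B \<subseteq> Z"
    and dom: "\<And>z h. \<rho> z h \<Longrightarrow> z \<in> Z \<and> h \<in> carrier W"
    and total: "\<And>z. z \<in> Z \<Longrightarrow> \<exists>h. \<rho> z h"
    and onto: "\<And>h. h \<in> carrier W \<Longrightarrow> \<exists>z. \<rho> z h"
    and add: "\<And>z h z' h'. \<rho> z h \<Longrightarrow> \<rho> z' h' \<Longrightarrow> \<rho> (z \<oplus>\<^bsub>V\<^esub> z') (h \<oplus>\<^bsub>W\<^esub> h')"
    and smult: "\<And>k z h. k \<in> carrier K \<Longrightarrow> \<rho> z h \<Longrightarrow> \<rho> (k \<odot>\<^bsub>V\<^esub> z) (k \<odot>\<^bsub>W\<^esub> h)"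
    and ker: "\<And>z h. \<rho> z h \<Longrightarrow> z \<in> B \<longleftrightarrow> h = \<zero>\<^bsub>W\<^esub>"
  defines "Q \<equiv> quot_space (V\<lparr>carrier := Z\<rparr>) B" and "f \<equiv> \<lambda>X. THE h. \<exists>z\<in>X. \<rho> z h"
  shows "module K Q" and "submodule B K (V\<lparr>carrier := Z\<rparr>)"
    and "f \<in> lin_maps K Q W" and "bij_betw f (carrier Q) (carrier W)"
    and "\<And>z h. \<rho> z h \<Longrightarrow> f (B +>\<^bsub>V\<lparr>carrier := Z\<rparr>\<^esub> z) = h"
proof -
  define V' where "V' = V\<lparr>carrier := Z\<rparr>"
  interpret V: module K V by fact
  interpret W: module K W by fact
  have V': "module K V'" unfolding V'_def by (rule submodule.submodule_is_module[OF Z V])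
  have V's: "carrier V' = Z" "\<zero>\<^bsub>V'\<^esub> = \<zero>\<^bsub>V\<^esub>" "\<And>x y. x \<oplus>\<^bsub>V'\<^esub> y = x \<oplus>\<^bsub>V\<^esub> y"
    "\<And>k x. k \<odot>\<^bsub>V'\<^esub> x = k \<odot>\<^bsub>V\<^esub> x"
    by (simp_all add: V'_def)
  have B': "submodule B K V'"
    using BZ subspace_zero[OF B] subspace_add[OF B] subspace_smult[OF B]
    by (intro subspaceI[OF V']) (simp_all add: V's)
  then show "submodule B K (V\<lparr>carrier := Z\<rparr>)" by (simp add: V'_def)
  have Q: "Q = quot_space V' B" by (simp add: Q_def V'_def)
  show mQ: "module K Q" unfolding Q by (rule quot_module[OF V' B'])
  have m1: "\<ominus>\<^bsub>K\<^esub> \<one>\<^bsub>K\<^esub> \<in> carrier K" by simp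
  have diff: "\<rho> (z \<ominus>\<^bsub>V\<^esub> z') (h \<ominus>\<^bsub>W\<^esub> h')" if r: "\<rho> z h" "\<rho> z' h'" for z z' h h'
    using add[OF r(1) smult[OF m1 r(2)]] dom[OF r(1)] dom[OF r(2)] subspace_subset[OF Z]
    by (simp add: module_minus_eq[OF V] module_minus_eq[OF W])
  have f: "f (B +>\<^bsub>V'\<^esub> z) = h" if r: "\<rho> z h" for z h
    unfolding f_def
  proof (rule the_equality)
    have zV: "z \<in> carrier V" using dom[OF r] subspace_subset[OF Z] by auto
    have "z = \<zero>\<^bsub>V\<^esub> \<oplus>\<^bsub>V\<^esub> z" using zV by simp
    then have "z \<in> B +>\<^bsub>V'\<^esub> z"
      unfolding coset_mem V's using subspace_zero[OF B] by blast
    then show "\<exists>z\<in>B +>\<^bsub>V'\<^esub> z. \<rho> z h" using r by blast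
    fix h' assume "\<exists>z\<in>B +>\<^bsub>V'\<^esub> z. \<rho> z h'"
    then obtain y where "y \<in> B +>\<^bsub>V'\<^esub> z" "\<rho> y h'" by blast
    then obtain b where b: "b \<in> B" "\<rho> (b \<oplus>\<^bsub>V\<^esub> z) h'" unfolding coset_mem V's by blast
    have "(b \<oplus>\<^bsub>V\<^esub> z) \<ominus>\<^bsub>V\<^esub> z = b"
      using zV subspace_subset[OF B b(1)] by (simp add: a_minus_def V.M.a_assoc V.M.r_neg)
    then have "h' \<ominus>\<^bsub>W\<^esub> h = \<zero>\<^bsub>W\<^esub>" using ker[OF diff[OF b(2) r]] b(1) by simp
    then show "h' = h" using module_minus_eq_zeroD[OF W] dom[OF b(2)] dom[OF r] by blast
  qed
  then show "\<And>z h. \<rho> z h \<Longrightarrow> f (B +>\<^bsub>V\<lparr>carrier := Z\<rparr>\<^esub> z) = h" by (simp add: V'_def)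
  have QC: "\<exists>z h. X = B +>\<^bsub>V'\<^esub> z \<and> \<rho> z h" if "X \<in> carrier Q" for X
    using that total unfolding Q quot_carrier V's by blast
  have Qz: "B +>\<^bsub>V'\<^esub> z \<in> carrier Q" if "\<rho> z h" for z h
    using dom[OF that] unfolding Q quot_carrier V's by blast
  show fl: "f \<in> lin_maps K Q W"
  proof (rule lin_mapsI)
    fix X assume "X \<in> carrier Q"
    then obtain z h where X: "X = B +>\<^bsub>V'\<^esub> z" and r: "\<rho> z h" using QC by blast
    have z: "z \<in> carrier V'" using dom[OF r] by (simp add: V's)
    show "f X \<in> carrier W" using f[OF r] dom[OF r] X by simp
    show "f (k \<odot>\<^bsub>Q\<^esub> X) = k \<odot>\<^bsub>W\<^esub> f X" if k: "k \<in> carrier K" for k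
      using f[OF smult[OF k r]] f[OF r] quot_smult[OF V' B' k z] X by (simp add: Q V's)
    fix Y assume "Y \<in> carrier Q"
    then obtain z' h' where Y: "Y = B +>\<^bsub>V'\<^esub> z'" and r': "\<rho> z' h'" using QC by blast
    have z': "z' \<in> carrier V'" using dom[OF r'] by (simp add: V's)
    show "f (X \<oplus>\<^bsub>Q\<^esub> Y) = f X \<oplus>\<^bsub>W\<^esub> f Y"
      using f[OF add[OF r r']] f[OF r] f[OF r'] quot_add[OF V' B' z z'] X Y by (simp add: Q V's)
  qed
  show "bij_betw f (carrier Q) (carrier W)"
  proof (rule bij_betw_imageI)
    show "inj_on f (carrier Q)"
    proof (rule lin_maps_injI[OF mQ W fl])
      fix X assume "X \<in> carrier Q" and 0: "f X = \<zero>\<^bsub>W\<^esub>"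
      then obtain z h where X: "X = B +>\<^bsub>V'\<^esub> z" and r: "\<rho> z h" using QC by blast
      have z: "z \<in> carrier V'" using dom[OF r] by (simp add: V's)
      have zB: "z \<in> B" using ker[OF r] f[OF r] 0 X by simp
      interpret V': module K V' by (rule V')
      have "z \<ominus>\<^bsub>V'\<^esub> \<zero>\<^bsub>V'\<^esub> \<in> B"
        using subspace_minus[OF V' B' zB subspace_zero[OF B']] .
      then show "X = \<zero>\<^bsub>Q\<^esub>"
        unfolding X Q quot_zero[OF V' B'] using coset_eq_iff[OF V' B' z V'.M.zero_closed] by simp
    qed
    show "f ` carrier Q = carrier W"
    proof (intro equalityI subsetI)
      fix h assume "h \<in> f ` carrier Q"
      then show "h \<in> carrier W" using lin_maps_closed[OF fl] by auto
    next
      fix h assume "h \<in> carrier W"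
      then obtain z where r: "\<rho> z h" using onto by blast
      from f[OF r, symmetric] Qz[OF r] show "h \<in> f ` carrier Q" by (rule image_eqI)
    qed
  qed
qed

text \<open>
  By the description of \<open>_ \<otimes> N\<close> above, the complex \<open>P \<otimes> N\<close> has the summands
  \<open>P (s - c j) / P (s - d j)\<close>. As the transition maps of \<open>P 0\<close> are injective, the connecting
  homomorphism identifies its first homology with the kernels of \<open>M (s - d j) \<rightarrow> M (s - c j)\<close>.
  The relation \<open>\<rho>\<close> is the graph of this homomorphism before passing to homology.
\<close>

lemma Tor_bars_iso:
  fixes K :: "('k, 'm) ring_scheme" and N :: "('k, 'b) persmod" and P :: "nat \<Rightarrow> ('k, 'p) persmod"
    and I :: "'i set" and J :: "'j set"
  assumes NB: "bars_iso K N J c d \<eta> \<psi>"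
    and I: "finite I" and ab: "\<And>i. i \<in> I \<Longrightarrow> ereal (a i) < b i"
    and P: "\<And>n. persistence_module K (P n)"
    and \<delta>: "\<And>n. \<delta> n \<in> pm_homs K (P (Suc n)) (P n)"
    and \<epsilon>: "\<epsilon> \<in> pm_homs K (P 0) (bars K I a b)" and epi: "pm_epi (P 0) (bars K I a b) \<epsilon>"
    and ex0: "pm_exact (P (Suc 0)) (P 0) (bars K I a b) (\<delta> 0) \<epsilon>"
    and ex1: "pm_exact (P (Suc (Suc 0))) (P (Suc 0)) (P 0) (\<delta> (Suc 0)) (\<delta> 0)"
    and inj: "\<And>s t x y. s \<le> t \<Longrightarrow> x \<in> carrier (pm_ob (P 0) s) \<Longrightarrow> y \<in> carrier (pm_ob (P 0) s) \<Longrightarrow>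
      pm_tr (P 0) s t x = pm_tr (P 0) s t y \<Longrightarrow> x = y"
  shows "module K (pm_ob (pm_Tor K P \<delta> N 1) t)"
    and "pm_isomorphic K (pm_Tor K P \<delta> N 1) (bars K {(i, j) \<in> I \<times> J. b i \<noteq> \<infinity> \<and> d j \<noteq> \<infinity>}
      (\<lambda>(i, j). max (a i + real_of_ereal (d j)) (real_of_ereal (b i) + c j)) (\<lambda>(i, j). b i + d j))"
proof -
  interpret NB: bars_iso K N J c d \<eta> \<psi> by fact
  note K = NB.field_K and N = NB.N
  define D where "D j = real_of_ereal (d j)" for j
  \<comment> \<open>Only pairs of finite bars occur: an infinite bar \<open>j\<close> imposes no
    relation on tensors, and an infinite bar \<open>i\<close> does not die between
    \<open>s - D j\<close> and \<open>s - c j\<close>.\<close>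
  define U where "U = {(i, j) \<in> I \<times> J. b i \<noteq> \<infinity> \<and> d j \<noteq> \<infinity>}"
  let ?A = "\<lambda>(i, j). max (a i + D j) (real_of_ereal (b i) + c j)" and ?B = "\<lambda>(i, j). b i + d j"
  define W where "W = bars K U ?A ?B"
  define \<alpha> where "\<alpha> s = alive U ?A ?B s" for s
  define S where "S = bars K I a b"
  have finU: "finite U" unfolding U_def by (rule finite_subset[of _ "I \<times> J"]) (use I NB.J in auto)
  have D: "d j = ereal (D j)" "c j < D j" if "j \<in> J" "d j \<noteq> \<infinity>" for j
    using NB.death_real[OF that] by (simp_all add: D_def)
  \<comment> \<open>These are the bars in the kernel of the transition map from
    \<open>s - D j\<close> to \<open>s - c j\<close>, which explains both ends of the Tor
    bars.\<close>
  have \<alpha>: "(i, j) \<in> \<alpha> s \<longleftrightarrow> j \<in> J \<and> d j \<noteq> \<infinity> \<and> i \<in> alive I a b (s - D j) \<and> i \<notin> alive I a b (s - c j)"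
    for i j s
  proof (cases "i \<in> I \<and> j \<in> J \<and> d j \<noteq> \<infinity>")
    case True
    then have "d j = ereal (D j)" "c j < D j" "ereal (a i) < b i" using D ab by auto
    then show ?thesis using True by (cases "b i") (auto simp: \<alpha>_def U_def alive_def)
  qed (auto simp: \<alpha>_def U_def alive_def)
  have mW: "module K (pm_ob W s)" for s unfolding W_def by (rule bars_module[OF K finU])
  have WC: "carrier (pm_ob W s) = coord_space K (\<alpha> s)" for s
    by (simp add: W_def \<alpha>_def bars_carrier[OF K finU])
  have SC: "carrier (pm_ob S s) = coord_space K (alive I a b s)" for s
    by (simp add: S_def bars_carrier[OF K I])
  have mS: "module K (pm_ob S s)" for s unfolding S_def by (rule bars_module[OF K I])
  have S0: "\<zero>\<^bsub>pm_ob S s\<^esub> = (\<lambda>_. \<zero>\<^bsub>K\<^esub>)" for s by (simp add: S_def bars_zero[OF K])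
  have W0: "\<zero>\<^bsub>pm_ob W s\<^esub> = (\<lambda>_. \<zero>\<^bsub>K\<^esub>)" for s by (simp add: W_def bars_zero[OF K])
  have Str: "pm_tr S s t g = (\<lambda>i. if i \<in> alive I a b t then g i else \<zero>\<^bsub>K\<^esub>)"
    if "g \<in> coord_space K (alive I a b s)" for g s t
    unfolding S_def by (rule bars_tr[OF K that])
  note mP = pm_module[OF P]
  note dl = pm_homs_lin[OF \<delta>] and el = pm_homs_lin[OF \<epsilon>, folded S_def]
  have \<epsilon>coord: "\<epsilon> s y \<in> coord_space K (alive I a b s)" if "y \<in> carrier (pm_ob (P 0) s)" for s y
    using lin_maps_closed[OF el that] by (simp add: SC)
  have \<epsilon>\<delta>: "y \<in> carrier (pm_ob (P 0) s) \<and> \<epsilon> s y = \<zero>\<^bsub>pm_ob S s\<^esub>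
      \<longleftrightarrow> (\<exists>x\<in>carrier (pm_ob (P (Suc 0)) s). y = \<delta> 0 s x)" for s y
    using ex0 unfolding pm_exact_def a_kernel_def' S_def by blast
  have \<delta>\<delta>: "x \<in> carrier (pm_ob (P (Suc 0)) s) \<and> \<delta> 0 s x = \<zero>\<^bsub>pm_ob (P 0) s\<^esub>
      \<longleftrightarrow> (\<exists>w\<in>carrier (pm_ob (P (Suc (Suc 0))) s). x = \<delta> (Suc 0) s w)" for s x
    using ex1 unfolding pm_exact_def a_kernel_def' by blast
  define T where "T = pm_tensor K (P (Suc 0)) N"
  define T0 where "T0 = pm_tensor K (P 0) N"
  define T2 where "T2 = pm_tensor K (P (Suc (Suc 0))) N"
  define Z where "Z s = a_kernel (pm_ob T s) (pm_ob T0 s) (pm_tensor_map K (P 0) N (\<delta> 0) s)" for s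
  define Bd where "Bd s = pm_tensor_map K (P (Suc 0)) N (\<delta> (Suc 0)) s ` carrier (pm_ob T2 s)" for s
  have Tor_ob: "pm_ob (pm_Tor K P \<delta> N 1) s = quot_space (pm_ob T s\<lparr>carrier := Z s\<rparr>) (Bd s)"
    and Tor_tr: "pm_tr (pm_Tor K P \<delta> N 1) s t
      = quot_map (pm_ob T t\<lparr>carrier := Z t\<rparr>) (Bd t) (pm_tr T s t)" for s t
    by (simp_all add: pm_Tor_def pm_subquot_def T_def T0_def T2_def Z_def Bd_def)
  have mT: "module K (pm_ob T s)" "module K (pm_ob T0 s)" "module K (pm_ob T2 s)" for s
    unfolding T_def T0_def T2_def by (rule pm_tensor_module[OF P N])+
  have l0: "pm_tensor_map K (P 0) N (\<delta> 0) s \<in> lin_maps K (pm_ob T s) (pm_ob T0 s)"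
    and l1: "pm_tensor_map K (P (Suc 0)) N (\<delta> (Suc 0)) s \<in> lin_maps K (pm_ob T2 s) (pm_ob T s)" for s
    unfolding T_def T0_def T2_def by (rule pm_tensor_map_lin[OF P P N \<delta>])+
  have Zs: "submodule (Z s) K (pm_ob T s)" for s
    unfolding Z_def by (rule subspace_kernel[OF mT(1,2) l0])
  have Bs: "submodule (Bd s) K (pm_ob T s)" for s
    unfolding Bd_def by (rule subspace_image[OF mT(3,1) l1 module.carrier_is_submodule[OF mT(3)]])
  let ?g1 = "NB.gam (P (Suc 0))" and ?f1 = "NB.fam (P (Suc 0))"
  have Zgam: "?g1 s x \<in> Z s \<longleftrightarrow> (\<forall>j\<in>J. \<delta> 0 (s - c j) (x j) \<in> NB.dead (P 0) s j)" if x: "x \<in> ?f1 s" for s x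
  proof -
    have eq: "pm_tensor_map K (P 0) N (\<delta> 0) s (?g1 s x) = NB.gam (P 0) s (\<lambda>j. \<delta> 0 (s - c j) (x j))"
      by (rule NB.gam_hom[OF P P \<delta> x])
    have fam: "(\<lambda>j. \<delta> 0 (s - c j) (x j)) \<in> NB.fam (P 0) s" by (rule NB.fam_hom[OF \<delta> x])
    have cl: "?g1 s x \<in> carrier (pm_ob T s)" unfolding T_def by (rule NB.gam_closed[OF P x])
    show ?thesis
    proof
      assume "?g1 s x \<in> Z s"
      then have "NB.gam (P 0) s (\<lambda>j. \<delta> 0 (s - c j) (x j)) = \<zero>\<^bsub>pm_ob T0 s\<^esub>"
        using eq by (simp add: Z_def a_kernel_def')
      then show "\<forall>j\<in>J. \<delta> 0 (s - c j) (x j) \<in> NB.dead (P 0) s j"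
        using NB.gam_kernel[OF P fam] by (simp add: T0_def)
    next
      assume "\<forall>j\<in>J. \<delta> 0 (s - c j) (x j) \<in> NB.dead (P 0) s j"
      then have "NB.gam (P 0) s (\<lambda>j. \<delta> 0 (s - c j) (x j)) = \<zero>\<^bsub>pm_ob T0 s\<^esub>"
        unfolding T0_def by (intro NB.gam_dead[OF P]) simp
      then show "?g1 s x \<in> Z s" using eq cl by (simp add: Z_def a_kernel_def')
    qed
  qed
  \<comment> \<open>As \<open>gam\<close> is injective modulo dead entries, boundaries are the
    families that agree with entrywise images under \<open>\<delta> (Suc 0)\<close> up to dead
    entries.\<close>
  have Bgam: "?g1 s x \<in> Bd s \<longleftrightarrow> (\<exists>w\<in>NB.fam (P (Suc (Suc 0))) s. \<forall>j\<in>J.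
      x j \<ominus>\<^bsub>pm_ob (P (Suc 0)) (s - c j)\<^esub> \<delta> (Suc 0) (s - c j) (w j) \<in> NB.dead (P (Suc 0)) s j)"
    if x: "x \<in> ?f1 s" for s x
  proof -
    have eq: "pm_tensor_map K (P (Suc 0)) N (\<delta> (Suc 0)) s (NB.gam (P (Suc (Suc 0))) s w)
        = ?g1 s (\<lambda>j. \<delta> (Suc 0) (s - c j) (w j))"
      and fam: "(\<lambda>j. \<delta> (Suc 0) (s - c j) (w j)) \<in> ?f1 s"
      and cl: "NB.gam (P (Suc (Suc 0))) s w \<in> carrier (pm_ob T2 s)"
      if w: "w \<in> NB.fam (P (Suc (Suc 0))) s" for w
      using NB.gam_hom[OF P P \<delta> w] NB.fam_hom[OF \<delta> w] NB.gam_closed[OF P w] by (simp_all add: T2_def)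
    show ?thesis
    proof
      assume "?g1 s x \<in> Bd s"
      then obtain v where v: "v \<in> carrier (pm_ob T2 s)"
        "?g1 s x = pm_tensor_map K (P (Suc 0)) N (\<delta> (Suc 0)) s v" by (auto simp: Bd_def)
      obtain w where w: "w \<in> NB.fam (P (Suc (Suc 0))) s" "v = NB.gam (P (Suc (Suc 0))) s w"
        using NB.gam_surj[OF P v(1)[unfolded T2_def]] by blast
      have "?g1 s x = ?g1 s (\<lambda>j. \<delta> (Suc 0) (s - c j) (w j))" using v(2) w eq by simp
      then show "\<exists>w\<in>NB.fam (P (Suc (Suc 0))) s. \<forall>j\<in>J.
          x j \<ominus>\<^bsub>pm_ob (P (Suc 0)) (s - c j)\<^esub> \<delta> (Suc 0) (s - c j) (w j) \<in> NB.dead (P (Suc 0)) s j"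
        using NB.gam_eqD[OF P x fam[OF w(1)]] w(1) by blast
    next
      assume "\<exists>w\<in>NB.fam (P (Suc (Suc 0))) s. \<forall>j\<in>J.
          x j \<ominus>\<^bsub>pm_ob (P (Suc 0)) (s - c j)\<^esub> \<delta> (Suc 0) (s - c j) (w j) \<in> NB.dead (P (Suc 0)) s j"
      then obtain w where w: "w \<in> NB.fam (P (Suc (Suc 0))) s" "\<And>j. j \<in> J \<Longrightarrow>
          x j \<ominus>\<^bsub>pm_ob (P (Suc 0)) (s - c j)\<^esub> \<delta> (Suc 0) (s - c j) (w j) \<in> NB.dead (P (Suc 0)) s j"
        by blast
      have "?g1 s x = ?g1 s (\<lambda>j. \<delta> (Suc 0) (s - c j) (w j))"
        by (rule NB.gam_eqI[OF P x fam[OF w(1)] w(2)])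
      also have "\<dots> = pm_tensor_map K (P (Suc 0)) N (\<delta> (Suc 0)) s (NB.gam (P (Suc (Suc 0))) s w)"
        by (rule eq[OF w(1), symmetric])
      finally show "?g1 s x \<in> Bd s" unfolding Bd_def using cl[OF w(1)] by (rule image_eqI)
    qed
  qed
  \<comment> \<open>A boundary is represented by a family of genuine images under
    \<open>\<delta> (Suc 0)\<close>, whose differentials vanish.\<close>
  have BZ: "Bd s \<subseteq> Z s" for s
  proof
    fix z assume z: "z \<in> Bd s"
    then have "z \<in> carrier (pm_ob T s)" using subspace_subset[OF Bs] by blast
    then obtain x where x: "x \<in> ?f1 s" "z = ?g1 s x" using NB.gam_surj[OF P] unfolding T_def by blast
    obtain w where w: "w \<in> NB.fam (P (Suc (Suc 0))) s" "\<And>j. j \<in> J \<Longrightarrow>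
        x j \<ominus>\<^bsub>pm_ob (P (Suc 0)) (s - c j)\<^esub> \<delta> (Suc 0) (s - c j) (w j) \<in> NB.dead (P (Suc 0)) s j"
      using Bgam[OF x(1)] z x(2) by blast
    define x' where "x' j = \<delta> (Suc 0) (s - c j) (w j)" for j
    have x': "x' \<in> ?f1 s" unfolding x'_def by (rule NB.fam_hom[OF \<delta> w(1)])
    have "z = ?g1 s x'" unfolding x(2)
      by (rule NB.gam_eqI[OF P x(1) x']) (simp add: x'_def w(2))
    moreover have "\<delta> 0 (s - c j) (x' j) \<in> NB.dead (P 0) s j" if j: "j \<in> J" for j
    proof -
      have "\<delta> 0 (s - c j) (x' j) = \<zero>\<^bsub>pm_ob (P 0) (s - c j)\<^esub>"
        using \<delta>\<delta>[of "x' j" "s - c j"] NB.famD[OF w(1) j] unfolding x'_def by blast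
      then show ?thesis using subspace_zero[OF NB.dead_subspace[OF P j]] by simp
    qed
    ultimately show "z \<in> Z s" using Zgam[OF x'] by simp
  qed
  define row where "row h j = (\<lambda>i. h (i, j))" for h :: "'i \<times> 'j \<Rightarrow> 'k" and j
  have row: "row h j \<in> coord_space K (alive I a b (s - D j))" if "h \<in> coord_space K (\<alpha> s)" for h j s
    using that by (auto simp: row_def coord_space_def \<alpha>)
  \<comment> \<open>One summand of the connecting homomorphism: apply \<open>\<delta> 0\<close> to
    \<open>x\<close>, pull the result back along the transition map to \<open>y\<close>, and apply
    \<open>\<epsilon>\<close> at time \<open>s - D j\<close>. For infinite \<open>d j\<close> only
    zero is dead, so \<open>\<delta> 0\<close> must kill \<open>x\<close>; \<open>g\<close> is left
    free there, since \<open>row h j\<close> is zero anyway.\<close>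
  define link where "link s j x g \<longleftrightarrow> (if d j = \<infinity> then \<delta> 0 (s - c j) x = \<zero>\<^bsub>pm_ob (P 0) (s - c j)\<^esub>
      else \<exists>y\<in>carrier (pm_ob (P 0) (s - D j)).
        \<delta> 0 (s - c j) x = pm_tr (P 0) (s - D j) (s - c j) y \<and> \<epsilon> (s - D j) y = g)" for s j x g
  define \<rho> where "\<rho> s z h \<longleftrightarrow> h \<in> coord_space K (\<alpha> s) \<and>
      (\<exists>x\<in>?f1 s. z = ?g1 s x \<and> (\<forall>j\<in>J. link s j (x j) (row h j)))" for s z h
  have ptr: "pm_tr (P n) (s - D j) (s - c j) \<in> lin_maps K (pm_ob (P n) (s - D j)) (pm_ob (P n) (s - c j))"
    if "j \<in> J" "d j \<noteq> \<infinity>" for n s j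
    using D(2)[OF that] by (intro pm_tr_lin[OF P]) simp
  have deadD: "NB.dead (P n) s j = pm_tr (P n) (s - D j) (s - c j) ` carrier (pm_ob (P n) (s - D j))"
    if "d j \<noteq> \<infinity>" for n s j
    using that by (simp add: NB.dead_def D_def)
  have dead_inf: "NB.dead (P n) s j = {\<zero>\<^bsub>pm_ob (P n) (s - c j)\<^esub>}" if "d j = \<infinity>" for n s j
    using that by (simp add: NB.dead_def)
  have link_dead: "\<delta> 0 (s - c j) x \<in> NB.dead (P 0) s j" if "link s j x g" for s j x g
    using that by (cases "d j = \<infinity>") (auto simp: link_def deadD dead_inf)
  have dom: "z \<in> Z s \<and> h \<in> carrier (pm_ob W s)" if r: "\<rho> s z h" for s z h
    using r link_dead Zgam unfolding \<rho>_def WC by blast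
  have total: "\<exists>h. \<rho> s z h" if z: "z \<in> Z s" for s z
  proof -
    have "z \<in> carrier (pm_ob T s)" using subspace_subset[OF Zs z] .
    then obtain x where x: "x \<in> ?f1 s" "z = ?g1 s x" using NB.gam_surj[OF P] unfolding T_def by blast
    have xd: "\<delta> 0 (s - c j) (x j) \<in> NB.dead (P 0) s j" if "j \<in> J" for j
      using z Zgam[OF x(1)] that unfolding x(2) by blast
    have "\<forall>j. \<exists>y. j \<in> J \<and> d j \<noteq> \<infinity> \<longrightarrow> y \<in> carrier (pm_ob (P 0) (s - D j)) \<and>
        \<delta> 0 (s - c j) (x j) = pm_tr (P 0) (s - D j) (s - c j) y"
      using xd deadD by blast
    from choice[OF this] obtain y where y: "\<And>j. j \<in> J \<Longrightarrow> d j \<noteq> \<infinity> \<Longrightarrow> y j \<in> carrier (pm_ob (P 0) (s - D j))"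
      "\<And>j. j \<in> J \<Longrightarrow> d j \<noteq> \<infinity> \<Longrightarrow> \<delta> 0 (s - c j) (x j) = pm_tr (P 0) (s - D j) (s - c j) (y j)" by blast
    define h where "h = (\<lambda>(i, j). if j \<in> J \<and> d j \<noteq> \<infinity> then \<epsilon> (s - D j) (y j) i else \<zero>\<^bsub>K\<^esub>)"
    \<comment> \<open>Moved to \<open>s - c j\<close>, the vector \<open>\<epsilon>\<close> of
      \<open>y\<close> becomes \<open>\<epsilon>\<close> applied to an image of
      \<open>\<delta> 0\<close>, which is zero. So its coordinates lie on bars that die in
      between.\<close>
    have gone: "\<epsilon> (s - D j) (y j) i = \<zero>\<^bsub>K\<^esub>" if j: "j \<in> J" "d j \<noteq> \<infinity>" and i: "i \<in> alive I a b (s - c j)" for i j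
    proof -
      have le: "s - D j \<le> s - c j" using D(2)[OF j] by simp
      have "pm_tr S (s - D j) (s - c j) (\<epsilon> (s - D j) (y j)) = \<epsilon> (s - c j) (\<delta> 0 (s - c j) (x j))"
        using pm_homs_natural[OF \<epsilon>[folded S_def] le y(1)[OF j]] y(2)[OF j] by simp
      also have "\<dots> = (\<lambda>_. \<zero>\<^bsub>K\<^esub>)" using \<epsilon>\<delta> NB.famD[OF x(1) j(1)] unfolding S0 by blast
      finally have "(if i \<in> alive I a b (s - c j) then \<epsilon> (s - D j) (y j) i else \<zero>\<^bsub>K\<^esub>) = \<zero>\<^bsub>K\<^esub>"
        unfolding Str[OF \<epsilon>coord[OF y(1)[OF j]]] by (rule fun_cong)
      then show ?thesis using i by simp
    qed
    have "h (i, j) \<in> carrier K \<and> ((i, j) \<notin> \<alpha> s \<longrightarrow> h (i, j) = \<zero>\<^bsub>K\<^esub>)" for i j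
    proof (cases "j \<in> J \<and> d j \<noteq> \<infinity>")
      case True
      then have "\<epsilon> (s - D j) (y j) \<in> coord_space K (alive I a b (s - D j))" using \<epsilon>coord y(1) by blast
      then show ?thesis using True gone[of j i] by (auto simp: h_def \<alpha> coord_space_def)
    qed (auto simp: h_def)
    then have h: "h \<in> coord_space K (\<alpha> s)" by (simp add: coord_space_def)
    have "link s j (x j) (row h j)" if j: "j \<in> J" for j
    proof (cases "d j = \<infinity>")
      case True
      then show ?thesis using xd[OF j] dead_inf[OF True] by (simp add: link_def)
    next
      case False
      then show ?thesis
        using y j by (auto simp: link_def row_def h_def intro!: bexI[of _ "y j"])
    qed
    then have "\<rho> s z h" unfolding \<rho>_def using h x by blast
    then show ?thesis by blast
  qed
  have onto: "\<exists>z. \<rho> s z h" if "h \<in> carrier (pm_ob W s)" for s h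
  proof -
    have h: "h \<in> coord_space K (\<alpha> s)" using that by (simp add: WC)
    have "\<exists>x. x \<in> carrier (pm_ob (P (Suc 0)) (s - c j)) \<and> link s j x (row h j)" if j: "j \<in> J" for j
    proof (cases "d j = \<infinity>")
      case True
      interpret M1: module K "pm_ob (P (Suc 0)) (s - c j)" by (rule mP)
      have "link s j \<zero>\<^bsub>pm_ob (P (Suc 0)) (s - c j)\<^esub> (row h j)"
        using lin_maps_zero[OF mP mP dl] True by (simp add: link_def)
      then show ?thesis using M1.M.zero_closed by blast
    next
      case False
      \<comment> \<open>The chase run backwards: the kernel element lifts along
        \<open>\<epsilon>\<close> to \<open>y\<close>, and \<open>\<epsilon>\<close> kills
        \<open>y\<close> moved to \<open>s - c j\<close>, which therefore comes from
        \<open>P (Suc 0)\<close> by exactness.\<close>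
      have "row h j \<in> \<epsilon> (s - D j) ` carrier (pm_ob (P 0) (s - D j))"
        using epi row[OF h] by (simp add: pm_epi_def S_def[symmetric] SC)
      then obtain y where y: "y \<in> carrier (pm_ob (P 0) (s - D j))" "\<epsilon> (s - D j) y = row h j" by auto
      have le: "s - D j \<le> s - c j" using D(2)[OF j False] by simp
      have "\<epsilon> (s - c j) (pm_tr (P 0) (s - D j) (s - c j) y) = pm_tr S (s - D j) (s - c j) (row h j)"
        using pm_homs_natural[OF \<epsilon>[folded S_def] le y(1)] y(2) by simp
      also have "\<dots> = \<zero>\<^bsub>pm_ob S (s - c j)\<^esub>"
        unfolding Str[OF row[OF h]] S0 using h by (auto simp: row_def coord_space_def \<alpha>)
      finally obtain x where "x \<in> carrier (pm_ob (P (Suc 0)) (s - c j))"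
        "pm_tr (P 0) (s - D j) (s - c j) y = \<delta> 0 (s - c j) x"
        using \<epsilon>\<delta> lin_maps_closed[OF ptr[OF j False] y(1)] by blast
      then show ?thesis using y False by (auto simp: link_def intro!: exI[of _ x] bexI[of _ y])
    qed
    then have "\<forall>j\<in>J. \<exists>x. x \<in> carrier (pm_ob (P (Suc 0)) (s - c j)) \<and> link s j x (row h j)" by blast
    from bchoice[OF this] obtain x where x: "\<forall>j\<in>J. x j \<in> carrier (pm_ob (P (Suc 0)) (s - c j)) \<and>
        link s j (x j) (row h j)" by (elim exE) (rule that)
    then have "x \<in> ?f1 s" by (simp add: NB.fam_def)
    then have "\<rho> s (?g1 s x) h" unfolding \<rho>_def using h x by blast
    then show ?thesis by blast
  qed
  have add: "\<rho> s (z \<oplus>\<^bsub>pm_ob T s\<^esub> z') (h \<oplus>\<^bsub>pm_ob W s\<^esub> h')" if r: "\<rho> s z h" "\<rho> s z' h'" for s z h z' h'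
  proof -
    have h: "h \<in> coord_space K (\<alpha> s)" "h' \<in> coord_space K (\<alpha> s)" using r by (auto simp: \<rho>_def)
    obtain x where x: "x \<in> ?f1 s" "z = ?g1 s x" "\<And>j. j \<in> J \<Longrightarrow> link s j (x j) (row h j)"
      using r(1) unfolding \<rho>_def by blast
    obtain x' where x': "x' \<in> ?f1 s" "z' = ?g1 s x'" "\<And>j. j \<in> J \<Longrightarrow> link s j (x' j) (row h' j)"
      using r(2) unfolding \<rho>_def by blast
    let ?x = "\<lambda>j. x j \<oplus>\<^bsub>pm_ob (P (Suc 0)) (s - c j)\<^esub> x' j"
    have hh: "h \<oplus>\<^bsub>pm_ob W s\<^esub> h' = (\<lambda>i. h i \<oplus>\<^bsub>K\<^esub> h' i)"
      unfolding W_def using h by (intro bars_add[OF K]) (simp_all add: \<alpha>_def)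
    have "link s j (?x j) (row (h \<oplus>\<^bsub>pm_ob W s\<^esub> h') j)" if j: "j \<in> J" for j
    proof (cases "d j = \<infinity>")
      case True
      interpret M0: module K "pm_ob (P 0) (s - c j)" by (rule mP)
      show ?thesis
        using x(3)[OF j] x'(3)[OF j] lin_maps_add[OF dl NB.famD[OF x(1) j] NB.famD[OF x'(1) j]] True
        by (simp add: link_def)
    next
      case False
      obtain y where y: "y \<in> carrier (pm_ob (P 0) (s - D j))"
        "\<delta> 0 (s - c j) (x j) = pm_tr (P 0) (s - D j) (s - c j) y" "\<epsilon> (s - D j) y = row h j"
        using x(3)[OF j] False by (auto simp: link_def)
      obtain y' where y': "y' \<in> carrier (pm_ob (P 0) (s - D j))"
        "\<delta> 0 (s - c j) (x' j) = pm_tr (P 0) (s - D j) (s - c j) y'" "\<epsilon> (s - D j) y' = row h' j"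
        using x'(3)[OF j] False by (auto simp: link_def)
      interpret M0: module K "pm_ob (P 0) (s - D j)" by (rule mP)
      have "\<epsilon> (s - D j) (y \<oplus>\<^bsub>pm_ob (P 0) (s - D j)\<^esub> y') = row (h \<oplus>\<^bsub>pm_ob W s\<^esub> h') j"
        using lin_maps_add[OF el y(1) y'(1)] y(3) y'(3) bars_add[OF K row[OF h(1)] row[OF h(2)]]
        by (simp add: S_def hh row_def)
      moreover have "\<delta> 0 (s - c j) (?x j)
          = pm_tr (P 0) (s - D j) (s - c j) (y \<oplus>\<^bsub>pm_ob (P 0) (s - D j)\<^esub> y')"
        using lin_maps_add[OF ptr[OF j False] y(1) y'(1)]
          lin_maps_add[OF dl NB.famD[OF x(1) j] NB.famD[OF x'(1) j]] y(2) y'(2) by simp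
      ultimately show ?thesis
        using False M0.M.a_closed[OF y(1) y'(1)] unfolding link_def by auto
    qed
    moreover have "z \<oplus>\<^bsub>pm_ob T s\<^esub> z' = ?g1 s ?x"
      unfolding x(2) x'(2) T_def by (rule NB.gam_add[OF P x(1) x'(1), symmetric])
    moreover have "h \<oplus>\<^bsub>pm_ob W s\<^esub> h' \<in> coord_space K (\<alpha> s)"
      using h by (simp add: hh coord_space_def)
    ultimately show ?thesis unfolding \<rho>_def using NB.fam_add[OF P x(1) x'(1)] by blast
  qed
  have smult: "\<rho> s (k \<odot>\<^bsub>pm_ob T s\<^esub> z) (k \<odot>\<^bsub>pm_ob W s\<^esub> h)" if k: "k \<in> carrier K" and r: "\<rho> s z h" for s k z h
  proof -
    have h: "h \<in> coord_space K (\<alpha> s)" using r by (auto simp: \<rho>_def)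
    obtain x where x: "x \<in> ?f1 s" "z = ?g1 s x" "\<And>j. j \<in> J \<Longrightarrow> link s j (x j) (row h j)"
      using r unfolding \<rho>_def by blast
    let ?x = "\<lambda>j. k \<odot>\<^bsub>pm_ob (P (Suc 0)) (s - c j)\<^esub> x j"
    have hh: "k \<odot>\<^bsub>pm_ob W s\<^esub> h = (\<lambda>i. k \<otimes>\<^bsub>K\<^esub> h i)"
      unfolding W_def using h k by (intro bars_smult[OF K]) (simp_all add: \<alpha>_def)
    have "link s j (?x j) (row (k \<odot>\<^bsub>pm_ob W s\<^esub> h) j)" if j: "j \<in> J" for j
    proof (cases "d j = \<infinity>")
      case True
      interpret M0: module K "pm_ob (P 0) (s - c j)" by (rule mP)
      show ?thesis
        using x(3)[OF j] lin_maps_smult[OF dl k NB.famD[OF x(1) j]] True k by (simp add: link_def)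
    next
      case False
      obtain y where y: "y \<in> carrier (pm_ob (P 0) (s - D j))"
        "\<delta> 0 (s - c j) (x j) = pm_tr (P 0) (s - D j) (s - c j) y" "\<epsilon> (s - D j) y = row h j"
        using x(3)[OF j] False by (auto simp: link_def)
      interpret M0: module K "pm_ob (P 0) (s - D j)" by (rule mP)
      have "\<epsilon> (s - D j) (k \<odot>\<^bsub>pm_ob (P 0) (s - D j)\<^esub> y) = row (k \<odot>\<^bsub>pm_ob W s\<^esub> h) j"
        using lin_maps_smult[OF el k y(1)] y(3) bars_smult[OF K row[OF h] k]
        by (simp add: S_def hh row_def)
      moreover have "\<delta> 0 (s - c j) (?x j)
          = pm_tr (P 0) (s - D j) (s - c j) (k \<odot>\<^bsub>pm_ob (P 0) (s - D j)\<^esub> y)"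
        using lin_maps_smult[OF ptr[OF j False] k y(1)] lin_maps_smult[OF dl k NB.famD[OF x(1) j]] y(2)
        by simp
      ultimately show ?thesis
        using False M0.smult_closed[OF k y(1)] unfolding link_def by auto
    qed
    moreover have "k \<odot>\<^bsub>pm_ob T s\<^esub> z = ?g1 s ?x"
      unfolding x(2) T_def by (rule NB.gam_smult[OF P x(1) k, symmetric])
    moreover have "k \<odot>\<^bsub>pm_ob W s\<^esub> h \<in> coord_space K (\<alpha> s)"
      using h k by (simp add: hh coord_space_def)
    ultimately show ?thesis unfolding \<rho>_def using NB.fam_smult[OF P x(1) k] by blast
  qed
  have ker: "z \<in> Bd s \<longleftrightarrow> h = \<zero>\<^bsub>pm_ob W s\<^esub>" if r: "\<rho> s z h" for s z h
  proof -
    have h: "h \<in> coord_space K (\<alpha> s)" using r by (auto simp: \<rho>_def)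
    obtain x where x: "x \<in> ?f1 s" "z = ?g1 s x" "\<And>j. j \<in> J \<Longrightarrow> link s j (x j) (row h j)"
      using r unfolding \<rho>_def by blast
    show ?thesis
    proof
      assume "z \<in> Bd s"
      then obtain w where w: "w \<in> NB.fam (P (Suc (Suc 0))) s" "\<And>j. j \<in> J \<Longrightarrow>
          x j \<ominus>\<^bsub>pm_ob (P (Suc 0)) (s - c j)\<^esub> \<delta> (Suc 0) (s - c j) (w j) \<in> NB.dead (P (Suc 0)) s j"
        using Bgam[OF x(1)] unfolding x(2) by blast
      have "h (i, j) = \<zero>\<^bsub>K\<^esub>" for i j
      proof (cases "j \<in> J \<and> d j \<noteq> \<infinity>")
        case False
        then show ?thesis using h by (auto simp: coord_space_def \<alpha>)
      next
        case True
        then have j: "j \<in> J" and fin: "d j \<noteq> \<infinity>" by auto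
        interpret M0: module K "pm_ob (P 0) (s - c j)" by (rule mP)
        have le: "s - D j \<le> s - c j" using D(2)[OF j fin] by simp
        obtain y where y: "y \<in> carrier (pm_ob (P 0) (s - D j))"
          "\<delta> 0 (s - c j) (x j) = pm_tr (P 0) (s - D j) (s - c j) y" "\<epsilon> (s - D j) y = row h j"
          using x(3)[OF j] fin by (auto simp: link_def)
        let ?w = "\<delta> (Suc 0) (s - c j) (w j)"
        have dw: "?w \<in> carrier (pm_ob (P (Suc 0)) (s - c j))" "\<delta> 0 (s - c j) ?w = \<zero>\<^bsub>pm_ob (P 0) (s - c j)\<^esub>"
          using \<delta>\<delta>[of ?w "s - c j"] NB.famD[OF w(1) j] by blast+
        obtain q where q: "q \<in> carrier (pm_ob (P (Suc 0)) (s - D j))"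
          "x j \<ominus>\<^bsub>pm_ob (P (Suc 0)) (s - c j)\<^esub> ?w = pm_tr (P (Suc 0)) (s - D j) (s - c j) q"
          using w(2)[OF j] unfolding deadD[OF fin] by blast
        have xc: "\<delta> 0 (s - c j) (x j) \<in> carrier (pm_ob (P 0) (s - c j))"
          by (rule lin_maps_closed[OF dl NB.famD[OF x(1) j]])
        have "pm_tr (P 0) (s - D j) (s - c j) y
            = \<delta> 0 (s - c j) (x j \<ominus>\<^bsub>pm_ob (P (Suc 0)) (s - c j)\<^esub> ?w)"
          using lin_maps_minus[OF mP mP dl NB.famD[OF x(1) j] dw(1)] dw(2) y(2) xc
          by (simp add: a_minus_def)
        also have "\<dots> = pm_tr (P 0) (s - D j) (s - c j) (\<delta> 0 (s - D j) q)"
          unfolding q(2) by (rule pm_homs_natural[OF \<delta> le q(1)])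
        \<comment> \<open>Injectivity of the transition maps of \<open>P 0\<close> enters here: it
          carries the equality at \<open>s - c j\<close> back to \<open>s - D j\<close>, where
          \<open>\<epsilon>\<close> can be applied.\<close>
        finally have "y = \<delta> 0 (s - D j) q"
          by (rule inj[OF le y(1) lin_maps_closed[OF dl q(1)]])
        then have "row h j = (\<lambda>_. \<zero>\<^bsub>K\<^esub>)" using \<epsilon>\<delta>[of y "s - D j"] q(1) y(3) S0 by auto
        then show ?thesis by (simp add: row_def fun_eq_iff)
      qed
      then show "h = \<zero>\<^bsub>pm_ob W s\<^esub>" by (auto simp: W0)
    next
      assume h0: "h = \<zero>\<^bsub>pm_ob W s\<^esub>"
      have "\<exists>w. w \<in> carrier (pm_ob (P (Suc (Suc 0))) (s - c j)) \<and>
          x j \<ominus>\<^bsub>pm_ob (P (Suc 0)) (s - c j)\<^esub> \<delta> (Suc 0) (s - c j) w \<in> NB.dead (P (Suc 0)) s j"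
        if j: "j \<in> J" for j
      proof (cases "d j = \<infinity>")
        case True
        then obtain w where w: "w \<in> carrier (pm_ob (P (Suc (Suc 0))) (s - c j))" "x j = \<delta> (Suc 0) (s - c j) w"
          using x(3)[OF j] \<delta>\<delta>[of "x j" "s - c j"] NB.famD[OF x(1) j] by (auto simp: link_def)
        then show ?thesis
          using module_minus_self[OF mP NB.famD[OF x(1) j]] dead_inf[OF True]
          by (intro exI[of _ w]) simp
      next
        case False
        interpret M1: module K "pm_ob (P (Suc 0)) (s - c j)" by (rule mP)
        have le: "s - D j \<le> s - c j" using D(2)[OF j False] by simp
        obtain y where y: "y \<in> carrier (pm_ob (P 0) (s - D j))"
          "\<delta> 0 (s - c j) (x j) = pm_tr (P 0) (s - D j) (s - c j) y" "\<epsilon> (s - D j) y = row h j"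
          using x(3)[OF j] False by (auto simp: link_def)
        have "\<epsilon> (s - D j) y = \<zero>\<^bsub>pm_ob S (s - D j)\<^esub>" using y(3) h0 by (simp add: row_def S0 W0)
        then obtain q where q: "q \<in> carrier (pm_ob (P (Suc 0)) (s - D j))" "y = \<delta> 0 (s - D j) q"
          using \<epsilon>\<delta>[of y "s - D j"] y(1) by blast
        \<comment> \<open>\<open>x j\<close> and the transported \<open>q\<close> have the same
          differential, so by exactness they differ by an image of \<open>\<delta> (Suc 0)\<close>,
          and the transported \<open>q\<close> is dead.\<close>
        let ?q = "pm_tr (P (Suc 0)) (s - D j) (s - c j) q"
        have qc: "?q \<in> carrier (pm_ob (P (Suc 0)) (s - c j))"
          by (rule lin_maps_closed[OF ptr[OF j False] q(1)])
        have "\<delta> 0 (s - c j) (x j) = \<delta> 0 (s - c j) ?q"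
          using pm_homs_natural[OF \<delta> le q(1)] y(2) q(2) by simp
        then have "\<delta> 0 (s - c j) (x j \<ominus>\<^bsub>pm_ob (P (Suc 0)) (s - c j)\<^esub> ?q) = \<zero>\<^bsub>pm_ob (P 0) (s - c j)\<^esub>"
          using lin_maps_minus[OF mP mP dl NB.famD[OF x(1) j] qc]
            module_minus_self[OF mP lin_maps_closed[OF dl qc]] by simp
        then obtain w where w: "w \<in> carrier (pm_ob (P (Suc (Suc 0))) (s - c j))"
          "x j \<ominus>\<^bsub>pm_ob (P (Suc 0)) (s - c j)\<^esub> ?q = \<delta> (Suc 0) (s - c j) w"
          using \<delta>\<delta>[of "x j \<ominus>\<^bsub>pm_ob (P (Suc 0)) (s - c j)\<^esub> ?q" "s - c j"]
            M1.M.minus_closed[OF NB.famD[OF x(1) j] qc] by blast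
        have "x j \<ominus>\<^bsub>pm_ob (P (Suc 0)) (s - c j)\<^esub> \<delta> (Suc 0) (s - c j) w = ?q"
          unfolding w(2)[symmetric] using NB.famD[OF x(1) j] qc
          by (simp add: a_minus_def M1.M.minus_add M1.M.a_assoc[symmetric] M1.M.r_neg)
        then show ?thesis using w(1) q(1) unfolding deadD[OF False] by blast
      qed
      then have "\<forall>j\<in>J. \<exists>w. w \<in> carrier (pm_ob (P (Suc (Suc 0))) (s - c j)) \<and>
          x j \<ominus>\<^bsub>pm_ob (P (Suc 0)) (s - c j)\<^esub> \<delta> (Suc 0) (s - c j) w \<in> NB.dead (P (Suc 0)) s j" by blast
      from bchoice[OF this] obtain w where
        w: "\<forall>j\<in>J. w j \<in> carrier (pm_ob (P (Suc (Suc 0))) (s - c j)) \<and>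
          x j \<ominus>\<^bsub>pm_ob (P (Suc 0)) (s - c j)\<^esub> \<delta> (Suc 0) (s - c j) (w j) \<in> NB.dead (P (Suc 0)) s j"
        by (elim exE) (rule that)
      then have "w \<in> NB.fam (P (Suc (Suc 0))) s" by (simp add: NB.fam_def)
      then show "z \<in> Bd s" unfolding x(2) Bgam[OF x(1)] using w by blast
    qed
  qed
  have nat: "\<rho> t (pm_tr T s t z) (pm_tr W s t h)" if st: "s \<le> t" and r: "\<rho> s z h" for s t z h
  proof -
    have h: "h \<in> coord_space K (\<alpha> s)" using r by (auto simp: \<rho>_def)
    obtain x where x: "x \<in> ?f1 s" "z = ?g1 s x" "\<And>j. j \<in> J \<Longrightarrow> link s j (x j) (row h j)"
      using r unfolding \<rho>_def by blast
    let ?x = "\<lambda>j. pm_tr (P (Suc 0)) (s - c j) (t - c j) (x j)"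
    have trh: "pm_tr W s t h = (\<lambda>i. if i \<in> \<alpha> t then h i else \<zero>\<^bsub>K\<^esub>)"
      using bars_tr[OF K h[unfolded \<alpha>_def], of t] by (simp add: W_def \<alpha>_def)
    have "link t j (?x j) (row (pm_tr W s t h) j)" if j: "j \<in> J" for j
    proof -
      have sc: "s - c j \<le> t - c j" and sD: "s - D j \<le> t - D j" using st by simp_all
      have n: "\<delta> 0 (t - c j) (?x j) = pm_tr (P 0) (s - c j) (t - c j) (\<delta> 0 (s - c j) (x j))"
        by (rule pm_homs_natural[OF \<delta> sc NB.famD[OF x(1) j]])
      show ?thesis
      proof (cases "d j = \<infinity>")
        case True
        then show ?thesis
          using x(3)[OF j] n lin_maps_zero[OF mP mP pm_tr_lin[OF P sc]] by (simp add: link_def)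
      next
        case False
        obtain y where y: "y \<in> carrier (pm_ob (P 0) (s - D j))"
          "\<delta> 0 (s - c j) (x j) = pm_tr (P 0) (s - D j) (s - c j) y" "\<epsilon> (s - D j) y = row h j"
          using x(3)[OF j] False by (auto simp: link_def)
        let ?y = "pm_tr (P 0) (s - D j) (t - D j) y"
        have yc: "?y \<in> carrier (pm_ob (P 0) (t - D j))" by (rule lin_maps_closed[OF pm_tr_lin[OF P sD] y(1)])
        have Dc: "s - D j \<le> s - c j" "t - D j \<le> t - c j" using D(2)[OF j False] by simp_all
        have "\<delta> 0 (t - c j) (?x j) = pm_tr (P 0) (s - D j) (t - c j) y"
          unfolding n y(2) by (rule persistence_module.tr_trans[OF P Dc(1) sc y(1)])
        also have "\<dots> = pm_tr (P 0) (t - D j) (t - c j) ?y"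
          by (rule persistence_module.tr_trans[OF P sD Dc(2) y(1), symmetric])
        finally have 1: "\<delta> 0 (t - c j) (?x j) = pm_tr (P 0) (t - D j) (t - c j) ?y" .
        have "\<epsilon> (t - D j) ?y = pm_tr S (s - D j) (t - D j) (row h j)"
          using pm_homs_natural[OF \<epsilon>[folded S_def] sD y(1)] y(3) by simp
        also have "\<dots> = (\<lambda>i. if i \<in> alive I a b (t - D j) then h (i, j) else \<zero>\<^bsub>K\<^esub>)"
          unfolding Str[OF row[OF h]] by (auto simp: row_def fun_eq_iff)
        also have "\<dots> = row (pm_tr W s t h) j"
        proof
          fix i
          show "(if i \<in> alive I a b (t - D j) then h (i, j) else \<zero>\<^bsub>K\<^esub>) = row (pm_tr W s t h) j i"
          proof (cases "h (i, j) = \<zero>\<^bsub>K\<^esub>")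
            case False
            then have "(i, j) \<in> \<alpha> s" using h by (auto simp: coord_space_def)
            then have "i \<in> alive I a b (s - D j)" "i \<notin> alive I a b (s - c j)" by (simp_all add: \<alpha>)
            \<comment> \<open>A bar that has ended by \<open>s - c j\<close> has also ended by
              \<open>t - c j\<close>, so membership in \<open>\<alpha> t\<close> reduces to being
              alive at \<open>t - D j\<close>.\<close>
            then have "i \<notin> alive I a b (t - c j)"
              using Dc(1) sc by (cases "b i") (auto simp: alive_def)
            then have "(i, j) \<in> \<alpha> t \<longleftrightarrow> i \<in> alive I a b (t - D j)"
              using j \<open>d j \<noteq> \<infinity>\<close> by (simp add: \<alpha>)
            then show ?thesis by (simp add: row_def trh)
          qed (simp add: row_def trh)
        qed
        finally show ?thesis using 1 yc False by (auto simp: link_def)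
      qed
    qed
    moreover have "pm_tr T s t z = ?g1 t ?x"
      unfolding T_def x(2) by (rule NB.gam_tr[OF P st x(1)])
    moreover have "pm_tr W s t h \<in> coord_space K (\<alpha> t)"
      using h by (simp add: trh coord_space_def)
    ultimately show ?thesis unfolding \<rho>_def using NB.fam_tr[OF P st x(1)] by blast
  qed
  define f where "f s X = (THE h. \<exists>z\<in>X. \<rho> s z h)" for s X
  note quot = relation_quotient_iso[of K "pm_ob T s" "pm_ob W s" "Z s" "Bd s" "\<rho> s" for s,
      OF mT(1) mW Zs Bs BZ dom total onto add smult ker, folded Tor_ob f_def]
  have rel: "module K (pm_ob (pm_Tor K P \<delta> N 1) s)"
    "submodule (Bd s) K (pm_ob T s\<lparr>carrier := Z s\<rparr>)"
    "f s \<in> lin_maps K (pm_ob (pm_Tor K P \<delta> N 1) s) (pm_ob W s)"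
    "bij_betw (f s) (carrier (pm_ob (pm_Tor K P \<delta> N 1) s)) (carrier (pm_ob W s))" for s
    by (rule quot; assumption)+
  have rel_f: "f s (Bd s +>\<^bsub>pm_ob T s\<lparr>carrier := Z s\<rparr>\<^esub> z) = h" if "\<rho> s z h" for s z h
    by (rule quot(5); (assumption | rule that))
  show "module K (pm_ob (pm_Tor K P \<delta> N 1) t)" by (rule rel(1))
  have "f \<in> pm_homs K (pm_Tor K P \<delta> N 1) W"
    unfolding pm_homs_def
  proof (intro CollectI conjI allI impI ballI rel(3))
    fix s t :: real and X
    assume st: "s \<le> t" and "X \<in> carrier (pm_ob (pm_Tor K P \<delta> N 1) s)"
    then obtain z where z: "z \<in> Z s" "X = Bd s +>\<^bsub>pm_ob T s\<lparr>carrier := Z s\<rparr>\<^esub> z"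
      unfolding Tor_ob quot_carrier by auto
    obtain h where r: "\<rho> s z h" using total[OF z(1)] by blast
    note r' = nat[OF st r]
    have mZ: "module K (pm_ob T s\<lparr>carrier := Z s\<rparr>)" for s
      by (rule submodule.submodule_is_module[OF Zs mT(1)])
    have ttl: "pm_tr T s t \<in> lin_maps K (pm_ob T s) (pm_ob T t)"
      unfolding T_def by (rule pm_tensor_tr_lin[OF P N st])
    \<comment> \<open>That transition maps preserve cycles, and below also boundaries, is read off
      from the compatibility of \<open>\<rho>\<close> with time.\<close>
    have trZ: "pm_tr T s t v \<in> Z t" if v: "v \<in> Z s" for v
    proof -
      obtain g where "\<rho> s v g" using total[OF v] by blast
      then show ?thesis using dom[OF nat[OF st]] by blast
    qed
    have "pm_tr T s t \<in> lin_maps K (pm_ob T s\<lparr>carrier := Z s\<rparr>) (pm_ob T t\<lparr>carrier := Z t\<rparr>)"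
      using trZ subspace_subset[OF Zs] lin_maps_add[OF ttl] lin_maps_smult[OF ttl]
      by (intro lin_mapsI) simp_all
    moreover have "pm_tr T s t ` Bd s \<subseteq> Bd t"
    proof
      fix u assume "u \<in> pm_tr T s t ` Bd s"
      then obtain v where v: "v \<in> Bd s" "u = pm_tr T s t v" by auto
      obtain g where g: "\<rho> s v g" using total BZ v(1) by blast
      have "g = \<zero>\<^bsub>pm_ob W s\<^esub>" using ker[OF g] v(1) by simp
      moreover have "pm_tr W s t \<zero>\<^bsub>pm_ob W s\<^esub> = \<zero>\<^bsub>pm_ob W t\<^esub>"
        using lin_maps_zero[OF mW mW pm_tr_lin[OF _ st]] bars_persistence_module[OF K finU]
        unfolding W_def by blast
      ultimately show "u \<in> Bd t" using ker[OF nat[OF st g]] v(2) by simp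
    qed
    ultimately have "pm_tr (pm_Tor K P \<delta> N 1) s t X = Bd t +>\<^bsub>pm_ob T t\<lparr>carrier := Z t\<rparr>\<^esub> pm_tr T s t z"
      unfolding Tor_tr z(2) using z(1) by (intro quot_map_coset[OF mZ mZ rel(2) rel(2)]) simp_all
    then show "f t (pm_tr (pm_Tor K P \<delta> N 1) s t X) = pm_tr W s t (f s X)"
      using rel_f[OF r'] rel_f[OF r] z(2) by simp
  qed
  then show "pm_isomorphic K (pm_Tor K P \<delta> N 1) (bars K {(i, j) \<in> I \<times> J. b i \<noteq> \<infinity> \<and> d j \<noteq> \<infinity>}
      (\<lambda>(i, j). max (a i + real_of_ereal (d j)) (real_of_ereal (b i) + c j)) (\<lambda>(i, j). b i + d j))"
    unfolding pm_isomorphic_def using rel(4) by (auto simp: W_def U_def D_def)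
qed


section \<open>The magnitude of the tensor product\<close>

text \<open>Multiplying out gives four exponentials. For finite bars the terms at
  \<open>a + d\<close> and \<open>b + c\<close> are redistributed over minimum and maximum; with an
  infinite end the terms containing it vanish, and the minimum picks whichever end remains.\<close>

lemma magnitude_bar_product:
  assumes "ereal a < b" "ereal c < d"
  shows "(exp (- a) - exp_neg b) * (exp (- c) - exp_neg d) =
    (exp (- (a + c)) - exp_neg (min (ereal a + d) (b + ereal c))) -
    (if b \<noteq> \<infinity> \<and> d \<noteq> \<infinity>
     then exp (- max (a + real_of_ereal d) (real_of_ereal b + c)) - exp_neg (b + d) else 0)"
proof (cases "b = \<infinity> \<or> d = \<infinity>")
  case True
  then show ?thesis
    using assms
    by (cases b; cases d) (simp_all add: exp_neg_def exp_add[symmetric] algebra_simps)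
next
  case False
  then obtain b' d' where bd: "b = ereal b'" "d = ereal d'"
    using assms by (cases b; cases d) auto
  have e: "exp_neg (ereal x) = exp (- x)" for x by (simp add: exp_neg_def)
  have m: "min (ereal (a + d')) (ereal (b' + c)) = ereal (min (a + d') (b' + c))"
    by (simp add: min_def)
  have "exp (- min (a + d') (b' + c)) + exp (- max (a + d') (b' + c)) = exp (- (a + d')) + exp (- (b' + c))"
    by (simp add: min_def max_def)
  moreover have "(exp (- a) - exp (- b')) * (exp (- c) - exp (- d'))
      = exp (- (a + c)) - exp (- (a + d')) - exp (- (b' + c)) + exp (- (b' + d'))"
    by (simp add: exp_add[symmetric] algebra_simps)
  ultimately show ?thesis
    unfolding bd plus_ereal.simps m e by simp
qed

theorem proposition5p14:
  fixes K :: "('k, 'm) ring_scheme"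
    and M :: "('k, 'a) persmod" and N :: "('k, 'b) persmod"
    and P :: "nat \<Rightarrow> ('k, 'p) persmod" and d :: "nat \<Rightarrow> real \<Rightarrow> 'p \<Rightarrow> 'p"
    and \<epsilon> :: "real \<Rightarrow> 'p \<Rightarrow> 'a"
  assumes "field K"
    and "finitely_presented K M"
    and "finitely_presented K N"
    and "projective_resolution K M P d \<epsilon>"
  shows "persistent_magnitude K M * persistent_magnitude K N =
    persistent_magnitude K (pm_tensor K M N) - persistent_magnitude K (pm_Tor K P d N 1)"
proof -
  note K = assms(1)
  have M: "persistence_module K M" and N: "persistence_module K N"
    using assms(2,3) by (auto simp: finitely_presented_def)
  obtain I :: "nat set" and a b \<xi> where I: "finite I" and ab: "\<And>i. i \<in> I \<Longrightarrow> ereal (a i) < b i"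
    and \<xi>: "\<xi> \<in> pm_homs K (bars K I a b) M"
      "\<And>t. bij_betw (\<xi> t) (carrier (pm_ob (bars K I a b) t)) (carrier (pm_ob M t))"
    by (rule finitely_presented_bars[OF K assms(2)]) (rule that; assumption)
  obtain J :: "nat set" and c e \<eta> where J: "finite J" and ce: "\<And>j. j \<in> J \<Longrightarrow> ereal (c j) < e j"
    and \<eta>: "\<eta> \<in> pm_homs K (bars K J c e) N"
      "\<And>t. bij_betw (\<eta> t) (carrier (pm_ob (bars K J c e) t)) (carrier (pm_ob N t))"
    by (rule finitely_presented_bars[OF K assms(3)]) (rule that; assumption)
  define \<zeta> where "\<zeta> t = inv_into (carrier (pm_ob (bars K I a b) t)) (\<xi> t)" for t
  define \<psi> where "\<psi> t = inv_into (carrier (pm_ob (bars K J c e) t)) (\<eta> t)" for t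
  note \<zeta> = pm_iso_inverse[OF K bars_persistence_module[OF K I] \<xi>, folded \<zeta>_def]
  note \<psi> = pm_iso_inverse[OF K bars_persistence_module[OF K J] \<eta>, folded \<psi>_def]
  have MB: "bars_iso K M I a b \<xi> \<zeta>"
    by (rule bars_iso.intro) (fact M I ab \<xi>(1) \<zeta>(1) \<zeta>(3) \<zeta>(4))+
  have NB: "bars_iso K N J c e \<eta> \<psi>"
    by (rule bars_iso.intro) (fact N J ce \<eta>(1) \<psi>(1) \<psi>(3) \<psi>(4))+
  have M_iso: "pm_isomorphic K M (bars K I a b)"
    unfolding pm_isomorphic_def by (rule bexI[OF _ \<zeta>(1)]) (rule allI, rule \<zeta>(2))
  have N_iso: "pm_isomorphic K N (bars K J c e)"
    unfolding pm_isomorphic_def by (rule bexI[OF _ \<psi>(1)]) (rule allI, rule \<psi>(2))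
  let ?U = "{(i, j) \<in> I \<times> J. b i \<noteq> \<infinity> \<and> e j \<noteq> \<infinity>}"
  have proj: "pm_projective K (P n)" and \<delta>: "d n \<in> pm_homs K (P (Suc n)) (P n)"
    and \<epsilon>: "\<epsilon> \<in> pm_homs K (P 0) M" "pm_epi (P 0) M \<epsilon>" "pm_exact (P (Suc 0)) (P 0) M (d 0) \<epsilon>"
    and ex: "pm_exact (P (Suc (Suc n))) (P (Suc n)) (P n) (d (Suc n)) (d n)" for n
    using assms(4) by (simp_all add: projective_resolution_def)
  have P: "persistence_module K (P n)" for n using proj by (simp add: pm_projective_def)
  \<comment> \<open>Composing the augmentation with the isomorphism \<open>\<zeta>\<close> turns the
    given resolution into one of the sum of bars. Terms and differentials, and hence Tor, stay the
    same.\<close>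
  let ?\<epsilon> = "\<lambda>t y. \<zeta> t (\<epsilon> t y)"
  have \<epsilon>': "?\<epsilon> \<in> pm_homs K (P 0) (bars K I a b)" by (rule pm_homs_comp[OF K \<epsilon>(1) \<zeta>(1)])
  have epi: "pm_epi (P 0) (bars K I a b) ?\<epsilon>"
    unfolding pm_epi_def
  proof
    fix t
    have "?\<epsilon> t ` carrier (pm_ob (P 0) t) = \<zeta> t ` (\<epsilon> t ` carrier (pm_ob (P 0) t))"
      by (simp add: image_image)
    also have "\<dots> = carrier (pm_ob (bars K I a b) t)"
      using \<epsilon>(2) \<zeta>(2)[of t] by (simp add: pm_epi_def bij_betw_def)
    finally show "?\<epsilon> t ` carrier (pm_ob (P 0) t) = carrier (pm_ob (bars K I a b) t)" .
  qed
  have ker: "a_kernel (pm_ob (P 0) t) (pm_ob (bars K I a b) t) (?\<epsilon> t)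
      = a_kernel (pm_ob (P 0) t) (pm_ob M t) (\<epsilon> t)" for t
  proof -
    have z: "\<zeta> t \<zero>\<^bsub>pm_ob M t\<^esub> = \<zero>\<^bsub>pm_ob (bars K I a b) t\<^esub>"
      and x: "\<xi> t \<zero>\<^bsub>pm_ob (bars K I a b) t\<^esub> = \<zero>\<^bsub>pm_ob M t\<^esub>"
      using lin_maps_zero[OF pm_module[OF M] bars_module[OF K I] pm_homs_lin[OF \<zeta>(1)]]
        lin_maps_zero[OF bars_module[OF K I] pm_module[OF M] pm_homs_lin[OF \<xi>(1)]] by auto
    have "\<zeta> t (\<epsilon> t y) = \<zero>\<^bsub>pm_ob (bars K I a b) t\<^esub> \<longleftrightarrow> \<epsilon> t y = \<zero>\<^bsub>pm_ob M t\<^esub>"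
      if "y \<in> carrier (pm_ob (P 0) t)" for y
    proof
      assume "\<zeta> t (\<epsilon> t y) = \<zero>\<^bsub>pm_ob (bars K I a b) t\<^esub>"
      then show "\<epsilon> t y = \<zero>\<^bsub>pm_ob M t\<^esub>"
        using \<zeta>(4)[OF lin_maps_closed[OF pm_homs_lin[OF \<epsilon>(1)] that]] x by simp
    qed (simp add: z)
    then show ?thesis
      unfolding a_kernel_def' by (intro Collect_cong conj_cong refl)
  qed
  have ex0: "pm_exact (P (Suc 0)) (P 0) (bars K I a b) (d 0) ?\<epsilon>"
    using \<epsilon>(3) unfolding pm_exact_def ker .
  note Tor = Tor_bars_iso[OF NB I ab P \<delta> \<epsilon>' epi ex0 ex projective_tr_inj[OF proj]]
  have "persistent_magnitude K M = (\<Sum>i\<in>I. exp (- a i) - exp_neg (b i))"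
    by (rule persistent_magnitude_bars[OF K I pm_module[OF M] M_iso ab])
  moreover have "persistent_magnitude K N = (\<Sum>j\<in>J. exp (- c j) - exp_neg (e j))"
    by (rule persistent_magnitude_bars[OF K J pm_module[OF N] N_iso ce])
  moreover have "persistent_magnitude K (pm_tensor K M N) = (\<Sum>q\<in>I \<times> J.
      exp (- (case q of (i, j) \<Rightarrow> a i + c j)) -
      exp_neg (case q of (i, j) \<Rightarrow> min (ereal (a i) + e j) (b i + ereal (c j))))"
  proof (rule persistent_magnitude_bars[OF K _ pm_tensor_module[OF M N] tensor_bars_iso[OF MB NB]])
    fix q assume "q \<in> I \<times> J"
    then obtain i j where q: "q = (i, j)" "ereal (a i) < b i" "ereal (c j) < e j" using ab ce by auto
    then show "ereal (case q of (i, j) \<Rightarrow> a i + c j)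
        < (case q of (i, j) \<Rightarrow> min (ereal (a i) + e j) (b i + ereal (c j)))"
      by (cases "b i"; cases "e j") auto
  qed (use I J in auto)
  moreover have "persistent_magnitude K (pm_Tor K P d N 1) = (\<Sum>q\<in>?U.
      exp (- (case q of (i, j) \<Rightarrow> max (a i + real_of_ereal (e j)) (real_of_ereal (b i) + c j))) -
      exp_neg (case q of (i, j) \<Rightarrow> b i + e j))"
  proof (rule persistent_magnitude_bars[OF K _ Tor])
    show "finite ?U" by (rule finite_subset[of _ "I \<times> J"]) (use I J in auto)
    fix q assume "q \<in> ?U"
    then obtain i j where q: "q = (i, j)" "ereal (a i) < b i" "ereal (c j) < e j" "b i \<noteq> \<infinity>" "e j \<noteq> \<infinity>"
      using ab ce by auto
    \<comment> \<open>The Tor bars are nonempty because both \<open>a i < b i\<close> and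
      \<open>c j < e j\<close> are strict.\<close>
    then show "ereal (case q of (i, j) \<Rightarrow> max (a i + real_of_ereal (e j)) (real_of_ereal (b i) + c j))
        < (case q of (i, j) \<Rightarrow> b i + e j)"
      by (cases "b i"; cases "e j") auto
  qed
  \<comment> \<open>The sum over finite pairs is extended by zero to all pairs, so that it can be
    matched with the product bar by bar.\<close>
  moreover have "\<dots> = (\<Sum>(i, j)\<in>I \<times> J. if b i \<noteq> \<infinity> \<and> e j \<noteq> \<infinity>
      then exp (- max (a i + real_of_ereal (e j)) (real_of_ereal (b i) + c j)) - exp_neg (b i + e j) else 0)"
    using I J by (intro sum.mono_neutral_cong_left) auto
  moreover have "(\<Sum>i\<in>I. exp (- a i) - exp_neg (b i)) * (\<Sum>j\<in>J. exp (- c j) - exp_neg (e j))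
      = (\<Sum>(i, j)\<in>I \<times> J. (exp (- a i) - exp_neg (b i)) * (exp (- c j) - exp_neg (e j)))"
    by (simp add: sum_product sum.cartesian_product)
  moreover have "\<dots> = (\<Sum>(i, j)\<in>I \<times> J.
    (exp (- (a i + c j)) - exp_neg (min (ereal (a i) + e j) (b i + ereal (c j)))) -
    (if b i \<noteq> \<infinity> \<and> e j \<noteq> \<infinity> then
      exp (- max (a i + real_of_ereal (e j)) (real_of_ereal (b i) + c j)) - exp_neg (b i + e j) else 0))"
    by (intro sum.cong refl) (auto simp only: magnitude_bar_product[OF ab ce] split: prod.splits)
  ultimately show ?thesis
    by (simp add: case_prod_beta sum_subtractf)
qed

end
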